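(* Let $T>0$ and let $p\in\{1,2,3\}$. For $k=1,2$, let $\mathfrak{P}^{(k)}=\big(\beta^{(k)}_{ij}\big)_{1\le i,j\le 2}\in\mathcal{A}_p$ (with $\mathcal{A}_1,\mathcal{A}_2,\mathcal{A}_3$ the admissible classes of $2\times2$ matrix-valued functions on $\mathbb{R}^3$ defined in the context) have real-valued entries $\beta^{(k)}_{ij}\in C^\infty(\mathbb{R}^3)$, and let $\overrightarrow{U}^{(k)}=\begin{bmatrix} U^{(k)}_1 \\ U^{(k)}_2 \end{bmatrix}$ solve the initial value problem $$\begin{cases}\left(\Box I_{2\times 2}-\mathfrak{P}^{(k)}(x)\right)\overrightarrow{U}^{(k)}(t,x)=\delta(t,x)\begin{bmatrix}1\\1\end{bmatrix}, & (t,x)\in\mathbb{R}\times\mathbb{R}^3,\\ \overrightarrow{U}^{(k)}(t,x)=\overrightarrow{0}, & (t,x)\in(-\infty,0)\times\mathbb{R}^3.\end{cases}$$ Assume further that the entries are radial: for $k=1,2$ and $1\le i,j\le2$ there is a function $b^{(k)}_{ij}$ on $[0,\infty)$ with $\beta^{(k)}_{ij}(x)=b^{(k)}_{ij}(|x|)$ for every $x\in\mathbb{R}^3$. If $$\overrightarrow{U}^{(1)}(t,0)=\overrightarrow{U}^{(2)}(t,0)\quad\text{for each } t\in(0,T],$$ then $\mathfrak{P}^{(1)}(x)=\mathfrak{P}^{(2)}(x)$ for every $x\in\mathbb{R}^3$ with $|x|\le\frac{T}{2}$.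
   Context: Admissible classes. $\mathcal{A}_1$ is the set of matrix functions $\mathfrak{P}=(\beta_{ij})$ with $\beta_{11}=\beta_{12}=\beta_{21}=\beta_{22}$. $\mathcal{A}_2$ is the set of matrix functions $\begin{bmatrix}\beta&\beta_{12}\\ \beta_{21}&\beta\end{bmatrix}$ in which the off-diagonal entries $\beta_{12},\beta_{21}$ are prescribed (fixed, known functions, the same for all members of the class, hence the same for $k=1$ and $k=2$) while $\beta$ is an arbitrary unknown function. $\mathcal{A}_3$ is the set of matrix functions $\begin{bmatrix}\beta_{11}&\beta\\ \beta&\beta_{22}\end{bmatrix}$ in which the diagonal entries $\beta_{11},\beta_{22}$ are prescribed (the same for $k=1$ and $k=2$) while $\beta$ is an arbitrary unknown function. Here $\Box=\partial_t^2-\Delta_x$ is the wave operator on $\mathbb{R}\times\mathbb{R}^3$, $I_{2\times2}$ is the identity matrix, and $\delta(t,x)$ is the Dirac delta distribution on $\mathbb{R}\times\mathbb{R}^3$ concentrated at $(t,x)=(0,0)$. The initial value problem is understood in the sense of distributions. Its unique solution has the form $$\overrightarrow{U}^{(k)}(t,x)=\frac{\delta(t-|x|)}{4\pi|x|}\begin{bmatrix}1\\1\end{bmatrix}+\mathscr{H}(t-|x|)\,\overrightarrow{R}^{(k)}(t,x),$$ where $\mathscr{H}$ is the Heaviside function and $\overrightarrow{R}^{(k)}$ is a $C^1$ solution in the region $t>|x|$ (up to the cone $t=|x|$) of $(\Box I_{2\times2}-\mathfrak{P}^{(k)})\overrightarrow{R}^{(k)}=\overrightarrow{0}$ with $\overrightarrow{R}^{(k)}(|x|,x)=\frac{1}{8\pi}\int_0^1\mathfrak{P}^{(k)}(sx)\begin{bmatrix}1\\1\end{bmatrix}ds$.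 For $t>0$ the value $\overrightarrow{U}^{(k)}(t,0)$ at the spatial origin is understood as $\overrightarrow{R}^{(k)}(t,0)$. *)

theory Defs
  imports "HOL-Analysis.Analysis"
begin

section \<open>Smooth functions and test functions\<close>

definition partial_derivative :: "'a::euclidean_space \<Rightarrow> ('a \<Rightarrow> real) \<Rightarrow> 'a \<Rightarrow> real" where
  "partial_derivative b f = (\<lambda>x. frechet_derivative f (at x) b)"

definition iterated_partial :: "'a::euclidean_space list \<Rightarrow> ('a \<Rightarrow> real) \<Rightarrow> 'a \<Rightarrow> real" where
  "iterated_partial bs f = foldr partial_derivative bs f"

definition smooth :: "('a::euclidean_space \<Rightarrow> real) \<Rightarrow> bool" where
  "smooth f \<longleftrightarrow> (\<forall>bs\<in>lists Basis. iterated_partial bs f differentiable_on UNIV)"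

definition tsupport :: "('a::euclidean_space \<Rightarrow> real) \<Rightarrow> 'a set" where
  "tsupport f = closure (support_on UNIV f)"

definition test_functions :: "'a::euclidean_space set \<Rightarrow> ('a \<Rightarrow> real) set" where
  "test_functions \<Omega> = {\<phi>. smooth \<phi> \<and> compact (tsupport \<phi>) \<and> tsupport \<phi> \<subseteq> \<Omega>}"


section \<open>Vector-valued distributions on the whole space\<close>

text \<open>
  A distribution with values in \<open>\<real>\<^sup>2\<close> is a function on test functions; its values on
  arguments that are not test functions are irrelevant. Continuity is the usual estimate by
  finitely many derivatives on each compact set: \<open>M\<close> ranges over the upper bounds of the
  derivatives of \<open>\<phi>\<close> of order at most \<open>N\<close>.
\<close>

definition distribution :: "(('a::euclidean_space \<Rightarrow> real) \<Rightarrow> real^2) \<Rightarrow> bool" where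
  "distribution U \<longleftrightarrow>
     (\<forall>\<phi>\<in>test_functions UNIV. \<forall>\<psi>\<in>test_functions UNIV. \<forall>a b.
        U (\<lambda>z. a * \<phi> z + b * \<psi> z) = a *\<^sub>R U \<phi> + b *\<^sub>R U \<psi>) \<and>
     (\<forall>K. compact K \<longrightarrow> (\<exists>C N. \<forall>\<phi>\<in>test_functions K. \<forall>M.
        (\<forall>bs\<in>lists Basis. length bs \<le> N \<longrightarrow> (\<forall>z. \<bar>iterated_partial bs \<phi> z\<bar> \<le> M))
          \<longrightarrow> norm (U \<phi>) \<le> C * M))"

definition function_distribution ::
  "'a::euclidean_space set \<Rightarrow> ('a \<Rightarrow> real^2) \<Rightarrow> ('a \<Rightarrow> real) \<Rightarrow> real^2" where
  "function_distribution S R \<phi> = (LINT z:S|lborel. \<phi> z *\<^sub>R R z)"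


section \<open>The wave system on \<open>\<real> \<times> \<real>\<^sup>3\<close>\<close>

type_synonym spacetime = "real \<times> (real^3)"

definition dalembertian :: "(spacetime \<Rightarrow> real) \<Rightarrow> spacetime \<Rightarrow> real" where
  "dalembertian \<phi> z = iterated_partial [(1, 0), (1, 0)] \<phi> z
             - (\<Sum>e\<in>Basis. iterated_partial [(0, e), (0, e)] \<phi> z)"

text \<open>
  The distribution \<open>(\<box> I - P) U\<close>: \<open>\<box>\<close> is formally self-adjoint, and the product of a
  function \<open>\<beta>\<close> with a scalar distribution \<open>u\<close> is \<open>\<phi> \<mapsto> u (\<beta> \<phi>)\<close>.
\<close>

definition wave_operator ::
  "(real^3 \<Rightarrow> real^2^2) \<Rightarrow> ((spacetime \<Rightarrow> real) \<Rightarrow> real^2)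
     \<Rightarrow> (spacetime \<Rightarrow> real) \<Rightarrow> real^2" where
  "wave_operator P U \<phi> =
     (\<chi> i. U (dalembertian \<phi>) $ i - (\<Sum>j\<in>UNIV. U (\<lambda>(t, x). P x $ i $ j * \<phi> (t, x)) $ j))"

definition solves_ivp ::
  "(real^3 \<Rightarrow> real^2^2) \<Rightarrow> ((spacetime \<Rightarrow> real) \<Rightarrow> real^2) \<Rightarrow> bool" where
  "solves_ivp P U \<longleftrightarrow>
     distribution U \<and>
     (\<forall>\<phi>\<in>test_functions UNIV. wave_operator P U \<phi> = \<phi> (0, 0) *\<^sub>R vec 1) \<and>
     (\<forall>\<phi>\<in>test_functions ({..<0} \<times> UNIV). U \<phi> = 0)"


section \<open>The form of the solution\<close>

definition closed_cone :: "(spacetime) set" where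
  "closed_cone = {(t, x). norm x \<le> t}"

definition open_cone :: "(spacetime) set" where
  "open_cone = {(t, x). norm x < t}"

definition C1_on :: "'a::real_normed_vector set \<Rightarrow> ('a \<Rightarrow> 'b::real_normed_vector) \<Rightarrow> bool" where
  "C1_on S f \<longleftrightarrow> (\<exists>f'. continuous_on S f' \<and>
     (\<forall>z\<in>S. (f has_derivative blinfun_apply (f' z)) (at z within S)))"

text \<open>The distribution \<open>\<delta>(t - |x|) / (4 \<pi> |x|)\<close>.\<close>

definition cone_delta :: "(spacetime \<Rightarrow> real) \<Rightarrow> real" where
  "cone_delta \<phi> = (LINT x|lborel. \<phi> (norm x, x) / (4 * pi * norm x))"

text \<open>
  \<open>R\<close> is the regular part of the solution \<open>U\<close>. Only its values on the closed cone
  matter. Being merely \<open>C\<^sup>1\<close>, it solves the second-order system inside the cone in the sense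
  of distributions.
\<close>

definition regular_part ::
  "(real^3 \<Rightarrow> real^2^2) \<Rightarrow> ((spacetime \<Rightarrow> real) \<Rightarrow> real^2)
     \<Rightarrow> (spacetime \<Rightarrow> real^2) \<Rightarrow> bool" where
  "regular_part P U R \<longleftrightarrow>
     C1_on closed_cone R \<and>
     (\<forall>\<phi>\<in>test_functions open_cone.
        wave_operator P (function_distribution open_cone R) \<phi> = 0) \<and>
     (\<forall>x. R (norm x, x) = (1 / (8 * pi)) *\<^sub>R integral {0..1} (\<lambda>s. P (s *\<^sub>R x) *v vec 1)) \<and>
     (\<forall>\<phi>\<in>test_functions UNIV.
        U \<phi> = cone_delta \<phi> *\<^sub>R vec 1 + function_distribution closed_cone R \<phi>)"


section \<open>Admissible classes\<close>

text \<open>In the second and third class \<open>f\<close> and \<open>g\<close> are the prescribed entries.\<close>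

definition A1 :: "(real^3 \<Rightarrow> real^2^2) set" where
  "A1 = {P. \<forall>x. P x $ 1 $ 1 = P x $ 1 $ 2 \<and> P x $ 1 $ 2 = P x $ 2 $ 1 \<and>
                P x $ 2 $ 1 = P x $ 2 $ 2}"

definition A2 :: "(real^3 \<Rightarrow> real) \<Rightarrow> (real^3 \<Rightarrow> real) \<Rightarrow> (real^3 \<Rightarrow> real^2^2) set" where
  "A2 f g = {P. \<forall>x. P x $ 1 $ 2 = f x \<and> P x $ 2 $ 1 = g x \<and> P x $ 1 $ 1 = P x $ 2 $ 2}"

definition A3 :: "(real^3 \<Rightarrow> real) \<Rightarrow> (real^3 \<Rightarrow> real) \<Rightarrow> (real^3 \<Rightarrow> real^2^2) set" where
  "A3 f g = {P. \<forall>x. P x $ 1 $ 1 = f x \<and> P x $ 2 $ 2 = g x \<and> P x $ 1 $ 2 = P x $ 2 $ 1}"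

definition admissible ::
  "nat \<Rightarrow> (real^3 \<Rightarrow> real) \<Rightarrow> (real^3 \<Rightarrow> real) \<Rightarrow> (real^3 \<Rightarrow> real^2^2) set" where
  "admissible p f g = (if p = 1 then A1 else if p = 2 then A2 f g else A3 f g)"

end

theory Submission
  imports Defs
begin

text \<open>
  The potentials are radial, so averaging over spheres turns the problem into one about functions
  of \<open>t\<close> and \<open>r = |x|\<close>. Let \<open>u\<close> be the difference of the two regular parts, and let \<open>w\<close> be \<open>r\<close>
  times the mean of \<open>u(t, \<cdot>)\<close> over the sphere of radius \<open>r\<close>. In the coordinates \<open>\<xi> = t + r\<close>,
  \<open>\<eta> = t - r\<close> the wave equation becomes \<open>4 \<partial>\<^sub>\<xi> \<partial>\<^sub>\<eta> w = F\<close>. The source \<open>F\<close> comes from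
  \<open>P\<^sub>1 R\<^sub>1 - P\<^sub>2 R\<^sub>2 = P\<^sub>1 u + (P\<^sub>1 - P\<^sub>2) R\<^sub>2\<close>, and multiplication by a radial function commutes with
  the spherical mean; so \<open>F\<close> is bounded by a constant times \<open>|w| + |b(r)|\<close>. Here \<open>b\<close> is the one unknown scalar that
  an admissible class leaves: \<open>P\<^sub>1 - P\<^sub>2 = b(|x|) E\<close> with a constant matrix \<open>E\<close> whose rows have
  the same positive sum.

  The two kinds of data determine \<open>b\<close>. On the axis \<open>u\<close> vanishes for times up to \<open>T\<close>, so \<open>w\<close> vanishes
  there to first order; integrating the equation inwards from the axis gives \<open>4 w(\<xi>, \<eta>)\<close> as minus
  the integral of \<open>F\<close> over the triangle \<open>\<eta> < y < x < \<xi>\<close> (\<open>wave_eq_wedge_integral\<close>). On the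
  light cone \<open>\<eta> = 0\<close> the prescribed values of the regular part make \<open>w(\<xi>, 0)\<close> a positive multiple
  of the integral of \<open>b(s / 2)\<close> over \<open>0 < s < \<xi>\<close>. Comparing the two and differentiating in \<open>\<xi>\<close>
  expresses \<open>b(\<xi> / 2)\<close> by the integral of \<open>F\<close> along a characteristic. Thus \<open>w\<close> and \<open>b\<close> satisfy
  a homogeneous Volterra system, which has only the zero solution (\<open>characteristic_data_unique\<close>).
  The coordinate \<open>\<xi>\<close> runs up to \<open>T\<close>, hence \<open>r = \<xi> / 2\<close> up to \<open>T / 2\<close>.

  The regular part is only \<open>C\<^sup>1\<close> and satisfies the equation weakly, so \<open>\<partial>\<^sub>\<xi> \<partial>\<^sub>\<eta> w\<close> is never formed.
  The test functions \<open>A(t + |x|) B(t - |x|) / |x|\<close> satisfy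
  \<open>\<box> \<phi> = 4 A'(t + |x|) B'(t - |x|) / |x|\<close> (\<open>dalembertian_radial_wave\<close>), and polar coordinates
  (\<open>integral_polar\<close>) turn the weak equation into \<open>4 \<integral> A' B' w = \<integral> A B F\<close>. When \<open>A\<close> and \<open>B\<close>
  approach indicator functions of intervals, this becomes the statement that four times the
  alternating sum of \<open>w\<close> over the corners of a rectangle equals the integral of \<open>F\<close> over the
  rectangle (\<open>light_cone_rectangle_identity\<close>), and the later argument uses the wave
  equation in this form only.
\<close>

section \<open>Criteria for smoothness\<close>

text \<open>
  A family that is closed under partial derivatives certifies that all its members are smooth: every
  iterated partial derivative is again a member, hence differentiable. So smoothness of concrete
  functions reduces to finding an algebra of formulas that contains its own derivatives.
\<close>

definition differentially_closed :: "'a::euclidean_space set \<Rightarrow> ('a \<Rightarrow> real) set \<Rightarrow> bool" where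
  "differentially_closed S X \<longleftrightarrow>
     (\<forall>f\<in>X. \<exists>f'. (\<forall>z\<in>S. (f has_derivative f' z) (at z)) \<and> (\<forall>b\<in>Basis. (\<lambda>z. f' z b) \<in> X))"

lemma partial_derivative_eq:
  assumes "(f has_derivative f') (at z)"
  shows "partial_derivative b f z = f' b"
  using frechet_derivative_at[OF assms] by (simp add: partial_derivative_def)

lemma partial_derivative_cong_open:
  assumes "open S" "z \<in> S" "\<And>y. y \<in> S \<Longrightarrow> f y = g y"
  shows "partial_derivative b f z = partial_derivative b g z"
proof -
  have "(f has_derivative f') (at z) \<longleftrightarrow> (g has_derivative f') (at z)" for f'
    using assms by (metis has_derivative_transform_within_open)
  then show ?thesis
    by (simp add: partial_derivative_def frechet_derivative_def)
qed

lemma iterated_partial_in_differentially_closed: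
  assumes "open S" "differentially_closed S X" "g \<in> X" "\<And>z. z \<in> S \<Longrightarrow> f z = g z" "bs \<in> lists Basis"
  shows "\<exists>h\<in>X. \<forall>z\<in>S. iterated_partial bs f z = h z"
  using assms(5)
proof (induction bs)
  case Nil
  then show ?case using assms by (auto simp: iterated_partial_def)
next
  case (Cons b bs)
  then obtain h where h: "h \<in> X" "\<forall>z\<in>S. iterated_partial bs f z = h z" by auto
  obtain h' where h': "\<And>z. z \<in> S \<Longrightarrow> (h has_derivative h' z) (at z)" "\<And>b. b \<in> Basis \<Longrightarrow> (\<lambda>z. h' z b) \<in> X"
    using assms(2) h(1) unfolding differentially_closed_def by meson
  have "iterated_partial (b # bs) f z = h' z b" if "z \<in> S" for z
  proof -
    have "iterated_partial (b # bs) f z = partial_derivative b (iterated_partial bs f) z"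
      by (simp add: iterated_partial_def)
    also have "\<dots> = partial_derivative b h z"
      using assms(1) that h by (intro partial_derivative_cong_open) auto
    finally show ?thesis using partial_derivative_eq[OF h'(1)[OF that]] by simp
  qed
  then show ?case using h'(2) Cons.hyps by (intro bexI[of _ "\<lambda>z. h' z b"]) auto
qed

text \<open>
  The locality matters for functions that involve \<open>|x|\<close>: near the axis they are known to vanish,
  and elsewhere they belong to an algebra of functions that are smooth only off the axis.
\<close>

lemma smooth_if_locally_in_differentially_closed:
  fixes f :: "'a::euclidean_space \<Rightarrow> real"
  assumes "\<And>z. \<exists>S X g. open S \<and> z \<in> S \<and> differentially_closed S X \<and> g \<in> X \<and> (\<forall>y\<in>S. f y = g y)"
  shows "smooth f"
  unfolding smooth_def differentiable_on_def
proof (intro ballI)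
  fix bs :: "'a list" and z :: 'a
  assume bs: "bs \<in> lists Basis"
  obtain S X g where S: "open S" "z \<in> S" "differentially_closed S X" "g \<in> X" "\<forall>y\<in>S. f y = g y"
    using assms[of z] by blast
  obtain h where h: "h \<in> X" "\<forall>z\<in>S. iterated_partial bs f z = h z"
    using iterated_partial_in_differentially_closed[OF S(1,3,4) _ bs] S(5) by blast
  obtain h' where "\<And>z. z \<in> S \<Longrightarrow> (h has_derivative h' z) (at z)"
    using S(3) h(1) unfolding differentially_closed_def by meson
  then have "(iterated_partial bs f has_derivative h' z) (at z)"
    using S(1,2) h(2) by (metis has_derivative_transform_within_open)
  then show "iterated_partial bs f differentiable at z within UNIV"
    by (auto simp: differentiable_def)
qed

lemma differentially_closed_zero: "differentially_closed S {\<lambda>_. 0}"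
  unfolding differentially_closed_def by (auto intro!: exI[of _ "\<lambda>_ _. 0"])

section \<open>A smooth step\<close>

text \<open>
  The factor \<open>1 / x ^ k\<close> is what makes the family of all \<open>flat k\<close> closed under differentiation up
  to linear combinations.
\<close>

definition flat :: "nat \<Rightarrow> real \<Rightarrow> real" where
  "flat k x = (if x \<le> 0 then 0 else exp (- 1 / x) / x ^ k)"

lemma flat_tendsto_0: "(flat k \<longlongrightarrow> 0) (at 0)"
proof -
  have "((\<lambda>y::real. y ^ k / exp y) \<longlongrightarrow> 0) at_top"
    by (rule tendsto_power_div_exp_0)
  then have "((\<lambda>x::real. inverse x ^ k / exp (inverse x)) \<longlongrightarrow> 0) (at_right 0)"
    using filterlim_inverse_at_top_right filterlim_compose by blast
  moreover have "\<forall>\<^sub>F x in at_right (0::real). inverse x ^ k / exp (inverse x) = flat k x"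
    unfolding eventually_at_right_field
    by (intro exI[of _ 1]) (auto simp: flat_def field_simps exp_minus)
  ultimately have 1: "(flat k \<longlongrightarrow> 0) (at_right 0)"
    using Lim_transform_eventually by blast
  have "\<forall>\<^sub>F x in at_left (0::real). 0 = flat k x"
    unfolding eventually_at_left_field
    by (intro exI[of _ "-1"]) (auto simp: flat_def)
  then have "(flat k \<longlongrightarrow> 0) (at_left 0)"
    using Lim_transform_eventually tendsto_const by blast
  with 1 show ?thesis using filterlim_split_at by blast
qed

lemma flat_deriv: "(flat k has_real_derivative flat (k + 2) x - real k * flat (k + 1) x) (at x)"
proof -
  consider "x < 0" | "x = 0" | "x > 0" by linarith
  then show ?thesis
  proof cases
    case 1
    have "(flat k has_real_derivative 0) (at x)"
      by (rule has_field_derivative_transform_within_open[where S="{..<0}" and f="\<lambda>_. 0"])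
         (use 1 in \<open>auto simp: flat_def\<close>)
    then show ?thesis using 1 by (simp add: flat_def)
  next
    case 2
    have "((\<lambda>h. (flat k (0 + h) - flat k 0) / h) \<longlongrightarrow> 0) (at 0)"
      using flat_tendsto_0[of "k + 1"]
      by (rule Lim_transform_eventually) (auto simp: flat_def eventually_at_filter)
    then show ?thesis using 2 unfolding DERIV_def by (simp add: flat_def)
  next
    case 3
    have "((\<lambda>x. exp (- 1 / x) / x ^ k) has_real_derivative
      ((exp (- 1 / x) * (1 / x\<^sup>2)) * x ^ k - exp (- 1 / x) * (k * x ^ (k - 1))) / (x ^ k)\<^sup>2) (at x)"
      using 3 by (auto intro!: derivative_eq_intros simp: power2_eq_square)
    moreover have "((exp (- 1 / x) * (1 / x\<^sup>2)) * x ^ k - exp (- 1 / x) * (k * x ^ (k - 1))) / (x ^ k)\<^sup>2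
       = flat (k + 2) x - real k * flat (k + 1) x"
      using 3 by (cases k) (auto simp: flat_def field_simps power2_eq_square)
    ultimately have "((\<lambda>x. exp (- 1 / x) / x ^ k) has_real_derivative
        flat (k + 2) x - real k * flat (k + 1) x) (at x)" by simp
    then show ?thesis
      by (rule has_field_derivative_transform_within_open[where S="{0<..}"])
         (use 3 in \<open>auto simp: flat_def\<close>)
  qed
qed

text \<open>
  The closure under affine substitutions is what rescaled and translated steps need.
\<close>

inductive_set step_algebra :: "(real \<Rightarrow> real) set" where
  const: "(\<lambda>_. c) \<in> step_algebra"
| flat: "flat k \<in> step_algebra"
| recip: "(\<lambda>x. 1 / (flat 0 x + flat 0 (1 - x))) \<in> step_algebra"
| add: "A \<in> step_algebra \<Longrightarrow> B \<in> step_algebra \<Longrightarrow> (\<lambda>x. A x + B x) \<in> step_algebra"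
| mult: "A \<in> step_algebra \<Longrightarrow> B \<in> step_algebra \<Longrightarrow> (\<lambda>x. A x * B x) \<in> step_algebra"
| affine: "A \<in> step_algebra \<Longrightarrow> (\<lambda>x. A (c * x + d)) \<in> step_algebra"

lemma flat_denominator_pos: "flat 0 x + flat 0 (1 - x) > 0"
  by (auto simp: flat_def add_pos_pos)

lemma step_algebra_derivative:
  assumes "A \<in> step_algebra"
  shows "\<exists>A'\<in>step_algebra. \<forall>x. (A has_real_derivative A' x) (at x)"
  using assms
proof induction
  case (const c)
  then show ?case by (intro bexI[of _ "\<lambda>_. 0"]) (auto intro: step_algebra.const)
next
  case (flat k)
  have "(\<lambda>x. flat (k + 2) x + (- real k) * flat (k + 1) x) \<in> step_algebra"
    by (intro step_algebra.intros)
  then show ?case using flat_deriv by (intro bexI) auto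
next
  case recip
  let ?q = "\<lambda>x. 1 / (flat 0 x + flat 0 (1 - x))"
  let ?q' = "\<lambda>x. (flat 2 x + (-1) * flat 2 ((-1) * x + 1)) * ((-1) * (?q x * ?q x))"
  have "?q' \<in> step_algebra"
    by (intro step_algebra.intros)
  moreover have "(?q has_real_derivative ?q' x) (at x)" for x
  proof -
    have 1: "(flat 0 has_real_derivative flat 2 y) (at y)" for y
      using flat_deriv[of 0 y] by (simp add: numeral_2_eq_2)
    have 2: "((\<lambda>x. flat 0 (1 - x)) has_real_derivative flat 2 (1 - x) * (-1)) (at x)"
      by (rule DERIV_chain2[OF 1]) (auto intro!: derivative_eq_intros)
    have "(?q has_real_derivative
        (0 * (flat 0 x + flat 0 (1 - x)) - 1 * (flat 2 x + flat 2 (1 - x) * (-1)))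
          / ((flat 0 x + flat 0 (1 - x)) * (flat 0 x + flat 0 (1 - x)))) (at x)"
      by (intro DERIV_divide DERIV_add 1 2 DERIV_const) (use flat_denominator_pos[of x] in simp)
    moreover have "(0 * (flat 0 x + flat 0 (1 - x)) - 1 * (flat 2 x + flat 2 (1 - x) * (-1)))
          / ((flat 0 x + flat 0 (1 - x)) * (flat 0 x + flat 0 (1 - x))) = ?q' x"
      using flat_denominator_pos[of x] by (simp add: divide_simps)
    ultimately show ?thesis by simp
  qed
  ultimately show ?case by (intro bexI) auto
next
  case (add A B)
  then obtain A' B' where *: "A' \<in> step_algebra" "B' \<in> step_algebra"
    "\<forall>x. (A has_real_derivative A' x) (at x)" "\<forall>x. (B has_real_derivative B' x) (at x)" by blast
  then show ?case
    by (intro bexI[of _ "\<lambda>x. A' x + B' x"]) (auto intro!: DERIV_add step_algebra.intros)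
next
  case (mult A B)
  then obtain A' B' where *: "A' \<in> step_algebra" "B' \<in> step_algebra"
    "\<forall>x. (A has_real_derivative A' x) (at x)" "\<forall>x. (B has_real_derivative B' x) (at x)" by blast
  then show ?case using mult.hyps
    by (intro bexI[of _ "\<lambda>x. A' x * B x + B' x * A x"]) (auto intro!: DERIV_mult step_algebra.intros)
next
  case (affine A c d)
  then obtain A' where *: "A' \<in> step_algebra" "\<forall>x. (A has_real_derivative A' x) (at x)" by blast
  have "((\<lambda>x. A (c * x + d)) has_real_derivative A' (c * x + d) * c) (at x)" for x
    by (rule DERIV_chain2[OF *(2)[rule_format]]) (auto intro!: derivative_eq_intros)
  then show ?case using *
    by (intro bexI[of _ "\<lambda>x. A' (c * x + d) * c"]) (auto intro!: step_algebra.intros)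
qed

definition smooth_step :: "real \<Rightarrow> real" where
  "smooth_step x = flat 0 x * (1 / (flat 0 x + flat 0 (1 - x)))"

lemma smooth_step_in_step_algebra: "smooth_step \<in> step_algebra"
  unfolding smooth_step_def by (intro step_algebra.intros)

lemma smooth_step_eq_0: "x \<le> 0 \<Longrightarrow> smooth_step x = 0"
  by (simp add: smooth_step_def flat_def)

lemma smooth_step_eq_1: "x \<ge> 1 \<Longrightarrow> smooth_step x = 1"
  by (simp add: smooth_step_def flat_def)

lemma smooth_step_bounds: "0 \<le> smooth_step x" "smooth_step x \<le> 1"
  using flat_denominator_pos[of x] by (auto simp: smooth_step_def flat_def field_simps)

section \<open>Radial wave packets as test functions\<close>

text \<open>
  The functions from which the radial test functions are built. The coordinates are included only
  because \<open>x \<bullet> e / |x|\<close> arises as a derivative of \<open>|x|\<close>.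
\<close>

inductive_set cone_algebra :: "(real \<times> 'a::euclidean_space \<Rightarrow> real) set" where
  const: "(\<lambda>_. c) \<in> cone_algebra"
| coordinate: "(\<lambda>z. snd z \<bullet> e) \<in> cone_algebra"
| recip_norm: "(\<lambda>z. 1 / norm (snd z)) \<in> cone_algebra"
| outgoing: "A \<in> step_algebra \<Longrightarrow> (\<lambda>z. A (fst z - norm (snd z))) \<in> cone_algebra"
| incoming: "A \<in> step_algebra \<Longrightarrow> (\<lambda>z. A (fst z + norm (snd z))) \<in> cone_algebra"
| add: "f \<in> cone_algebra \<Longrightarrow> g \<in> cone_algebra \<Longrightarrow> (\<lambda>z. f z + g z) \<in> cone_algebra"
| mult: "f \<in> cone_algebra \<Longrightarrow> g \<in> cone_algebra \<Longrightarrow> (\<lambda>z. f z * g z) \<in> cone_algebra"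

lemma has_derivative_norm_snd:
  fixes z :: "real \<times> 'a::euclidean_space"
  assumes "snd z \<noteq> 0"
  shows "((\<lambda>z. norm (snd z)) has_derivative (\<lambda>h. (snd z \<bullet> snd h) * (1 / norm (snd z)))) (at z)"
proof -
  have "((\<lambda>z. norm (snd z)) has_derivative (\<lambda>h. snd h \<bullet> sgn (snd z))) (at z)"
    using has_derivative_compose[OF has_derivative_snd[OF has_derivative_ident]
        has_derivative_norm[OF assms]] by simp
  then show ?thesis by (simp add: sgn_div_norm inner_commute divide_inverse mult.commute)
qed

lemma has_derivative_comp_real:
  assumes "(A has_real_derivative a) (at (g z))" "(g has_derivative g') (at z)"
  shows "((\<lambda>z. A (g z)) has_derivative (\<lambda>h. a * g' h)) (at z)"
  using has_derivative_compose[OF assms(2) assms(1)[unfolded has_field_derivative_def]] by simp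

lemma has_derivative_light_cone_functions:
  fixes z :: "real \<times> 'a::euclidean_space"
  assumes "\<And>x. (A has_real_derivative A' x) (at x)" "snd z \<noteq> 0"
  shows "((\<lambda>z. A (fst z - norm (snd z))) has_derivative
      (\<lambda>h. A' (fst z - norm (snd z)) * (fst h + (-1) * ((snd z \<bullet> snd h) * (1 / norm (snd z)))))) (at z)"
    and "((\<lambda>z. A (fst z + norm (snd z))) has_derivative
      (\<lambda>h. A' (fst z + norm (snd z)) * (fst h + (snd z \<bullet> snd h) * (1 / norm (snd z))))) (at z)"
proof -
  have fst: "(fst has_derivative fst) (at z)"
    by (rule bounded_linear_imp_has_derivative[OF bounded_linear_fst])
  have 1: "((\<lambda>z. fst z - norm (snd z)) has_derivative
     (\<lambda>h. fst h + (-1) * ((snd z \<bullet> snd h) * (1 / norm (snd z))))) (at z)"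
    using has_derivative_diff[OF fst has_derivative_norm_snd[OF assms(2)]] by simp
  have 2: "((\<lambda>z. fst z + norm (snd z)) has_derivative
     (\<lambda>h. fst h + (snd z \<bullet> snd h) * (1 / norm (snd z)))) (at z)"
    using has_derivative_add[OF fst has_derivative_norm_snd[OF assms(2)]] by simp
  show "((\<lambda>z. A (fst z - norm (snd z))) has_derivative
      (\<lambda>h. A' (fst z - norm (snd z)) * (fst h + (-1) * ((snd z \<bullet> snd h) * (1 / norm (snd z)))))) (at z)"
    by (rule has_derivative_comp_real[OF assms(1) 1])
  show "((\<lambda>z. A (fst z + norm (snd z))) has_derivative
      (\<lambda>h. A' (fst z + norm (snd z)) * (fst h + (snd z \<bullet> snd h) * (1 / norm (snd z))))) (at z)"
    by (rule has_derivative_comp_real[OF assms(1) 2])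
qed

lemma differentially_closed_cone_algebra:
  "differentially_closed {z. snd z \<noteq> 0} (cone_algebra :: (real \<times> 'a::euclidean_space \<Rightarrow> real) set)"
  unfolding differentially_closed_def
proof
  fix f :: "real \<times> 'a \<Rightarrow> real"
  let ?S = "{z :: real \<times> 'a. snd z \<noteq> 0}"
  assume "f \<in> cone_algebra"
  then show "\<exists>f'. (\<forall>z\<in>?S. (f has_derivative f' z) (at z)) \<and> (\<forall>b\<in>Basis. (\<lambda>z. f' z b) \<in> cone_algebra)"
  proof induction
    case (const c)
    show ?case
      by (rule exI[of _ "\<lambda>_ _. 0"]) (auto intro: cone_algebra.const)
  next
    case (coordinate e)
    show ?case
      by (rule exI[of _ "\<lambda>_ h. snd h \<bullet> e"]) (auto intro!: derivative_eq_intros cone_algebra.const)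
  next
    case recip_norm
    let ?r = "\<lambda>z::real \<times> 'a. 1 / norm (snd z)"
    let ?f' = "\<lambda>(z::real \<times> 'a) (h::real \<times> 'a). (-1) * (?r z * ?r z) * ((snd z \<bullet> snd h) * ?r z)"
    have "(?r has_derivative ?f' z) (at z)" if "z \<in> ?S" for z
      by (rule has_derivative_comp_real[where A="\<lambda>x. 1 / x", OF _ has_derivative_norm_snd])
         (use that in \<open>auto intro!: derivative_eq_intros\<close>)
    moreover have "(\<lambda>z. ?f' z b) \<in> cone_algebra" for b
      by (intro cone_algebra.intros)
    ultimately show ?case by (intro exI[of _ ?f']) blast
  next
    case (outgoing A)
    obtain A' where A': "A' \<in> step_algebra" "\<And>x. (A has_real_derivative A' x) (at x)"
      using step_algebra_derivative[OF outgoing] by blast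
    show ?case
      by (intro exI conjI ballI, rule has_derivative_light_cone_functions(1)[OF A'(2)])
        (simp, intro cone_algebra.intros A'(1))
  next
    case (incoming A)
    obtain A' where A': "A' \<in> step_algebra" "\<And>x. (A has_real_derivative A' x) (at x)"
      using step_algebra_derivative[OF incoming] by blast
    show ?case
      by (intro exI conjI ballI, rule has_derivative_light_cone_functions(2)[OF A'(2)])
        (simp, intro cone_algebra.intros A'(1))
  next
    case (add f g)
    then obtain f' g' where "\<forall>z\<in>?S. (f has_derivative f' z) (at z)" "\<forall>b\<in>Basis. (\<lambda>z. f' z b) \<in> cone_algebra"
      "\<forall>z\<in>?S. (g has_derivative g' z) (at z)" "\<forall>b\<in>Basis. (\<lambda>z. g' z b) \<in> cone_algebra" by blast
    then show ?case
      by (intro exI[of _ "\<lambda>z h. f' z h + g' z h"]) (auto intro!: derivative_intros cone_algebra.add)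
  next
    case (mult f g)
    then obtain f' g' where "\<forall>z\<in>?S. (f has_derivative f' z) (at z)" "\<forall>b\<in>Basis. (\<lambda>z. f' z b) \<in> cone_algebra"
      "\<forall>z\<in>?S. (g has_derivative g' z) (at z)" "\<forall>b\<in>Basis. (\<lambda>z. g' z b) \<in> cone_algebra" by blast
    then show ?case using mult.hyps
      by (intro exI[of _ "\<lambda>z h. f z * g' z h + f' z h * g z"])
         (auto intro!: has_derivative_mult cone_algebra.intros)
  qed
qed

text \<open>
  The general product of an incoming and an outgoing spherical profile. Divided by \<open>|x|\<close>, either
  profile alone would solve the wave equation off the axis.
\<close>

definition radial_wave :: "(real \<Rightarrow> real) \<Rightarrow> (real \<Rightarrow> real) \<Rightarrow> real \<times> 'a::euclidean_space \<Rightarrow> real" where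
  "radial_wave A B z = A (fst z + norm (snd z)) * B (fst z - norm (snd z)) / norm (snd z)"

lemma has_derivative_light_cone_product:
  fixes z :: "real \<times> 'a::euclidean_space"
  assumes A: "\<And>x. (A has_real_derivative A' x) (at x)" and B: "\<And>x. (B has_real_derivative B' x) (at x)"
    and z: "snd z \<noteq> 0"
  defines "r \<equiv> norm (snd z)" and "d \<equiv> \<lambda>h. (snd z \<bullet> snd h) / norm (snd z)"
  shows "((\<lambda>z. A (fst z + norm (snd z)) * B (fst z - norm (snd z)) / norm (snd z) ^ m) has_derivative
     (\<lambda>h. (A' (fst z + r) * (fst h + d h) * B (fst z - r)
            + A (fst z + r) * B' (fst z - r) * (fst h - d h)) / r ^ m
          - real m * (A (fst z + r) * B (fst z - r)) * d h / r ^ (m + 1))) (at z)"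
proof -
  have r: "r > 0" using z by (simp add: r_def)
  have 1: "((\<lambda>x::real. 1 / x ^ m) has_real_derivative - real m / r ^ (m + 1)) (at r)"
  proof -
    have "((\<lambda>x::real. 1 / x ^ m) has_real_derivative (0 * r ^ m - 1 * (m * r ^ (m - 1))) / (r ^ m * r ^ m)) (at r)"
      using r by (auto intro!: derivative_eq_intros)
    moreover have "(0 * r ^ m - 1 * (m * r ^ (m - 1))) / (r ^ m * r ^ m) = - real m / r ^ (m + 1)"
      using r by (cases m) (auto simp: field_simps)
    ultimately show ?thesis by simp
  qed
  have 2: "((\<lambda>z. 1 / norm (snd z) ^ m) has_derivative (\<lambda>h. (- real m / r ^ (m + 1)) * d h)) (at z)"
    using has_derivative_comp_real[OF _ has_derivative_norm_snd[OF z], of "\<lambda>x. 1 / x ^ m", OF 1[unfolded r_def]]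
    by (simp add: r_def d_def)
  note 3 = has_derivative_mult[OF has_derivative_mult[OF
        has_derivative_light_cone_functions(2)[of A A', OF A z]
        has_derivative_light_cone_functions(1)[of B B', OF B z]] 2]
  have 4: "(\<lambda>z. A (fst z + norm (snd z)) * B (fst z - norm (snd z)) * (1 / norm (snd z) ^ m))
    = (\<lambda>z. A (fst z + norm (snd z)) * B (fst z - norm (snd z)) / norm (snd z) ^ m)" by auto
  show ?thesis
    using 3 unfolding 4
    by (rule has_derivative_eq_rhs)
       (simp add: r_def[symmetric] d_def divide_inverse algebra_simps)
qed

lemma iterated_partial_two:
  assumes "open S" "z \<in> S" "\<And>y. y \<in> S \<Longrightarrow> (f has_derivative f' y) (at y)"
    "\<And>y. y \<in> S \<Longrightarrow> f' y b = g y" "(g has_derivative g') (at z)"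
  shows "iterated_partial [b, b] f z = g' b"
proof -
  have "iterated_partial [b, b] f z = partial_derivative b (partial_derivative b f) z"
    by (simp add: iterated_partial_def)
  also have "\<dots> = partial_derivative b g z"
    using assms partial_derivative_eq[OF assms(3)] by (intro partial_derivative_cong_open) auto
  finally show ?thesis using partial_derivative_eq[OF assms(5)] by simp
qed

text \<open>
  The next four identities do the algebra of the two second derivatives of \<open>A B / r\<close>. In them
  \<open>a0, a1, a2\<close> and \<open>b0, b1, b2\<close> stand for the values of \<open>A\<close>, \<open>B\<close> and their derivatives, and \<open>p\<close>
  stands for \<open>x \<bullet> e\<close>.
\<close>

lemma light_cone_identity_tt:
  fixes r :: real
  assumes "r > 0"
  shows "(a2 * (1 + 0/r) * b0 + a1 * b1 * (1 - 0/r)) / r ^ 1 - real 1 * (a1 * b0) * (0/r) / r^(1+1) +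
  ((a1 * (1 + 0/r) * b1 + a0 * b2 * (1 - 0/r)) / r ^ 1 - real 1 * (a0 * b1) * (0/r) / r^(1+1)) = (a2 * b0 + 2 * a1 * b1 + a0 * b2) / r"
  using assms by (simp add: field_simps)

lemma light_cone_identity_x:
  fixes r :: real
  assumes "r > 0"
  shows "(a1 * (0 + p/r) * b0 + a0 * b1 * (0 - p/r)) / r ^ 1 - real 1 * (a0 * b0) * (p/r) / r^(1+1) =
 p * (a1 * b0 / r^2 - a0 * b1 / r^2 - a0 * b0 / r^3)"
  unfolding divide_inverse power_inverse[symmetric]
  by (simp add: algebra_simps power2_eq_square power3_eq_cube del: power_inverse)

lemma light_cone_identity_xx:
  fixes r :: real
  assumes "r > 0"
  shows "a1 * b0 / r^2 - a0 * b1 / r^2 - a0 * b0 / r^3 + p * (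
  (a2 * (0 + p/r) * b0 + a1 * b1 * (0 - p/r)) / r ^ 2 - real 2 * (a1 * b0) * (p/r) / r^(2+1)
 - ((a1 * (0 + p/r) * b1 + a0 * b2 * (0 - p/r)) / r ^ 2 - real 2 * (a0 * b1) * (p/r) / r^(2+1))
 - ((a1 * (0 + p/r) * b0 + a0 * b1 * (0 - p/r)) / r ^ 3 - real 3 * (a0 * b0) * (p/r) / r^(3+1)))
 = (a1 * b0 - a0 * b1) / r ^ 2 - a0 * b0 / r ^ 3
        + p\<^sup>2 / r ^ 2 * ((a2 * b0 - 2 * a1 * b1 + a0 * b2) / r
          - 3 * (a1 * b0 - a0 * b1) / r ^ 2 + 3 * (a0 * b0) / r ^ 3)"
  unfolding divide_inverse power_inverse[symmetric] of_nat_numeral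
  by (simp add: algebra_simps eval_nat_numeral del: power_inverse)

lemma light_cone_identity_wave:
  fixes r :: real
  assumes "r > 0"
  shows "(a2 * b0 + 2 * a1 * b1 + a0 * b2) / r - (3 * ((a1 * b0 - a0 * b1) / r ^ 2 - a0 * b0 / r ^ 3)
        + r\<^sup>2 / r ^ 2 * ((a2 * b0 - 2 * a1 * b1 + a0 * b2) / r
          - 3 * (a1 * b0 - a0 * b1) / r ^ 2 + 3 * (a0 * b0) / r ^ 3)) = 4 * (a1 * b1 / r)"
proof -
  have "r\<^sup>2 / r\<^sup>2 = 1" using assms by simp
  then show ?thesis unfolding divide_inverse power_inverse[symmetric] of_nat_numeral by algebra
qed

text \<open>
  For radial functions in three dimensions \<open>\<box> (\<psi> / r) = (\<partial>\<^sub>t\<^sup>2 - \<partial>\<^sub>r\<^sup>2) \<psi> / r\<close>, and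
  \<open>\<partial>\<^sub>t\<^sup>2 - \<partial>\<^sub>r\<^sup>2 = 4 \<partial>\<^sub>\<xi> \<partial>\<^sub>\<eta>\<close>. The sum over the three coordinate
  directions \<open>e\<close> is evaluated by \<open>\<Sum> (x \<bullet> e)\<^sup>2 = r\<^sup>2\<close>.
\<close>

lemma dalembertian_radial_wave:
  fixes z :: spacetime
  assumes A: "\<And>x. (A has_real_derivative A' x) (at x)" "\<And>x. (A' has_real_derivative A'' x) (at x)"
    and B: "\<And>x. (B has_real_derivative B' x) (at x)" "\<And>x. (B' has_real_derivative B'' x) (at x)"
    and z: "snd z \<noteq> 0"
  shows "dalembertian (radial_wave A B) z = 4 * radial_wave A' B' z"
proof -
  define T where "T A B m = (\<lambda>z::spacetime. A (fst z + norm (snd z)) * B (fst z - norm (snd z)) / norm (snd z) ^ m)"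
    for A B :: "real \<Rightarrow> real" and m :: nat
  define D where "D A A' B B' m = (\<lambda>(z::spacetime) (h::spacetime). (A' (fst z + norm (snd z)) * (fst h + (snd z \<bullet> snd h) / norm (snd z)) * B (fst z - norm (snd z))
            + A (fst z + norm (snd z)) * B' (fst z - norm (snd z)) * (fst h - (snd z \<bullet> snd h) / norm (snd z))) / norm (snd z) ^ m
          - real m * (A (fst z + norm (snd z)) * B (fst z - norm (snd z))) * ((snd z \<bullet> snd h) / norm (snd z)) / norm (snd z) ^ (m + 1))"
    for A A' B B' :: "real \<Rightarrow> real" and m :: nat
  have D: "(T A B m has_derivative D A A' B B' m z) (at z)"
    if "\<And>x. (A has_real_derivative A' x) (at x)" "\<And>x. (B has_real_derivative B' x) (at x)" "snd z \<noteq> 0"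
    for A A' B B' m z
    unfolding T_def D_def by (rule has_derivative_light_cone_product[OF that])
  let ?S = "{z :: spacetime. snd z \<noteq> 0}"
  have S: "open ?S"
    by (intro open_Collect_neq continuous_intros)
  have wave: "radial_wave A B = T A B 1"
    by (auto simp: radial_wave_def T_def)
  define r where "r = norm (snd z)"
  define \<xi> where "\<xi> = fst z + r"
  define \<eta> where "\<eta> = fst z - r"
  have r: "r > 0" using z by (simp add: r_def)
  have time: "iterated_partial [(1, 0), (1, 0)] (radial_wave A B) z
      = D A' A'' B B' 1 z (1, 0) + D A A' B' B'' 1 z (1, 0)"
    unfolding wave
  proof (rule iterated_partial_two[OF S, where f'="D A A' B B' 1" and g="\<lambda>y. T A' B 1 y + T A B' 1 y"])
    show "z \<in> ?S" using z by simp
    show "(T A B 1 has_derivative D A A' B B' 1 y) (at y)" if "y \<in> ?S" for y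
      using that by (intro D A B) auto
    show "D A A' B B' 1 y (1, 0) = T A' B 1 y + T A B' 1 y" for y
      by (simp add: D_def T_def add_divide_distrib)
    show "((\<lambda>y. T A' B 1 y + T A B' 1 y) has_derivative
        (\<lambda>h. D A' A'' B B' 1 z h + D A A' B' B'' 1 z h)) (at z)"
      using z by (intro has_derivative_add D A B)
  qed
  have time': "\<dots> = (A'' \<xi> * B \<eta> + 2 * A' \<xi> * B' \<eta> + A \<xi> * B'' \<eta>) / r"
    using light_cone_identity_tt[OF r, of "A'' \<xi>" "B \<eta>" "A' \<xi>" "B' \<eta>" "A \<xi>" "B'' \<eta>"]
    by (simp add: D_def r_def \<xi>_def \<eta>_def)
  have space: "iterated_partial [(0, e), (0, e)] (radial_wave A B) z
      = (A' \<xi> * B \<eta> - A \<xi> * B' \<eta>) / r ^ 2 - A \<xi> * B \<eta> / r ^ 3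
        + (snd z \<bullet> e)\<^sup>2 / r ^ 2 * ((A'' \<xi> * B \<eta> - 2 * A' \<xi> * B' \<eta> + A \<xi> * B'' \<eta>) / r
          - 3 * (A' \<xi> * B \<eta> - A \<xi> * B' \<eta>) / r ^ 2 + 3 * (A \<xi> * B \<eta>) / r ^ 3)"
    if "e \<in> Basis" for e
  proof -
    let ?G = "\<lambda>y. T A' B 2 y - T A B' 2 y - T A B 3 y"
    have "iterated_partial [(0, e), (0, e)] (radial_wave A B) z
      = (snd z \<bullet> e) * (D A' A'' B B' 2 z (0, e) - D A A' B' B'' 2 z (0, e) - D A A' B B' 3 z (0, e))
        + (snd (0::real, e) \<bullet> e) * ?G z"
      unfolding wave
    proof (rule iterated_partial_two[OF S, where f'="D A A' B B' 1" and g="\<lambda>y. (snd y \<bullet> e) * ?G y"])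
      show "z \<in> ?S" using z by simp
      show "(T A B 1 has_derivative D A A' B B' 1 y) (at y)" if "y \<in> ?S" for y
        using that by (intro D A B) auto
      show "D A A' B B' 1 y (0, e) = (snd y \<bullet> e) * ?G y" if "y \<in> ?S" for y
        using light_cone_identity_x[of "norm (snd y)"] that unfolding D_def T_def by simp
      have 1: "((\<lambda>y::spacetime. snd y \<bullet> e) has_derivative (\<lambda>h. snd h \<bullet> e)) (at z)"
        by (auto intro!: derivative_eq_intros)
      have 2: "(?G has_derivative
        (\<lambda>h. D A' A'' B B' 2 z h - D A A' B' B'' 2 z h - D A A' B B' 3 z h)) (at z)"
        using z by (intro has_derivative_diff D A B)
      show "((\<lambda>y. (snd y \<bullet> e) * ?G y) has_derivative
         (\<lambda>h. (snd z \<bullet> e) * (D A' A'' B B' 2 z h - D A A' B' B'' 2 z h - D A A' B B' 3 z h)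
          + (snd h \<bullet> e) * ?G z)) (at z)"
        by (rule has_derivative_mult[OF 1 2])
    qed
    also have "\<dots> = ?G z + (snd z \<bullet> e) * (D A' A'' B B' 2 z (0, e) - D A A' B' B'' 2 z (0, e) - D A A' B B' 3 z (0, e))"
      using that by simp
    also have "\<dots> = (A' \<xi> * B \<eta> - A \<xi> * B' \<eta>) / r ^ 2 - A \<xi> * B \<eta> / r ^ 3
        + (snd z \<bullet> e)\<^sup>2 / r ^ 2 * ((A'' \<xi> * B \<eta> - 2 * A' \<xi> * B' \<eta> + A \<xi> * B'' \<eta>) / r
          - 3 * (A' \<xi> * B \<eta> - A \<xi> * B' \<eta>) / r ^ 2 + 3 * (A \<xi> * B \<eta>) / r ^ 3)"
      unfolding D_def T_def r_def[symmetric] \<xi>_def[symmetric] \<eta>_def[symmetric] fst_conv snd_conv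
      by (rule light_cone_identity_xx[OF r])
    finally show ?thesis .
  qed
  have norm: "(\<Sum>e\<in>Basis. (snd z \<bullet> e)\<^sup>2) = r\<^sup>2"
  proof -
    have "(\<Sum>e\<in>Basis. (snd z \<bullet> e)\<^sup>2) = snd z \<bullet> snd z"
      by (simp only: euclidean_inner[of "snd z" "snd z"] power2_eq_square)
    then show ?thesis by (simp only: r_def power2_norm_eq_inner)
  qed
  have "(\<Sum>e\<in>Basis. iterated_partial [(0, e), (0, e)] (radial_wave A B) z)
      = 3 * ((A' \<xi> * B \<eta> - A \<xi> * B' \<eta>) / r ^ 2 - A \<xi> * B \<eta> / r ^ 3)
        + r\<^sup>2 / r ^ 2 * ((A'' \<xi> * B \<eta> - 2 * A' \<xi> * B' \<eta> + A \<xi> * B'' \<eta>) / r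
          - 3 * (A' \<xi> * B \<eta> - A \<xi> * B' \<eta>) / r ^ 2 + 3 * (A \<xi> * B \<eta>) / r ^ 3)"
    by (simp add: space sum.distrib sum_distrib_right[symmetric] sum_divide_distrib[symmetric] norm)
  then have "dalembertian (radial_wave A B) z = 4 * (A' \<xi> * B' \<eta> / r)"
    unfolding dalembertian_def time time' by (simp only: light_cone_identity_wave[OF r])
  then show ?thesis
    by (simp add: radial_wave_def r_def \<xi>_def \<eta>_def)
qed

lemma spacetime_directions:
  "[(1, 0), (1, 0)] \<in> lists (Basis :: spacetime set)"
  "e \<in> Basis \<Longrightarrow> [(0, e), (0, e)] \<in> lists (Basis :: spacetime set)"
  by (simp_all add: Basis_prod_def)

text \<open>
  The separation \<open>b' < a\<close> of the two supports keeps \<open>|x|\<close> at least \<open>(a - b') / 2\<close> on the support of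
  the product, away from the singularity of \<open>1 / |x|\<close>; the condition \<open>0 < b\<close> keeps the support
  inside the open cone. At the axis both sides of the second claim vanish, the right one because
  division by zero yields zero.
\<close>

lemma radial_wave_test_function:
  assumes AB: "A \<in> step_algebra" "B \<in> step_algebra"
    and A: "\<And>x. A x \<noteq> 0 \<Longrightarrow> a \<le> x \<and> x \<le> a'" and B: "\<And>x. B x \<noteq> 0 \<Longrightarrow> b \<le> x \<and> x \<le> b'"
    and "0 < b" "b' < a"
  shows "(radial_wave A B :: spacetime \<Rightarrow> real) \<in> test_functions open_cone"
    and "\<And>A' B' z. (\<And>x. (A has_real_derivative A' x) (at x)) \<Longrightarrow> A' \<in> step_algebra \<Longrightarrow>
      (\<And>x. (B has_real_derivative B' x) (at x)) \<Longrightarrow> B' \<in> step_algebra \<Longrightarrow>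
      dalembertian (radial_wave A B) z = 4 * radial_wave A' B' z"
proof -
  let ?K = "{z::spacetime. a \<le> fst z + norm (snd z) \<and> fst z + norm (snd z) \<le> a' \<and>
     b \<le> fst z - norm (snd z) \<and> fst z - norm (snd z) \<le> b'}"
  let ?S0 = "{z::spacetime. 2 * norm (snd z) < a - b'}"
  let ?S1 = "{z::spacetime. snd z \<noteq> 0}"
  have open0: "open ?S0" by (intro open_Collect_less continuous_intros)
  have open1: "open ?S1" by (intro open_Collect_neq continuous_intros)
  have zero: "radial_wave A B z = 0" if "z \<in> ?S0" for z
  proof (rule ccontr)
    assume "radial_wave A B z \<noteq> 0"
    then have "A (fst z + norm (snd z)) \<noteq> 0" "B (fst z - norm (snd z)) \<noteq> 0"
      by (auto simp: radial_wave_def)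
    then have "a \<le> fst z + norm (snd z)" "fst z - norm (snd z) \<le> b'"
      using A B by blast+
    then show False using that by simp
  qed
  have "closed ?K"
    by (intro closed_Collect_conj closed_Collect_le continuous_intros)
  moreover have "bounded ?K"
  proof (rule bounded_subset)
    show "bounded ({b..a'} \<times> cball (0::real^3) a')"
      by (intro bounded_Times bounded_cball) simp
    show "?K \<subseteq> {b..a'} \<times> cball (0::real^3) a'"
    proof
      fix z assume "z \<in> ?K"
      then have "b \<le> fst z" "fst z \<le> a'" "norm (snd z) \<le> a'"
        using norm_ge_zero[of "snd z"] \<open>0 < b\<close> by (simp_all del: norm_ge_zero)
      then show "z \<in> {b..a'} \<times> cball 0 a'" by (simp add: mem_Times_iff)
    qed
  qed
  ultimately have K: "compact ?K" by (simp add: compact_eq_bounded_closed)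
  have "support_on UNIV (radial_wave A B) \<subseteq> ?K"
    using A B by (auto simp: support_on_def radial_wave_def)
  then have supp: "tsupport (radial_wave A B) \<subseteq> ?K"
    unfolding tsupport_def by (rule closure_minimal) fact
  have "compact (tsupport (radial_wave A B :: spacetime \<Rightarrow> real))"
    using compact_Int_closed[OF K, of "tsupport (radial_wave A B)"] supp
    by (simp add: tsupport_def Int_absorb1)
  moreover have "?K \<subseteq> open_cone"
    using \<open>0 < b\<close> by (auto simp: open_cone_def)
  moreover have "smooth (radial_wave A B :: spacetime \<Rightarrow> real)"
  proof (rule smooth_if_locally_in_differentially_closed)
    fix z :: spacetime
    show "\<exists>S X g. open S \<and> z \<in> S \<and> differentially_closed S X \<and> g \<in> X \<and> (\<forall>y\<in>S. radial_wave A B y = g y)"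
    proof (cases "snd z = 0")
      case True
      then have "z \<in> ?S0" using \<open>b' < a\<close> by simp
      then show ?thesis using open0 zero differentially_closed_zero
        by (intro exI[of _ ?S0] exI[of _ "{\<lambda>_. 0}"] exI[of _ "\<lambda>_. 0"]) auto
    next
      case False
      have "(\<lambda>z::spacetime. A (fst z + norm (snd z)) * B (fst z - norm (snd z)) * (1 / norm (snd z)))
         \<in> cone_algebra"
        by (intro cone_algebra.intros AB)
      then have "radial_wave A B \<in> (cone_algebra :: (spacetime \<Rightarrow> real) set)"
        by (simp add: radial_wave_def[abs_def])
      then show ?thesis using False open1 differentially_closed_cone_algebra
        by (intro exI[of _ ?S1] exI[of _ cone_algebra] exI[of _ "radial_wave A B"]) auto
    qed
  qed
  ultimately show "(radial_wave A B :: spacetime \<Rightarrow> real) \<in> test_functions open_cone"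
    using supp by (auto simp: test_functions_def)
  fix A' B' z
  assume A': "\<And>x. (A has_real_derivative A' x) (at x)" "A' \<in> step_algebra"
     and B': "\<And>x. (B has_real_derivative B' x) (at x)" "B' \<in> step_algebra"
  show "dalembertian (radial_wave A B) z = 4 * radial_wave A' B' z"
  proof (cases "snd z = 0")
    case False
    obtain A'' where A'': "\<And>x. (A' has_real_derivative A'' x) (at x)"
      using step_algebra_derivative[OF A'(2)] by blast
    obtain B'' where B'': "\<And>x. (B' has_real_derivative B'' x) (at x)"
      using step_algebra_derivative[OF B'(2)] by blast
    show ?thesis by (rule dalembertian_radial_wave[OF A'(1) A'' B'(1) B'' False])
  next
    case True
    then have z: "z \<in> ?S0" using \<open>b' < a\<close> by simp
    have "iterated_partial bs (radial_wave A B) z = 0" if bs: "bs \<in> lists Basis" for bs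
      using iterated_partial_in_differentially_closed[OF open0 differentially_closed_zero, of "\<lambda>_. 0" "radial_wave A B", OF _ zero bs] z by blast
    with spacetime_directions have "dalembertian (radial_wave A B) z = 0"
      unfolding dalembertian_def by (simp only: sum.neutral_const cong: sum.cong)
    then show ?thesis using True by (simp add: radial_wave_def)
  qed
qed

section \<open>Spherical means and polar coordinates\<close>

text \<open>
  The uniform distribution on the unit sphere, obtained by projecting the uniform distribution on
  the unit ball radially; only the null set consisting of the centre of the ball is not mapped to
  the sphere.
\<close>

definition sphere_measure :: "'a::euclidean_space measure" where
  "sphere_measure = distr (uniform_measure lborel (cball 0 1)) borel sgn"

definition sphere_mean :: "('a::euclidean_space \<Rightarrow> real) \<Rightarrow> real \<Rightarrow> real" where
  "sphere_mean f r = (LINT \<omega>|sphere_measure. f (r *\<^sub>R \<omega>))"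

lemma emeasure_unit_ball:
  "emeasure lborel (cball (0::'a::euclidean_space) 1) \<noteq> 0"
  "emeasure lborel (cball (0::'a::euclidean_space) 1) \<noteq> \<infinity>"
proof -
  have "unit_ball_vol (real DIM('a)) > 0" by simp
  then show "emeasure lborel (cball (0::'a) 1) \<noteq> 0" "emeasure lborel (cball (0::'a) 1) \<noteq> \<infinity>"
    by (auto simp: emeasure_cball simp del: unit_ball_vol_pos)
qed

lemma sets_sphere_measure [simp, measurable_cong]: "sets sphere_measure = sets borel"
  and space_sphere_measure [simp]: "space sphere_measure = UNIV"
  by (simp_all add: sphere_measure_def)

lemma sgn_borel_measurable [measurable]:
  "(sgn :: 'a::euclidean_space \<Rightarrow> 'a) \<in> borel_measurable borel"
  unfolding sgn_div_norm[abs_def] by measurable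

lemma emeasure_sphere_measure: "emeasure (sphere_measure :: 'a::euclidean_space measure) UNIV = 1"
  using emeasure_unit_ball[where 'a='a] unfolding sphere_measure_def
  by (subst emeasure_distr) (auto simp: ennreal_divide_self less_top)

interpretation sphere_measure: finite_measure "sphere_measure :: 'a::euclidean_space measure"
  by standard (simp add: emeasure_sphere_measure)

lemma AE_sphere_measure: "AE \<omega> in sphere_measure. norm \<omega> = 1"
proof -
  have "AE y in lborel. y \<noteq> (0::'a)"
    by (rule AE_lborel_singleton)
  then show ?thesis
    unfolding sphere_measure_def
    by (subst AE_distr_iff) (auto intro!: AE_uniform_measureI simp: norm_sgn)
qed

lemma nn_integral_lborel_scale:
  fixes g :: "'a::euclidean_space \<Rightarrow> ennreal"
  assumes [measurable]: "g \<in> borel_measurable borel" and "s > 0"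
  shows "(\<integral>\<^sup>+x. g x \<partial>lborel) = (\<integral>\<^sup>+y. ennreal (s ^ DIM('a)) * g (s *\<^sub>R y) \<partial>lborel)"
proof -
  let ?M = "distr lborel borel (\<lambda>x::'a. 0 + s *\<^sub>R x)"
  have "integral\<^sup>N lborel g = integral\<^sup>N (density ?M (\<lambda>_. ennreal (\<bar>s\<bar> ^ DIM('a)))) g"
    by (rule arg_cong[where f="\<lambda>M. integral\<^sup>N M g"], rule lborel_affine) (use assms in simp)
  also have "\<dots> = (\<integral>\<^sup>+x. ennreal (\<bar>s\<bar> ^ DIM('a)) * g x \<partial>?M)"
    by (rule nn_integral_density) simp_all
  also have "\<dots> = (\<integral>\<^sup>+y. ennreal (\<bar>s\<bar> ^ DIM('a)) * g (0 + s *\<^sub>R y) \<partial>lborel)"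
    by (rule nn_integral_distr) simp_all
  finally show ?thesis using assms by simp
qed

text \<open>
  The proof uses nothing but Tonelli's theorem and the scaling of Lebesgue measure. Write the
  spherical mean as an integral over \<open>y\<close> in the unit ball of \<open>f (r sgn y)\<close>. The substitution
  \<open>r = s |y|\<close> for fixed \<open>y\<close>, then \<open>x = s y\<close> for fixed \<open>s\<close>, leaves
  \<open>f x |x| ^ n\<close> times the integral of \<open>n / s ^ (n + 1)\<close> over \<open>s \<ge> |x|\<close>, which is \<open>1 / |x| ^ n\<close>.
\<close>

lemma nn_integral_polar:
  fixes f :: "'a::euclidean_space \<Rightarrow> ennreal"
  assumes [measurable]: "f \<in> borel_measurable borel"
  shows "(\<integral>\<^sup>+x. f x \<partial>lborel) = emeasure lborel (cball (0::'a) 1) *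
    (\<integral>\<^sup>+r. ennreal (real DIM('a) * r ^ (DIM('a) - 1)) * indicator {0<..} r *
      (\<integral>\<^sup>+\<omega>. f (r *\<^sub>R \<omega>) \<partial>sphere_measure) \<partial>lborel)"
proof -
  define n where "n = DIM('a)"
  have n: "n > 0" by (simp add: n_def)
  define V where "V = emeasure lborel (cball (0::'a) 1)"
  have V: "V \<noteq> 0" "V \<noteq> \<infinity>" using emeasure_unit_ball[where 'a='a] by (simp_all add: V_def)
  let ?w = "\<lambda>r::real. ennreal (real n * r ^ (n - 1)) * indicator {0<..} r"
  let ?B = "cball (0::'a) 1"
  have [measurable]: "?B \<in> sets borel" by simp
  have mean: "V * (\<integral>\<^sup>+\<omega>. f (r *\<^sub>R \<omega>) \<partial>sphere_measure)
      = (\<integral>\<^sup>+y. f (r *\<^sub>R sgn y) * indicator ?B y \<partial>lborel)" for r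
  proof -
    have "(\<integral>\<^sup>+\<omega>. f (r *\<^sub>R \<omega>) \<partial>sphere_measure)
        = (\<integral>\<^sup>+y. f (r *\<^sub>R sgn y) * indicator ?B y \<partial>lborel) / V"
      unfolding sphere_measure_def V_def
      by (subst nn_integral_distr, simp, simp, subst nn_integral_uniform_measure) auto
    then show ?thesis
      using V by (metis ennreal_times_divide mult.commute ennreal_mult_divide_eq infinity_ennreal_def)
  qed
  have radial_scaling: "(\<integral>\<^sup>+r. ?w r * f (r *\<^sub>R sgn y) \<partial>lborel)
      = (\<integral>\<^sup>+s. ?w s * ennreal (norm y ^ n) * f (s *\<^sub>R y) \<partial>lborel)" if "y \<noteq> 0" for y
  proof -
    have "(\<integral>\<^sup>+r. ?w r * f (r *\<^sub>R sgn y) \<partial>lborel)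
      = ennreal (norm y) * (\<integral>\<^sup>+s. ?w (0 + norm y * s) * f ((0 + norm y * s) *\<^sub>R sgn y) \<partial>lborel)"
      using that by (subst nn_integral_real_affine[where c="norm y" and t=0]) auto
    also have "\<dots> = (\<integral>\<^sup>+s. ennreal (norm y) * (?w (norm y * s) * f ((norm y * s) *\<^sub>R sgn y)) \<partial>lborel)"
      by (subst nn_integral_cmult[symmetric]) auto
    also have "\<dots> = (\<integral>\<^sup>+s. ?w s * ennreal (norm y ^ n) * f (s *\<^sub>R y) \<partial>lborel)"
    proof (rule nn_integral_cong)
      fix s :: real
      have 1: "(norm y * s) *\<^sub>R sgn y = s *\<^sub>R y"
        using that by (simp add: sgn_div_norm)
      have 2: "ennreal (norm y) * ?w (norm y * s) = ?w s * ennreal (norm y ^ n)"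
      proof (cases "s > 0")
        case True
        have "ennreal (norm y) * ennreal (real n * (norm y * s) ^ (n - 1))
           = ennreal (norm y * (real n * (norm y * s) ^ (n - 1)))"
          using True by (subst ennreal_mult) auto
        also have "norm y * (real n * (norm y * s) ^ (n - 1)) = real n * s ^ (n - 1) * norm y ^ n"
          using n by (cases n) (auto simp: power_mult_distrib)
        finally show ?thesis using True that by (simp add: ennreal_mult zero_less_mult_iff)
      qed (use that in \<open>auto simp: zero_less_mult_iff indicator_def\<close>)
      show "ennreal (norm y) * (?w (norm y * s) * f ((norm y * s) *\<^sub>R sgn y))
          = ?w s * ennreal (norm y ^ n) * f (s *\<^sub>R y)"
        unfolding 1 by (subst 2[symmetric]) (simp add: mult.assoc)
    qed
    finally show ?thesis .
  qed
  have space_scaling: "(\<integral>\<^sup>+y. ennreal (norm y ^ n) * f (s *\<^sub>R y) * indicator ?B y \<partial>lborel)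
      = (\<integral>\<^sup>+x. ennreal (norm x ^ n / s ^ (2 * n)) * f x * (if norm x \<le> s then 1 else 0) \<partial>lborel)"
    if "s > 0" for s
  proof -
    have "(\<integral>\<^sup>+x. ennreal (norm x ^ n / s ^ (2 * n)) * f x * (if norm x \<le> s then 1 else 0) \<partial>lborel)
      = (\<integral>\<^sup>+y. ennreal (s ^ n) * (ennreal (norm (s *\<^sub>R y) ^ n / s ^ (2 * n)) * f (s *\<^sub>R y) * (if norm (s *\<^sub>R y) \<le> s then 1 else 0)) \<partial>lborel)"
      using that
      unfolding n_def by (intro nn_integral_lborel_scale that) measurable
    also have "\<dots> = (\<integral>\<^sup>+y. ennreal (norm y ^ n) * f (s *\<^sub>R y) * indicator ?B y \<partial>lborel)"
    proof (rule nn_integral_cong)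
      fix y :: 'a
      have 1: "(if norm (s *\<^sub>R y) \<le> s then 1 else 0) = (indicator ?B y :: ennreal)"
        using that by (auto simp: indicator_def)
      have "ennreal (s ^ n) * ennreal (norm (s *\<^sub>R y) ^ n / s ^ (2 * n)) = ennreal (norm y ^ n)"
        using that by (subst ennreal_mult[symmetric])
          (auto simp: power_mult_distrib power_mult power2_eq_square field_simps mult_2 power_add)
      then show "ennreal (s ^ n) * (ennreal (norm (s *\<^sub>R y) ^ n / s ^ (2 * n)) * f (s *\<^sub>R y) * (if norm (s *\<^sub>R y) \<le> s then 1 else 0))
          = ennreal (norm y ^ n) * f (s *\<^sub>R y) * indicator ?B y"
        unfolding 1 by (metis mult.assoc)
    qed
    finally show ?thesis ..
  qed
  \<comment> \<open>The exponent \<open>2 * n\<close> collects \<open>|y| ^ n = |x| ^ n / s ^ n\<close> and the Jacobian of \<open>x = s y\<close>.\<close>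
  have tail: "(\<integral>\<^sup>+s. ?w s * (ennreal (norm x ^ n / s ^ (2 * n)) * (if norm x \<le> s then 1 else 0)) \<partial>lborel) = 1"
    if "x \<noteq> 0" for x :: 'a
  proof -
    let ?g = "\<lambda>s. real n * norm x ^ n / s ^ (n + 1)"
    have "(\<integral>\<^sup>+s. ?w s * (ennreal (norm x ^ n / s ^ (2 * n)) * (if norm x \<le> s then 1 else 0)) \<partial>lborel)
       = (\<integral>\<^sup>+s. ennreal (?g s) * indicator {norm x..} s \<partial>lborel)"
    proof (rule nn_integral_cong)
      fix s :: real
      have "ennreal (real n * s ^ (n - 1)) * ennreal (norm x ^ n / s ^ (2 * n)) = ennreal (?g s)" if "s > 0"
        using that n
        by (subst ennreal_mult[symmetric]; cases n) (auto simp: field_simps power_add mult_2 mult_2_right)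
      then show "?w s * (ennreal (norm x ^ n / s ^ (2 * n)) * (if norm x \<le> s then 1 else 0))
        = ennreal (?g s) * indicator {norm x..} s"
        using that zero_less_norm_iff[of x] by (auto simp: indicator_def simp del: zero_less_norm_iff)
    qed
    also have "\<dots> = ennreal (0 - (- (norm x ^ n) / norm x ^ n))"
    proof (rule nn_integral_FTC_atLeast[where F="\<lambda>s. - (norm x ^ n) / s ^ n"])
      show "((\<lambda>s. - (norm x ^ n) / s ^ n) has_real_derivative ?g s) (at s)" if "norm x \<le> s" for s
      proof -
        have s: "s > 0" using that \<open>x \<noteq> 0\<close> by (smt (verit) zero_less_norm_iff)
        have "((\<lambda>s. - (norm x ^ n) / s ^ n) has_real_derivative
          (0 * s ^ n - (- (norm x ^ n)) * (n * s ^ (n - 1))) / (s ^ n * s ^ n)) (at s)"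
          using s by (auto intro!: derivative_eq_intros)
        moreover have "(0 * s ^ n - (- (norm x ^ n)) * (n * s ^ (n - 1))) / (s ^ n * s ^ n) = ?g s"
          using s n by (cases n) (auto simp: field_simps)
        ultimately show ?thesis by simp
      qed
      show "0 \<le> ?g s" if "norm x \<le> s" for s
        using that by (smt (verit) norm_ge_zero divide_nonneg_nonneg mult_nonneg_nonneg of_nat_0_le_iff zero_le_power)
      show "((\<lambda>s. - (norm x ^ n) / s ^ n) \<longlongrightarrow> 0) at_top"
        using n by (intro tendsto_divide_0[OF tendsto_const] filterlim_at_top_imp_at_infinity
            filterlim_pow_at_top filterlim_ident)
    qed simp
    finally show ?thesis using that by simp
  qed
  have "V * (\<integral>\<^sup>+r. ?w r * (\<integral>\<^sup>+\<omega>. f (r *\<^sub>R \<omega>) \<partial>sphere_measure) \<partial>lborel)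
    = (\<integral>\<^sup>+r. V * (?w r * (\<integral>\<^sup>+\<omega>. f (r *\<^sub>R \<omega>) \<partial>sphere_measure)) \<partial>lborel)"
    by (rule nn_integral_cmult[symmetric]) measurable
  also have "\<dots> = (\<integral>\<^sup>+r. ?w r * (\<integral>\<^sup>+y. f (r *\<^sub>R sgn y) * indicator ?B y \<partial>lborel) \<partial>lborel)"
    unfolding mean[symmetric] by (intro nn_integral_cong) (simp only: ac_simps)
  also have "\<dots> = (\<integral>\<^sup>+r. (\<integral>\<^sup>+y. ?w r * (f (r *\<^sub>R sgn y) * indicator ?B y) \<partial>lborel) \<partial>lborel)"
    by (intro nn_integral_cong nn_integral_cmult[symmetric]) measurable
  also have "\<dots> = (\<integral>\<^sup>+y. (\<integral>\<^sup>+r. ?w r * (f (r *\<^sub>R sgn y) * indicator ?B y) \<partial>lborel) \<partial>lborel)"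
    by (rule lborel_pair.Fubini'[symmetric]) measurable
  also have "\<dots> = (\<integral>\<^sup>+y. (\<integral>\<^sup>+r. ?w r * f (r *\<^sub>R sgn y) \<partial>lborel) * indicator ?B y \<partial>lborel)"
  proof (rule nn_integral_cong)
    fix y :: 'a
    have "(\<integral>\<^sup>+r. (?w r * f (r *\<^sub>R sgn y)) * indicator ?B y \<partial>lborel)
        = (\<integral>\<^sup>+r. ?w r * f (r *\<^sub>R sgn y) \<partial>lborel) * indicator ?B y"
      by (rule nn_integral_multc) measurable
    then show "(\<integral>\<^sup>+r. ?w r * (f (r *\<^sub>R sgn y) * indicator ?B y) \<partial>lborel)
        = (\<integral>\<^sup>+r. ?w r * f (r *\<^sub>R sgn y) \<partial>lborel) * indicator ?B y"
      by (simp only: mult.assoc)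
  qed
  also have "\<dots> = (\<integral>\<^sup>+y. (\<integral>\<^sup>+s. ?w s * ennreal (norm y ^ n) * f (s *\<^sub>R y) \<partial>lborel) * indicator ?B y \<partial>lborel)"
    by (rule nn_integral_cong_AE, rule AE_mp[OF AE_lborel_singleton[of 0]], rule AE_I2, rule impI) (simp only: radial_scaling not_False_eq_True)
  also have "\<dots> = (\<integral>\<^sup>+y. (\<integral>\<^sup>+s. ?w s * ennreal (norm y ^ n) * f (s *\<^sub>R y) * indicator ?B y \<partial>lborel) \<partial>lborel)"
    by (intro nn_integral_cong nn_integral_multc[symmetric]) measurable
  also have "\<dots> = (\<integral>\<^sup>+s. (\<integral>\<^sup>+y. ?w s * ennreal (norm y ^ n) * f (s *\<^sub>R y) * indicator ?B y \<partial>lborel) \<partial>lborel)"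
    by (rule lborel_pair.Fubini') measurable
  also have "\<dots> = (\<integral>\<^sup>+s. ?w s * (\<integral>\<^sup>+y. ennreal (norm y ^ n) * f (s *\<^sub>R y) * indicator ?B y \<partial>lborel) \<partial>lborel)"
  proof (rule nn_integral_cong)
    fix s :: real
    have "(\<integral>\<^sup>+y. ?w s * (ennreal (norm y ^ n) * f (s *\<^sub>R y) * indicator ?B y) \<partial>lborel)
        = ?w s * (\<integral>\<^sup>+y. ennreal (norm y ^ n) * f (s *\<^sub>R y) * indicator ?B y \<partial>lborel)"
      by (rule nn_integral_cmult) measurable
    then show "(\<integral>\<^sup>+y. ?w s * ennreal (norm y ^ n) * f (s *\<^sub>R y) * indicator ?B y \<partial>lborel)
        = ?w s * (\<integral>\<^sup>+y. ennreal (norm y ^ n) * f (s *\<^sub>R y) * indicator ?B y \<partial>lborel)"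
      by (simp only: mult.assoc)
  qed
  also have "\<dots> = (\<integral>\<^sup>+s. ?w s * (\<integral>\<^sup>+x. ennreal (norm x ^ n / s ^ (2 * n)) * f x * (if norm x \<le> s then 1 else 0) \<partial>lborel) \<partial>lborel)"
  proof (rule nn_integral_cong)
    fix s :: real
    show "?w s * (\<integral>\<^sup>+y. ennreal (norm y ^ n) * f (s *\<^sub>R y) * indicator ?B y \<partial>lborel) = ?w s * (\<integral>\<^sup>+x. ennreal (norm x ^ n / s ^ (2 * n)) * f x * (if norm x \<le> s then 1 else 0) \<partial>lborel)"
    proof (cases "s > 0")
      case True
      then show ?thesis by (simp only: space_scaling)
    qed simp
  qed
  also have "\<dots> = (\<integral>\<^sup>+s. (\<integral>\<^sup>+x. ?w s * (ennreal (norm x ^ n / s ^ (2 * n)) * f x * (if norm x \<le> s then 1 else 0)) \<partial>lborel) \<partial>lborel)"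
    by (intro nn_integral_cong nn_integral_cmult[symmetric]) measurable
  also have "\<dots> = (\<integral>\<^sup>+x. (\<integral>\<^sup>+s. ?w s * (ennreal (norm x ^ n / s ^ (2 * n)) * f x * (if norm x \<le> s then 1 else 0)) \<partial>lborel) \<partial>lborel)"
    by (rule lborel_pair.Fubini'[symmetric]) measurable
  also have "\<dots> = (\<integral>\<^sup>+x. (\<integral>\<^sup>+s. f x * (?w s * (ennreal (norm x ^ n / s ^ (2 * n)) * (if norm x \<le> s then 1 else 0))) \<partial>lborel) \<partial>lborel)"
    by (intro nn_integral_cong) (simp only: ac_simps)
  also have "\<dots> = (\<integral>\<^sup>+x. f x * (\<integral>\<^sup>+s. ?w s * (ennreal (norm x ^ n / s ^ (2 * n)) * (if norm x \<le> s then 1 else 0)) \<partial>lborel) \<partial>lborel)"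
    by (intro nn_integral_cong nn_integral_cmult) measurable
  also have "\<dots> = (\<integral>\<^sup>+x. f x \<partial>lborel)"
    by (rule nn_integral_cong_AE, rule AE_mp[OF AE_lborel_singleton[of 0]], rule AE_I2, rule impI) (simp only: tail mult_1_right not_False_eq_True)
  finally show ?thesis by (simp add: V_def n_def)
qed

text \<open>
  Polar coordinates as an identity of measures, so that the formula carries over to integrable
  functions of either sign.
\<close>

lemma lborel_eq_polar:
  "(lborel :: 'a::euclidean_space measure) =
     distr (density lborel (\<lambda>r. ennreal (unit_ball_vol DIM('a) * real DIM('a) * r ^ (DIM('a) - 1)) * indicator {0<..} r)
       \<Otimes>\<^sub>M sphere_measure) borel (\<lambda>(r, \<omega>). r *\<^sub>R \<omega>)"
  (is "_ = distr (density lborel ?w \<Otimes>\<^sub>M _) borel ?T")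
proof (rule measure_eqI)
  fix A :: "'a set"
  assume "A \<in> sets lborel"
  then have [measurable]: "A \<in> sets borel" by simp
  let ?V = "ennreal (unit_ball_vol DIM('a))"
  have "emeasure lborel A = (\<integral>\<^sup>+x. indicator A x \<partial>lborel)"
    by simp
  also have "\<dots> = ?V * (\<integral>\<^sup>+r. ennreal (real DIM('a) * r ^ (DIM('a) - 1)) * indicator {0<..} r *
      (\<integral>\<^sup>+\<omega>. indicator A (r *\<^sub>R \<omega>) \<partial>sphere_measure) \<partial>lborel)"
    by (subst nn_integral_polar) (simp_all add: emeasure_cball)
  also have "\<dots> = (\<integral>\<^sup>+r. ?V * (ennreal (real DIM('a) * r ^ (DIM('a) - 1)) * indicator {0<..} r *
      (\<integral>\<^sup>+\<omega>. indicator A (r *\<^sub>R \<omega>) \<partial>sphere_measure)) \<partial>lborel)"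
    by (rule nn_integral_cmult[symmetric]) measurable
  also have "\<dots> = (\<integral>\<^sup>+r. ?w r * (\<integral>\<^sup>+\<omega>. indicator A (r *\<^sub>R \<omega>) \<partial>sphere_measure) \<partial>lborel)"
  proof (rule nn_integral_cong)
    fix r :: real
    have "ennreal (unit_ball_vol DIM('a) * real DIM('a) * r ^ (DIM('a) - 1))
        = ?V * ennreal (real DIM('a) * r ^ (DIM('a) - 1))" if "r > 0"
      unfolding mult.assoc using that by (intro ennreal_mult) auto
    then show "?V * (ennreal (real DIM('a) * r ^ (DIM('a) - 1)) * indicator {0<..} r *
        (\<integral>\<^sup>+\<omega>. indicator A (r *\<^sub>R \<omega>) \<partial>sphere_measure))
      = ?w r * (\<integral>\<^sup>+\<omega>. indicator A (r *\<^sub>R \<omega>) \<partial>sphere_measure)"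
      by (cases "r > 0") (simp_all add: mult.assoc)
  qed
  also have "\<dots> = (\<integral>\<^sup>+r. (\<integral>\<^sup>+\<omega>. indicator A (?T (r, \<omega>)) \<partial>sphere_measure) \<partial>density lborel ?w)"
    unfolding prod.case by (rule nn_integral_density[symmetric]) measurable
  also have "\<dots> = (\<integral>\<^sup>+p. indicator A (?T p) \<partial>(density lborel ?w \<Otimes>\<^sub>M sphere_measure))"
    by (rule sphere_measure.nn_integral_fst) measurable
  also have "\<dots> = emeasure (distr (density lborel ?w \<Otimes>\<^sub>M sphere_measure) borel ?T) A"
    by (simp add: nn_integral_indicator[symmetric] nn_integral_distr del: nn_integral_indicator)
  finally show "emeasure lborel A = emeasure (distr (density lborel ?w \<Otimes>\<^sub>M sphere_measure) borel ?T) A" .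
qed simp

theorem integral_polar:
  fixes f :: "'a::euclidean_space \<Rightarrow> real"
  assumes f: "integrable lborel f"
  shows "(LINT x|lborel. f x) =
    (LINT r|lborel. (unit_ball_vol DIM('a) * real DIM('a) * r ^ (DIM('a) - 1) * indicator {0<..} r) * sphere_mean f r)"
proof -
  define w :: "real \<Rightarrow> real" where
    "w r = unit_ball_vol DIM('a) * real DIM('a) * r ^ (DIM('a) - 1) * indicator {0<..} r" for r
  let ?D = "density lborel (\<lambda>r. ennreal (w r))"
  let ?T = "\<lambda>(r::real, \<omega>::'a). r *\<^sub>R \<omega>"
  have w [measurable]: "w \<in> borel_measurable borel" unfolding w_def[abs_def] by measurable
  have w_nonneg: "0 \<le> w r" for r by (simp add: w_def indicator_def)
  have [measurable]: "f \<in> borel_measurable borel" using f by auto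
  interpret D: sigma_finite_measure ?D
    by (subst sigma_finite_measure.sigma_finite_iff_density_finite[OF sigma_finite_lborel]) auto
  interpret P: pair_sigma_finite ?D "sphere_measure :: 'a measure" ..
  have w_eq: "(\<lambda>r. ennreal (unit_ball_vol DIM('a) * real DIM('a) * r ^ (DIM('a) - 1)) * indicator {0<..} r)
      = (\<lambda>r. ennreal (w r))"
    by (auto simp: w_def indicator_def)
  have polar: "(lborel :: 'a measure) = distr (?D \<Otimes>\<^sub>M sphere_measure) borel ?T"
    using lborel_eq_polar[where 'a='a] unfolding w_eq .
  have T: "?T \<in> ?D \<Otimes>\<^sub>M sphere_measure \<rightarrow>\<^sub>M borel" by measurable
  have "integrable (distr (?D \<Otimes>\<^sub>M sphere_measure) borel ?T) f"
    using f unfolding polar[symmetric] .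
  then have int: "integrable (?D \<Otimes>\<^sub>M sphere_measure) (\<lambda>p. f (?T p))"
    by (subst (asm) integrable_distr_eq) simp_all
  have "(LINT x|lborel. f x) = (LINT x|distr (?D \<Otimes>\<^sub>M sphere_measure) borel ?T. f x)"
    using polar by (rule arg_cong)
  also have "\<dots> = (LINT p|(?D \<Otimes>\<^sub>M sphere_measure). f (?T p))"
    by (rule integral_distr) simp_all
  also have "\<dots> = (LINT r|?D. sphere_mean f r)"
    unfolding sphere_mean_def using P.integral_fst'[OF int] by simp
  also have "\<dots> = (LINT r|lborel. w r * sphere_mean f r)"
    using w_nonneg unfolding sphere_mean_def
    by (subst integral_density) (auto intro!: sphere_measure.borel_measurable_lebesgue_integral)
  finally show ?thesis unfolding w_def .
qed

lemma integrable_sphere_measure: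
  fixes f :: "'a::euclidean_space \<Rightarrow> real"
  assumes "continuous_on UNIV f"
  shows "integrable sphere_measure (\<lambda>\<omega>. f (r *\<^sub>R \<omega>))"
proof -
  have [measurable]: "f \<in> borel_measurable borel"
    using assms by (rule borel_measurable_continuous_onI)
  have "compact (f ` cball 0 \<bar>r\<bar>)"
    using assms by (intro compact_continuous_image continuous_on_subset[OF assms]) auto
  then obtain C where C: "\<And>x. x \<in> cball 0 \<bar>r\<bar> \<Longrightarrow> norm (f x) \<le> C"
    using compact_imp_bounded bounded_iff by (metis imageI)
  show ?thesis
  proof (rule sphere_measure.integrable_const_bound[where B=C])
    show "AE \<omega> in sphere_measure. norm (f (r *\<^sub>R \<omega>)) \<le> C"
      using AE_sphere_measure by eventually_elim (simp add: C[unfolded real_norm_def])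
  qed measurable
qed

lemma sphere_mean_cong:
  fixes f g :: "'a::euclidean_space \<Rightarrow> real"
  assumes [measurable]: "f \<in> borel_measurable borel" "g \<in> borel_measurable borel"
    and "\<And>x. norm x = \<bar>r\<bar> \<Longrightarrow> f x = g x"
  shows "sphere_mean f r = sphere_mean g r"
  unfolding sphere_mean_def
proof (rule integral_cong_AE)
  show "AE \<omega> in sphere_measure. f (r *\<^sub>R \<omega>) = g (r *\<^sub>R \<omega>)"
    using AE_sphere_measure by eventually_elim (auto intro!: assms)
qed measurable

lemma sphere_mean_const [simp]: "sphere_mean (\<lambda>_ :: 'a::euclidean_space. c) r = c"
  using emeasure_sphere_measure[where 'a='a] by (simp add: sphere_mean_def measure_def)

lemma sphere_mean_mult_right: "sphere_mean (\<lambda>x. c * f x) r = c * sphere_mean f r"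
  by (simp add: sphere_mean_def)

lemma sphere_mean_sum:
  fixes f :: "'i \<Rightarrow> 'a::euclidean_space \<Rightarrow> real"
  assumes "\<And>j. j \<in> J \<Longrightarrow> continuous_on UNIV (f j)"
  shows "sphere_mean (\<lambda>x. \<Sum>j\<in>J. f j x) r = (\<Sum>j\<in>J. sphere_mean (f j) r)"
  unfolding sphere_mean_def by (intro Bochner_Integration.integral_sum integrable_sphere_measure assms)

lemma sphere_mean_add:
  fixes f g :: "'a::euclidean_space \<Rightarrow> real"
  assumes "continuous_on UNIV f" "continuous_on UNIV g"
  shows "sphere_mean (\<lambda>x. f x + g x) r = sphere_mean f r + sphere_mean g r"
  unfolding sphere_mean_def by (intro Bochner_Integration.integral_add integrable_sphere_measure assms)

text \<open>
  Dominated convergence: along a convergent sequence of parameters, the arguments of \<open>u\<close> stay in a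
  compact set.
\<close>

lemma continuous_sphere_mean:
  fixes u :: "real \<times> 'a::euclidean_space \<Rightarrow> real"
  assumes u: "continuous_on UNIV u"
  shows "continuous_on UNIV (\<lambda>(t, r). sphere_mean (\<lambda>x. u (t, x)) r)"
  unfolding continuous_on_sequentially
proof (intro allI ballI impI)
  fix X :: "nat \<Rightarrow> real \<times> real" and p :: "real \<times> real"
  assume "(\<forall>n. X n \<in> UNIV) \<and> X \<longlonglongrightarrow> p"
  then have X: "X \<longlonglongrightarrow> p" by simp
  have [measurable]: "u \<in> borel_measurable borel"
    using u by (rule borel_measurable_continuous_onI)
  obtain M where M: "\<And>n. norm (X n) \<le> M"
    using convergent_imp_bounded[OF X] unfolding bounded_iff by auto
  have "compact (u ` ({-M..M} \<times> cball 0 M))"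
    by (intro compact_continuous_image continuous_on_subset[OF u] compact_Times) auto
  then obtain C where C: "\<And>z. z \<in> {-M..M} \<times> cball 0 M \<Longrightarrow> norm (u z) \<le> C"
    using compact_imp_bounded bounded_iff by (metis imageI)
  have "(\<lambda>n. LINT \<omega>|sphere_measure. u (fst (X n), snd (X n) *\<^sub>R \<omega>)) \<longlonglongrightarrow>
      (LINT \<omega>|sphere_measure. u (fst p, snd p *\<^sub>R \<omega>))"
  proof (rule integral_dominated_convergence[where w="\<lambda>_. C"])
    show "AE \<omega> in sphere_measure. (\<lambda>n. u (fst (X n), snd (X n) *\<^sub>R \<omega>)) \<longlonglongrightarrow> u (fst p, snd p *\<^sub>R \<omega>)"
      using u X by (intro AE_I2 continuous_on_tendsto_compose[OF u] tendsto_intros) auto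
    show "AE \<omega> in sphere_measure. norm (u (fst (X n), snd (X n) *\<^sub>R \<omega>)) \<le> C" for n
      using AE_sphere_measure
    proof eventually_elim
      fix \<omega> :: 'a
      assume "norm \<omega> = 1"
      moreover have "\<bar>fst (X n)\<bar> \<le> M" "\<bar>snd (X n)\<bar> \<le> M"
        using M[of n] norm_fst_le[of "fst (X n)" "snd (X n)"] norm_snd_le[of "snd (X n)" "fst (X n)"] by auto
      ultimately show "norm (u (fst (X n), snd (X n) *\<^sub>R \<omega>)) \<le> C"
        by (intro C) auto
    qed
  qed simp_all
  then show "((\<lambda>(t, r). sphere_mean (\<lambda>x. u (t, x)) r) \<circ> X) \<longlonglongrightarrow> (\<lambda>(t, r). sphere_mean (\<lambda>x. u (t, x)) r) p"
    by (simp add: sphere_mean_def split_beta comp_def)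
qed

section \<open>Testing against radial wave packets\<close>

text \<open>
  This is \<open>r\<close> times the spherical mean in the coordinates \<open>\<xi> = t + r\<close>, \<open>\<eta> = t - r\<close>. The factor \<open>r\<close>
  turns the radial wave operator in three dimensions into the one-dimensional one.
\<close>

definition light_cone_mean :: "(real \<times> 'a::euclidean_space \<Rightarrow> real) \<Rightarrow> real \<Rightarrow> real \<Rightarrow> real" where
  "light_cone_mean u \<xi> \<eta> = (\<xi> - \<eta>) / 2 * sphere_mean (\<lambda>x. u ((\<xi> + \<eta>) / 2, x)) ((\<xi> - \<eta>) / 2)"

lemma continuous_light_cone_mean:
  assumes "continuous_on UNIV u"
  shows "continuous_on UNIV (\<lambda>(\<xi>, \<eta>). light_cone_mean u \<xi> \<eta>)"
proof -
  have "continuous_on UNIV (\<lambda>p. (fst p - snd p) / 2 *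
     (\<lambda>(t, r). sphere_mean (\<lambda>x. u (t, x)) r) ((fst p + snd p) / 2, (fst p - snd p) / 2))"
    by (intro continuous_intros continuous_on_compose2[OF continuous_sphere_mean[OF assms]]) auto
  then show ?thesis by (simp add: light_cone_mean_def split_beta)
qed

lemma integrable_compact_support:
  fixes f :: "'a::euclidean_space \<Rightarrow> real"
  assumes "compact K" "continuous_on K f" "\<And>x. x \<notin> K \<Longrightarrow> f x = 0"
  shows "integrable lborel f"
proof -
  have "(\<lambda>x. indicator K x *\<^sub>R f x) = f"
    using assms(3) by (auto simp: indicator_def fun_eq_iff)
  then show ?thesis
    using borel_integrable_compact[OF assms(1,2)] by simp
qed

text \<open>
  Polar coordinates contribute a factor \<open>r\<^sup>2\<close>, of which the denominator of the wave packet removes one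
  power; the other one is the factor \<open>r\<close> of the light cone mean. The two linear
  substitutions \<open>t = r + \<eta>\<close> and \<open>\<xi> = \<eta> + 2 r\<close> have total Jacobian \<open>1 / 2\<close>.
\<close>

lemma integral_radial_wave:
  fixes u :: "real \<times> (real^3) \<Rightarrow> real"
  assumes u: "continuous_on UNIV u" and AB: "continuous_on UNIV A" "continuous_on UNIV B"
    and A: "\<And>x. A x \<noteq> 0 \<Longrightarrow> a \<le> x \<and> x \<le> a'" and B: "\<And>x. B x \<noteq> 0 \<Longrightarrow> b \<le> x \<and> x \<le> b'"
    and ba: "b' < a"
  shows "(LINT z|lborel. u z * radial_wave A B z)
    = 3 / 2 * unit_ball_vol 3 * (LINT p|lborel. A (fst p) * B (snd p) * light_cone_mean u (fst p) (snd p))"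
proof -
  let ?F = "\<lambda>z. u z * radial_wave A B z"
  let ?K = "{z::real \<times> (real^3). a \<le> fst z + norm (snd z) \<and> fst z + norm (snd z) \<le> a' \<and>
     b \<le> fst z - norm (snd z) \<and> fst z - norm (snd z) \<le> b'}"
  \<comment> \<open>A crude common bound for \<open>|t|\<close> and \<open>|x|\<close> on the support.\<close>
  define M where "M = \<bar>a\<bar> + \<bar>a'\<bar> + \<bar>b\<bar> + \<bar>b'\<bar>"
  have K_bound: "\<bar>fst z\<bar> \<le> M \<and> norm (snd z) \<le> M \<and> snd z \<noteq> 0" if "z \<in> ?K" for z
    using that ba norm_ge_zero[of "snd z"] unfolding M_def by (auto simp: abs_le_iff simp del: norm_ge_zero)
  have F_out: "?F z = 0" if "z \<notin> ?K" for z
    using that A[of "fst z + norm (snd z)"] B[of "fst z - norm (snd z)"] by (auto simp: radial_wave_def)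
  have F_cont: "continuous_on S ?F" if "\<And>z. z \<in> S \<Longrightarrow> snd z \<noteq> 0" for S
    unfolding radial_wave_def using that
    by (intro continuous_intros continuous_on_subset[OF u] continuous_on_compose2[OF AB(1)]
        continuous_on_compose2[OF AB(2)]) auto
  have K: "compact ?K"
  proof -
    have "closed ?K"
      by (intro closed_Collect_conj closed_Collect_le continuous_intros)
    moreover have "bounded ?K"
    proof (rule bounded_subset)
      show "bounded ({-M..M} \<times> cball (0 :: real^3) M)"
        by (intro bounded_Times) auto
      show "?K \<subseteq> {-M..M} \<times> cball 0 M"
      proof
        fix z assume "z \<in> ?K"
        from K_bound[OF this] show "z \<in> {-M..M} \<times> cball 0 M"
          by (cases z) (auto simp: abs_le_iff)
      qed
    qed
    ultimately show ?thesis by (simp add: compact_eq_bounded_closed)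
  qed
  have F_int: "integrable lborel ?F"
    by (rule integrable_compact_support[OF K F_cont F_out]) (use K_bound in auto)
  have F_slice_meas: "(\<lambda>x. ?F (t, x)) \<in> borel_measurable borel" for t
  proof -
    have "(\<lambda>x. A (t + norm x)) \<in> borel_measurable borel" "(\<lambda>x. B (t - norm x)) \<in> borel_measurable borel"
      by (intro borel_measurable_continuous_onI continuous_on_compose2[OF AB(1)]
          continuous_on_compose2[OF AB(2)] continuous_intros; simp)+
    moreover have "(\<lambda>x. u (t, x)) \<in> borel_measurable borel"
      by (intro borel_measurable_continuous_onI continuous_on_compose2[OF u] continuous_intros) simp
    ultimately show ?thesis unfolding radial_wave_def fst_conv snd_conv
      by (intro borel_measurable_times borel_measurable_divide borel_measurable_norm measurable_ident_sets) auto
  qed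
  have u_slice_meas: "(\<lambda>x. c * u (t, x)) \<in> borel_measurable borel" for c t
    by (intro borel_measurable_continuous_onI continuous_intros continuous_on_compose2[OF u]) simp
  define G where "G = (\<lambda>(t, r). A (t + r) * B (t - r) * (r * sphere_mean (\<lambda>x. u (t, x)) r))"
  define c where "c = 3 * unit_ball_vol 3"
  have G_cont: "continuous_on UNIV G"
  proof -
    have "continuous_on UNIV (\<lambda>p. A (fst p + snd p) * B (fst p - snd p) * (snd p *
       (\<lambda>(t, r). sphere_mean (\<lambda>x. u (t, x)) r) (fst p, snd p)))"
      by (intro continuous_intros continuous_on_compose2[OF AB(1)] continuous_on_compose2[OF AB(2)]
          continuous_on_compose2[OF continuous_sphere_mean[OF u]]) auto
    then show ?thesis by (simp add: G_def split_beta)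
  qed
  have G_out: "t + r \<in> {a..a'} \<and> t - r \<in> {b..b'}" if "G (t, r) \<noteq> 0" for t r
    using A[of "t + r"] B[of "t - r"] that by (auto simp: G_def)
  have slice: "(LINT x|lborel. ?F (t, x)) = (LINT r|lborel. c * G (t, r))" for t
  proof -
    have "compact ({x. (t, x) \<in> ?K})"
    proof -
      have "closed {x. (t, x) \<in> ?K}"
        unfolding mem_Collect_eq fst_conv snd_conv
        by (intro closed_Collect_conj closed_Collect_le continuous_intros)
      moreover have "bounded {x. (t, x) \<in> ?K}"
        by (rule bounded_subset[of "cball 0 M"]) (use K_bound[of "(t, _)"] in auto)
      ultimately show ?thesis by (simp add: compact_eq_bounded_closed)
    qed
    moreover have "continuous_on {x. (t, x) \<in> ?K} (\<lambda>x. ?F (t, x))"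
      by (rule continuous_on_compose2[OF F_cont[of ?K]]) (use K_bound in \<open>auto intro!: continuous_intros\<close>)
    ultimately have "integrable lborel (\<lambda>x. ?F (t, x))"
      by (rule integrable_compact_support) (use F_out in auto)
    then have "(LINT x|lborel. ?F (t, x))
      = (LINT r|lborel. (unit_ball_vol DIM(real^3) * real DIM(real^3) * r ^ (DIM(real^3) - 1) * indicator {0<..} r)
           * sphere_mean (\<lambda>x. ?F (t, x)) r)"
      by (rule integral_polar)
    also have "\<dots> = (LINT r|lborel. c * G (t, r))"
    proof (rule Bochner_Integration.integral_cong[OF refl])
      fix r :: real
      show "(unit_ball_vol DIM(real^3) * real DIM(real^3) * r ^ (DIM(real^3) - 1) * indicator {0<..} r)
           * sphere_mean (\<lambda>x. ?F (t, x)) r = c * G (t, r)"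
      proof (cases "r > 0")
        case True
        have "sphere_mean (\<lambda>x. ?F (t, x)) r = sphere_mean (\<lambda>x. A (t + r) * B (t - r) / r * u (t, x)) r"
        proof (rule sphere_mean_cong[OF F_slice_meas u_slice_meas])
          show "?F (t, x) = A (t + r) * B (t - r) / r * u (t, x)" if "norm x = \<bar>r\<bar>" for x
            using that True by (simp add: radial_wave_def)
        qed
        also have "\<dots> = A (t + r) * B (t - r) / r * sphere_mean (\<lambda>x. u (t, x)) r"
          by (rule sphere_mean_mult_right)
        finally show ?thesis using True
          by (simp add: c_def G_def power2_eq_square)
      next
        case False
        then have "G (t, r) = 0" using G_out[of t r] ba by force
        then show ?thesis using False by simp
      qed
    qed
    finally show ?thesis .
  qed
  have G_int: "integrable lborel G"
    by (rule integrable_compact_support[of "cbox (-M, -M) (M, M)"])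
       (use G_out in \<open>force intro: continuous_on_subset[OF G_cont] simp: M_def\<close>)+
  define H where "H = (\<lambda>(\<eta>, r). G (r + \<eta>, r))"
  have H_int: "integrable lborel H"
  proof (rule integrable_compact_support[of "cbox (-M, -M) (M, M)"])
    show "continuous_on (cbox (-M, -M) (M, M)) H"
      unfolding H_def split_beta
      by (rule continuous_on_compose2[OF G_cont]) (auto intro!: continuous_intros)
    show "H p = 0" if "p \<notin> cbox (-M, -M) (M, M)" for p
      using that G_out[of "snd p + fst p" "snd p"] by (cases p) (force simp: H_def M_def)
  qed simp
  define Q where "Q = (\<lambda>(\<xi>, \<eta>). A \<xi> * B \<eta> * light_cone_mean u \<xi> \<eta>)"
  have Q_cont: "continuous_on UNIV Q"
  proof -
    have "continuous_on UNIV (\<lambda>p. A (fst p) * B (snd p) * (\<lambda>(\<xi>, \<eta>). light_cone_mean u \<xi> \<eta>) (fst p, snd p))"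
      by (intro continuous_intros continuous_on_compose2[OF AB(1)] continuous_on_compose2[OF AB(2)]
          continuous_on_compose2[OF continuous_light_cone_mean[OF u]]) auto
    then show ?thesis by (simp add: Q_def split_beta)
  qed
  have Q_int: "integrable lborel Q"
  proof (rule integrable_compact_support[of "cbox (a, b) (a', b')"])
    show "Q p = 0" if "p \<notin> cbox (a, b) (a', b')" for p
      using that A[of "fst p"] B[of "snd p"] by (cases p) (force simp: Q_def)
  qed (auto intro: continuous_on_subset[OF Q_cont])
  have "(LINT z|lborel. ?F z) = (LINT t|lborel. LINT x|lborel. ?F (t, x))"
    using lborel_pair.integral_fst'[of ?F] F_int by (simp add: lborel_prod)
  also have "\<dots> = c * (LINT t|lborel. LINT r|lborel. G (t, r))"
    unfolding slice by simp
  also have "(LINT t|lborel. LINT r|lborel. G (t, r)) = (LINT r|lborel. LINT t|lborel. G (t, r))"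
    using lborel_pair.Fubini_integral[of "\<lambda>t r. G (t, r)"] G_int by (simp add: lborel_prod)
  also have "\<dots> = (LINT r|lborel. LINT \<eta>|lborel. H (\<eta>, r))"
  proof (rule Bochner_Integration.integral_cong[OF refl])
    fix r :: real
    show "(LINT t|lborel. G (t, r)) = (LINT \<eta>|lborel. H (\<eta>, r))"
      using lborel_integral_real_affine[of 1 "\<lambda>t. G (t, r)" r] by (simp add: H_def)
  qed
  also have "\<dots> = (LINT \<eta>|lborel. LINT r|lborel. H (\<eta>, r))"
    using lborel_pair.Fubini_integral[of "\<lambda>\<eta> r. H (\<eta>, r)"] H_int by (simp add: lborel_prod)
  also have "\<dots> = (LINT \<eta>|lborel. 1 / 2 * (LINT \<xi>|lborel. Q (\<xi>, \<eta>)))"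
  proof (rule Bochner_Integration.integral_cong[OF refl])
    fix \<eta> :: real
    have "Q (\<eta> + 2 * r, \<eta>) = H (\<eta>, r)" for r
    proof -
      have "(\<eta> + 2 * r + \<eta>) / 2 = r + \<eta>" "(\<eta> + 2 * r - \<eta>) / 2 = r"
        "r + \<eta> + r = \<eta> + 2 * r" "r + \<eta> - r = \<eta>" by simp_all
      then show ?thesis
        by (simp only: Q_def H_def G_def light_cone_mean_def prod.case)
    qed
    then show "(LINT r|lborel. H (\<eta>, r)) = 1 / 2 * (LINT \<xi>|lborel. Q (\<xi>, \<eta>))"
      using lborel_integral_real_affine[of 2 "\<lambda>\<xi>. Q (\<xi>, \<eta>)" \<eta>] by simp
  qed
  also have "\<dots> = 1 / 2 * (LINT p|lborel. Q p)"
    using lborel_pair.integral_snd[of "\<lambda>\<xi> \<eta>. Q (\<xi>, \<eta>)"] Q_int by (simp add: lborel_prod)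
  finally show ?thesis by (simp add: c_def Q_def split_beta)
qed

lemma lborel_integral_affine:
  fixes g :: "'a::euclidean_space \<Rightarrow> real"
  assumes [measurable]: "g \<in> borel_measurable borel" and "c > 0"
  shows "(LINT x|lborel. g x) = (LINT y|lborel. c ^ DIM('a) * g (t + c *\<^sub>R y))"
proof -
  let ?M = "distr lborel borel (\<lambda>x::'a. t + c *\<^sub>R x)"
  have "integral\<^sup>L lborel g = integral\<^sup>L (density ?M (\<lambda>_. ennreal (\<bar>c\<bar> ^ DIM('a)))) g"
    by (rule arg_cong[where f="\<lambda>M. integral\<^sup>L M g"], rule lborel_affine) (use assms in simp)
  also have "\<dots> = (LINT x|?M. (\<bar>c\<bar> ^ DIM('a)) *\<^sub>R g x)"
    by (rule integral_density) simp_all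
  also have "\<dots> = (LINT y|lborel. (\<bar>c\<bar> ^ DIM('a)) *\<^sub>R g (t + c *\<^sub>R y))"
    by (rule integral_distr) simp_all
  finally show ?thesis using assms by simp
qed

section \<open>The rectangle identity in characteristic coordinates\<close>

lemma step_algebra_continuous: "A \<in> step_algebra \<Longrightarrow> continuous_on S A"
  using step_algebra_derivative[of A] by (meson DERIV_isCont continuous_at_imp_continuous_on)

definition smooth_step_deriv :: "real \<Rightarrow> real" where
  "smooth_step_deriv = deriv smooth_step"

lemma smooth_step_deriv_in_step_algebra: "smooth_step_deriv \<in> step_algebra"
  and DERIV_smooth_step: "(smooth_step has_real_derivative smooth_step_deriv x) (at x)"
proof -
  obtain s' where s': "s' \<in> step_algebra" "\<And>x. (smooth_step has_real_derivative s' x) (at x)"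
    using step_algebra_derivative[OF smooth_step_in_step_algebra] by blast
  then have "smooth_step_deriv = s'"
    unfolding smooth_step_deriv_def by (auto intro!: DERIV_imp_deriv)
  with s' show "smooth_step_deriv \<in> step_algebra" "(smooth_step has_real_derivative smooth_step_deriv x) (at x)"
    by auto
qed

lemma smooth_step_deriv_support:
  assumes "smooth_step_deriv x \<noteq> 0"
  shows "0 \<le> x \<and> x \<le> 1"
proof (rule ccontr)
  assume "\<not> ?thesis"
  then consider "x < 0" | "x > 1" by linarith
  then have "(smooth_step has_real_derivative 0) (at x)"
  proof cases
    case 1
    show ?thesis
      by (rule has_field_derivative_transform_within_open[where S="{..<0}" and f="\<lambda>_. 0"])
         (use 1 in \<open>auto simp: smooth_step_eq_0\<close>)
  next
    case 2
    show ?thesis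
      by (rule has_field_derivative_transform_within_open[where S="{1<..}" and f="\<lambda>_. 1"])
         (use 2 in \<open>auto simp: smooth_step_eq_1\<close>)
  qed
  then show False using DERIV_unique[OF DERIV_smooth_step] assms by blast
qed

lemma smooth_step_deriv_continuous: "continuous_on S smooth_step_deriv"
  by (rule step_algebra_continuous[OF smooth_step_deriv_in_step_algebra])

lemma integral_smooth_step_deriv: "(LINT x|lborel. smooth_step_deriv x) = 1"
proof -
  have "(LINT x|lborel. smooth_step_deriv x) = (LINT x|lborel. smooth_step_deriv x * indicator {0..1} x)"
    by (rule Bochner_Integration.integral_cong) (use smooth_step_deriv_support in \<open>auto simp: indicator_def\<close>)
  also have "\<dots> = smooth_step 1 - smooth_step 0"
    by (rule integral_FTC_Icc_real)
       (auto intro: DERIV_smooth_step continuous_on_interior smooth_step_deriv_continuous[of UNIV, unfolded continuous_on_eq_continuous_at[OF open_UNIV], rule_format])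
  finally show ?thesis by (simp add: smooth_step_eq_0 smooth_step_eq_1)
qed

lemma integral_smooth_step_deriv_product:
  "(LINT z|lborel. smooth_step_deriv (fst z) * smooth_step_deriv (snd z)) = 1"
proof -
  have "integrable lborel (\<lambda>z. smooth_step_deriv (fst z) * smooth_step_deriv (snd z))"
  proof (rule integrable_compact_support[of "cbox (0, 0) (1, 1)"])
    show "smooth_step_deriv (fst z) * smooth_step_deriv (snd z) = 0" if "z \<notin> cbox (0, 0) (1, 1)" for z
      using that smooth_step_deriv_support[of "fst z"] smooth_step_deriv_support[of "snd z"]
      by (cases z) auto
  qed (auto intro!: continuous_intros continuous_on_compose2[OF smooth_step_deriv_continuous[of UNIV]])
  then have "(LINT z|lborel. smooth_step_deriv (fst z) * smooth_step_deriv (snd z))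
      = (LINT x|lborel. LINT y|lborel. smooth_step_deriv x * smooth_step_deriv y)"
    using lborel_pair.integral_fst'[of "\<lambda>z. smooth_step_deriv (fst z) * smooth_step_deriv (snd z)"]
    by (simp add: lborel_prod)
  then show ?thesis by (simp add: integral_smooth_step_deriv)
qed

text \<open>
  The derivative of a step of width \<open>1 / N\<close> that starts at \<open>p + k / N\<close>. The offset \<open>k\<close> keeps the
  supports of incoming and outgoing profiles disjoint even when their limits touch.
\<close>

definition bump :: "real \<Rightarrow> real \<Rightarrow> real \<Rightarrow> real \<Rightarrow> real" where
  "bump N k p x = N * smooth_step_deriv (N * x + (- N * p - k))"

lemma bump_in_step_algebra: "bump N k p \<in> step_algebra"
  unfolding bump_def[abs_def] by (intro step_algebra.intros smooth_step_deriv_in_step_algebra)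

lemma bump_support:
  assumes "bump N k p x \<noteq> 0" "N > 0"
  shows "p + k / N \<le> x \<and> x \<le> p + (k + 1) / N"
proof -
  have "0 \<le> N * x + (- N * p - k)" "N * x + (- N * p - k) \<le> 1"
    using smooth_step_deriv_support[of "N * x + (- N * p - k)"] assms by (auto simp: bump_def)
  then have "k \<le> N * (x - p)" "N * (x - p) \<le> k + 1" by (simp_all add: algebra_simps)
  then have "k / N \<le> x - p" "x - p \<le> (k + 1) / N"
    using assms(2) by (simp_all add: pos_divide_le_eq pos_le_divide_eq mult.commute)
  then show ?thesis by linarith
qed

lemma bump_product_support:
  assumes "N > 0" "z \<notin> cbox (p + k / N, q + l / N) (p + (k + 1) / N, q + (l + 1) / N)"
  shows "bump N k p (fst z) * bump N l q (snd z) = 0"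
  using assms(2) bump_support[OF _ assms(1), of k p "fst z"] bump_support[OF _ assms(1), of l q "snd z"]
  by (cases z) auto

lemma integrable_bump_product:
  fixes G :: "real \<Rightarrow> real \<Rightarrow> real"
  assumes "continuous_on UNIV (\<lambda>(x, y). G x y)" "N > 0"
  shows "integrable lborel (\<lambda>z. bump N k p (fst z) * bump N l q (snd z) * G (fst z) (snd z))"
proof (rule integrable_compact_support[of "cbox (p + k / N, q + l / N) (p + (k + 1) / N, q + (l + 1) / N)"])
  show "continuous_on S (\<lambda>z. bump N k p (fst z) * bump N l q (snd z) * G (fst z) (snd z))" for S
    using continuous_on_subset[OF assms(1)]
    by (intro continuous_intros continuous_on_compose2[OF step_algebra_continuous[OF bump_in_step_algebra, of UNIV]])
       (auto simp: split_beta)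
  show "bump N k p (fst z) * bump N l q (snd z) * G (fst z) (snd z) = 0"
    if "z \<notin> cbox (p + k / N, q + l / N) (p + (k + 1) / N, q + (l + 1) / N)" for z
    using bump_product_support[OF assms(2) that] by simp
qed simp

text \<open>
  After rescaling, the two bumps become a fixed kernel with integral one on the unit square, while the
  argument of \<open>G\<close> tends to \<open>(p, q)\<close>; the offsets \<open>k\<close> and \<open>l\<close> disappear in the limit.
\<close>

lemma bump_concentration:
  fixes G :: "real \<Rightarrow> real \<Rightarrow> real"
  assumes G: "continuous_on UNIV (\<lambda>(x, y). G x y)"
  shows "(\<lambda>n. LINT z|lborel. bump (real (Suc n)) k p (fst z) * bump (real (Suc n)) l q (snd z) * G (fst z) (snd z))
     \<longlonglongrightarrow> G p q"
proof -
  let ?s = "\<lambda>z. smooth_step_deriv (fst z) * smooth_step_deriv (snd z)"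
  let ?\<epsilon> = "\<lambda>n. 1 / real (Suc n)"
  let ?h = "\<lambda>n z. ?s z * G (p + ?\<epsilon> n * (k + fst z)) (q + ?\<epsilon> n * (l + snd z))"
  have s_cont: "continuous_on S ?s" for S :: "(real \<times> real) set"
    by (intro continuous_intros continuous_on_compose2[OF smooth_step_deriv_continuous[of UNIV]]) auto
  have G_cont: "continuous_on S (\<lambda>z. G (f z) (g z))" if "continuous_on S f" "continuous_on S g"
    for S :: "(real \<times> real) set" and f g
    using continuous_on_compose2[OF G continuous_on_Pair[OF that]] by simp
  have rescale: "(LINT z|lborel. bump (real (Suc n)) k p (fst z) * bump (real (Suc n)) l q (snd z) * G (fst z) (snd z))
     = (LINT z|lborel. ?h n z)" for n
  proof -
    define N where "N = real (Suc n)"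
    have N: "N > 0" by (simp add: N_def)
    have "(LINT z|lborel. bump N k p (fst z) * bump N l q (snd z) * G (fst z) (snd z))
      = (LINT y|lborel. (1 / N) ^ DIM(real \<times> real) * (\<lambda>z. bump N k p (fst z) * bump N l q (snd z) * G (fst z) (snd z))
            ((p + k / N, q + l / N) + (1 / N) *\<^sub>R y))"
      using N integrable_bump_product[OF G N, of k p l q]
      by (intro lborel_integral_affine) auto
    also have "\<dots> = (LINT z|lborel. ?h n z)"
    proof (rule Bochner_Integration.integral_cong[OF refl])
      fix y :: "real \<times> real"
      have "N * (p + k / N + fst y / N) + (- N * p - k) = fst y" "N * (q + l / N + snd y / N) + (- N * q - l) = snd y"
        using N by (simp_all add: distrib_left)
      then show "(1 / N) ^ DIM(real \<times> real) * (\<lambda>z. bump N k p (fst z) * bump N l q (snd z) * G (fst z) (snd z))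
            ((p + k / N, q + l / N) + (1 / N) *\<^sub>R y) = ?h n y"
        using N unfolding N_def[symmetric]
        by (simp add: bump_def power2_eq_square add_divide_distrib add.assoc)
    qed
    finally show ?thesis by (simp add: N_def)
  qed
  let ?box = "cbox (0::real, 0::real) (1, 1)"
  let ?H = "\<lambda>y::(real \<times> real) \<times> real. ?s (fst y) * G (p + snd y * (k + fst (fst y))) (q + snd y * (l + snd (fst y)))"
  have "continuous_on (?box \<times> {0..1}) ?H"
  proof -
    have 1: "continuous_on (?box \<times> {0..1}) (\<lambda>y. ?s (fst y))"
      by (rule continuous_on_compose2[OF s_cont[of UNIV]]) (auto intro!: continuous_intros)
    have "continuous_on (?box \<times> {0..1}) (\<lambda>y::(real \<times> real) \<times> real.
        (\<lambda>(x, y). G x y) (p + snd y * (k + fst (fst y)), q + snd y * (l + snd (fst y))))"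
      by (rule continuous_on_compose2[OF G]) (auto intro!: continuous_intros)
    from continuous_on_mult[OF 1 this] show ?thesis unfolding prod.case .
  qed
  then have "compact (?H ` (?box \<times> {0..1}))"
    by (rule compact_continuous_image) (intro compact_Times compact_cbox compact_Icc)
  from compact_imp_bounded[OF this] obtain C where "\<forall>v \<in> ?H ` (?box \<times> {0..1}). norm v \<le> C"
    unfolding bounded_iff by blast
  then have C: "norm (?H y) \<le> C" if "y \<in> ?box \<times> {0..1}" for y
    using that by blast
  have "(\<lambda>n. LINT z|lborel. ?h n z) \<longlonglongrightarrow> (LINT z|lborel. ?s z * G p q)"
  proof (rule integral_dominated_convergence[where w="\<lambda>z. indicator ?box z *\<^sub>R C"])
    show "integrable lborel (\<lambda>z. indicator ?box z *\<^sub>R C)"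
      by (rule borel_integrable_compact) auto
    show "(\<lambda>z. ?s z * G p q) \<in> borel_measurable lborel"
      using borel_measurable_continuous_onI[OF s_cont] by simp
    show "?h n \<in> borel_measurable lborel" for n
    proof -
      have "continuous_on UNIV (?h n)"
        unfolding divide_inverse mult_1_left
        by (intro continuous_on_mult[OF s_cont] G_cont continuous_on_add continuous_on_mult continuous_on_const
            continuous_on_fst continuous_on_snd continuous_on_id)
      from borel_measurable_continuous_onI[OF this] show ?thesis by simp
    qed
    have eps: "?\<epsilon> \<longlonglongrightarrow> 0"
      using LIMSEQ_inverse_real_of_nat by (simp add: inverse_eq_divide)
    show "AE z in lborel. (\<lambda>n. ?h n z) \<longlonglongrightarrow> ?s z * G p q"
    proof (rule AE_I2)
      fix z :: "real \<times> real"
      have "(\<lambda>n. (p + ?\<epsilon> n * (k + fst z), q + ?\<epsilon> n * (l + snd z))) \<longlonglongrightarrow> (p + 0 * (k + fst z), q + 0 * (l + snd z))"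
        by (intro tendsto_intros eps)
      then have "(\<lambda>n. (\<lambda>(x, y). G x y) (p + ?\<epsilon> n * (k + fst z), q + ?\<epsilon> n * (l + snd z)))
          \<longlonglongrightarrow> (\<lambda>(x, y). G x y) (p + 0 * (k + fst z), q + 0 * (l + snd z))"
        by (intro continuous_on_tendsto_compose[OF G]) auto
      then show "(\<lambda>n. ?h n z) \<longlonglongrightarrow> ?s z * G p q"
        by (intro tendsto_mult_left) simp
    qed
    show "AE z in lborel. norm (?h n z) \<le> indicator ?box z *\<^sub>R C" for n
    proof (rule AE_I2)
      fix z :: "real \<times> real"
      show "norm (?h n z) \<le> indicator ?box z *\<^sub>R C"
      proof (cases "z \<in> ?box")
        case True
        then have "norm (?H (z, ?\<epsilon> n)) \<le> C" by (intro C) auto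
        then show ?thesis using True by (simp only: fst_conv snd_conv indicator_simps scaleR_one)
      next
        case False
        then have "?s z = 0"
          using smooth_step_deriv_support[of "fst z"] smooth_step_deriv_support[of "snd z"]
          by (cases z) auto
        moreover have "indicator ?box z = (0 :: real)" using False by simp
        ultimately show ?thesis by (simp only: mult_zero_left norm_zero scale_zero_left order_refl)
      qed
    qed
  qed
  then show ?thesis unfolding rescale by (simp add: integral_smooth_step_deriv_product)
qed

definition plateau :: "real \<Rightarrow> real \<Rightarrow> real \<Rightarrow> real \<Rightarrow> real \<Rightarrow> real" where
  "plateau N k p q x = smooth_step (N * x + (- N * p - k)) + (-1) * smooth_step (N * x + (- N * q - k))"

lemma plateau_in_step_algebra: "plateau N k p q \<in> step_algebra"
  unfolding plateau_def[abs_def] by (intro step_algebra.intros smooth_step_in_step_algebra)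

lemma DERIV_plateau: "(plateau N k p q has_real_derivative bump N k p x - bump N k q x) (at x)"
proof -
  have "((\<lambda>x. smooth_step (N * x + (- N * p - k))) has_real_derivative smooth_step_deriv (N * x + (- N * p - k)) * N) (at x)" for p
    by (rule DERIV_chain2[OF DERIV_smooth_step]) (auto intro!: derivative_eq_intros)
  from DERIV_add[OF this[of p] DERIV_cmult[OF this[of q], of "-1"]] show ?thesis
    unfolding plateau_def[abs_def] bump_def by (simp add: mult.commute)
qed

lemma plateau_support:
  assumes "plateau N k p q x \<noteq> 0" "N > 0" "p \<le> q"
  shows "p + k / N \<le> x \<and> x \<le> q + (k + 1) / N"
proof (rule ccontr)
  assume "\<not> ?thesis"
  then consider "x < p + k / N" | "q + (k + 1) / N < x" by linarith
  then have "plateau N k p q x = 0"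
  proof cases
    case 1
    have "N * x \<le> N * (p + k / N)" using 1 assms(2) by (intro mult_left_mono) auto
    moreover have "N * (p + k / N) = N * p + k" using assms(2) by (simp add: distrib_left[of N])
    moreover have "N * p \<le> N * q" using assms(2,3) by (intro mult_left_mono) auto
    ultimately have "N * x + (- N * p - k) \<le> 0 \<and> N * x + (- N * q - k) \<le> 0"
      unfolding mult_minus_left by linarith
    then show ?thesis by (simp only: plateau_def smooth_step_eq_0)
  next
    case 2
    have "N * (q + (k + 1) / N) \<le> N * x" using 2 assms(2) by (intro mult_left_mono) auto
    moreover have "N * (q + (k + 1) / N) = N * q + (k + 1)" using assms(2) by (simp add: distrib_left[of N q])
    moreover have "N * p \<le> N * q" using assms(2,3) by (intro mult_left_mono) auto
    ultimately have "N * x + (- N * p - k) \<ge> 1 \<and> N * x + (- N * q - k) \<ge> 1"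
      unfolding mult_minus_left by linarith
    then show ?thesis by (simp only: plateau_def smooth_step_eq_1)
  qed
  with assms show False by simp
qed

lemma plateau_deriv_support:
  assumes "bump N k p x - bump N k q x \<noteq> 0" "N > 0" "p \<le> q"
  shows "p + k / N \<le> x \<and> x \<le> q + (k + 1) / N"
  using bump_support[of N k p x] bump_support[of N k q x] assms by force

lemma abs_plateau_le: "\<bar>plateau N k p q x\<bar> \<le> 1"
  using smooth_step_bounds[of "N * x + (- N * p - k)"] smooth_step_bounds[of "N * x + (- N * q - k)"]
  unfolding plateau_def by (simp add: abs_le_iff)

text \<open>
  Since a step starts to the right of its base point and its width shrinks, the limit exists at every
  point, the end points included.
\<close>

lemma plateau_tendsto:
  assumes "0 \<le> k" "p \<le> q"
  shows "(\<lambda>n. plateau (real (Suc n)) k p q x) \<longlonglongrightarrow> indicator {p<..q} x"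
proof -
  have step: "(\<lambda>n. smooth_step (real (Suc n) * x + (- real (Suc n) * p - k))) \<longlonglongrightarrow> indicator {p<..} x" for p
  proof (cases "p < x")
    case True
    obtain n0 :: nat where n0: "(k + 1) / (x - p) \<le> real n0"
      using real_arch_simple by blast
    have "smooth_step (real (Suc n) * x + (- real (Suc n) * p - k)) = 1" if "n \<ge> n0" for n
    proof (rule smooth_step_eq_1)
      have "(k + 1) / (x - p) \<le> real (Suc n)" using n0 that by linarith
      then have "(k + 1) / (x - p) * (x - p) \<le> real (Suc n) * (x - p)"
        using True by (intro mult_right_mono) auto
      moreover have "(k + 1) / (x - p) * (x - p) = k + 1" using True by simp
      ultimately have "k + 1 \<le> real (Suc n) * x - real (Suc n) * p" by (simp only: right_diff_distrib)
      then show "1 \<le> real (Suc n) * x + (- real (Suc n) * p - k)" unfolding mult_minus_left by linarith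
    qed
    then have "\<forall>\<^sub>F n in sequentially. smooth_step (real (Suc n) * x + (- real (Suc n) * p - k)) = 1"
      unfolding eventually_sequentially by blast
    then show ?thesis using True by (simp add: tendsto_eventually del: of_nat_Suc)
  next
    case False
    have "real (Suc n) * x \<le> real (Suc n) * p" for n
      using False by (intro mult_left_mono) auto
    then have "real (Suc n) * x + (- real (Suc n) * p - k) \<le> 0" for n
    proof -
      have "X + (- Y - k) \<le> 0" if "X \<le> Y" for X Y using that assms(1) by simp
      then show ?thesis using \<open>real (Suc n) * x \<le> real (Suc n) * p\<close> unfolding mult_minus_left by blast
    qed
    then have "smooth_step (real (Suc n) * x + (- real (Suc n) * p - k)) = 0" for n
      by (rule smooth_step_eq_0)
    then show ?thesis using False by (simp only: greaterThan_iff indicator_simps not_False_eq_True tendsto_const)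
  qed
  have "(\<lambda>n. plateau (real (Suc n)) k p q x) \<longlonglongrightarrow> indicator {p<..} x + (-1) * indicator {q<..} x"
    unfolding plateau_def by (intro tendsto_add tendsto_mult_left step)
  moreover have "indicator {p<..} x + (-1) * indicator {q<..} x = (indicator {p<..q} x :: real)"
    using assms(2) by (auto simp: indicator_def)
  ultimately show ?thesis by simp
qed

text \<open>
  This is the integrated form of \<open>4 \<partial>\<^sub>\<xi> \<partial>\<^sub>\<eta> w = F\<close>. It follows from the weak equation tested with the
  wave packets of two plateaus: the derivatives of the plateaus concentrate at the corners of the
  rectangle, and the plateaus themselves tend to its indicator function. Rectangles that touch the
  diagonal or the line \<open>\<eta> = 0\<close> are included, which saves a separate limit.
\<close>

lemma light_cone_rectangle_identity:
  fixes u h :: "spacetime \<Rightarrow> real"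
  assumes u: "continuous_on UNIV u" and h: "continuous_on UNIV h"
    and weak: "\<And>\<phi>. \<phi> \<in> test_functions open_cone \<Longrightarrow>
      (LINT z|lborel. u z * dalembertian \<phi> z) = (LINT z|lborel. h z * \<phi> z)"
    and "0 \<le> \<eta>1" "\<eta>1 \<le> \<eta>2" "\<eta>2 \<le> \<xi>1" "\<xi>1 \<le> \<xi>2"
  shows "4 * (light_cone_mean u \<xi>2 \<eta>2 - light_cone_mean u \<xi>1 \<eta>2 - light_cone_mean u \<xi>2 \<eta>1 + light_cone_mean u \<xi>1 \<eta>1)
    = integral {\<xi>1..\<xi>2} (\<lambda>x. integral {\<eta>1..\<eta>2} (light_cone_mean h x))"
proof -
  note U = continuous_light_cone_mean[OF u] and H = continuous_light_cone_mean[OF h]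
  \<comment> \<open>The offsets 3 and 1 put the support of \<open>B n\<close>, which ends at \<open>\<eta>2 + 2 / N\<close>, strictly below that of
    \<open>A n\<close>, which starts at \<open>\<xi>1 + 3 / N\<close>, and strictly above zero.\<close>
  define A where "A n = plateau (real (Suc n)) 3 \<xi>1 \<xi>2" for n
  define B where "B n = plateau (real (Suc n)) 1 \<eta>1 \<eta>2" for n
  define J where "J n p q = (LINT z|lborel. bump (real (Suc n)) 3 p (fst z) * bump (real (Suc n)) 1 q (snd z)
      * light_cone_mean u (fst z) (snd z))" for n p q
  define I where "I n = (LINT z|lborel. A n (fst z) * B n (snd z) * light_cone_mean h (fst z) (snd z))" for n
  have A_alg: "A n \<in> step_algebra" and B_alg: "B n \<in> step_algebra" for n
    by (simp_all add: A_def B_def plateau_in_step_algebra)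
  have identity: "4 * (J n \<xi>2 \<eta>2 - J n \<xi>1 \<eta>2 - J n \<xi>2 \<eta>1 + J n \<xi>1 \<eta>1) = I n" for n
  proof -
    define N where "N = real (Suc n)"
    have N: "N > 0" by (simp add: N_def)
    define A' where "A' x = bump N 3 \<xi>1 x + (-1) * bump N 3 \<xi>2 x" for x
    define B' where "B' x = bump N 1 \<eta>1 x + (-1) * bump N 1 \<eta>2 x" for x
    have A'_alg: "A' \<in> step_algebra" and B'_alg: "B' \<in> step_algebra"
      unfolding A'_def[abs_def] B'_def[abs_def] by (intro step_algebra.intros bump_in_step_algebra)+
    have A': "(A n has_real_derivative A' x) (at x)" and B': "(B n has_real_derivative B' x) (at x)" for x
      using DERIV_plateau[of N 3 \<xi>1 \<xi>2 x] DERIV_plateau[of N 1 \<eta>1 \<eta>2 x]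
      by (simp_all add: A_def B_def A'_def B'_def N_def)
    have A_supp: "\<xi>1 + 3 / N \<le> x \<and> x \<le> \<xi>2 + (3 + 1) / N" if "A n x \<noteq> 0" for x
      using plateau_support[of N 3 \<xi>1 \<xi>2 x] that N assms by (simp add: A_def N_def)
    have B_supp: "\<eta>1 + 1 / N \<le> x \<and> x \<le> \<eta>2 + (1 + 1) / N" if "B n x \<noteq> 0" for x
      using plateau_support[of N 1 \<eta>1 \<eta>2 x] that N assms by (simp add: B_def N_def)
    have A'_supp: "\<xi>1 + 3 / N \<le> x \<and> x \<le> \<xi>2 + (3 + 1) / N" if "A' x \<noteq> 0" for x
      using plateau_deriv_support[of N 3 \<xi>1 x \<xi>2] that N assms by (simp add: A'_def)
    have B'_supp: "\<eta>1 + 1 / N \<le> x \<and> x \<le> \<eta>2 + (1 + 1) / N" if "B' x \<noteq> 0" for x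
      using plateau_deriv_support[of N 1 \<eta>1 x \<eta>2] that N assms by (simp add: B'_def)
    have b: "0 < \<eta>1 + 1 / N" using N assms by (simp add: add_nonneg_pos)
    have "(1 + 1) / N < 3 / N" using N by (intro divide_strict_right_mono) auto
    then have ba: "\<eta>2 + (1 + 1) / N < \<xi>1 + 3 / N" using assms by linarith
    have test: "(radial_wave (A n) (B n) :: spacetime \<Rightarrow> real) \<in> test_functions open_cone"
      by (rule radial_wave_test_function(1)[OF A_alg B_alg A_supp B_supp b ba])
    have box: "dalembertian (radial_wave (A n) (B n)) z = 4 * radial_wave A' B' z" for z
      by (rule radial_wave_test_function(2)[OF A_alg B_alg A_supp B_supp b ba A' A'_alg B' B'_alg])
    define V where "V = 3 / 2 * unit_ball_vol 3"
    have V: "V > 0" by (simp add: V_def)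
    have "4 * (V * (LINT p|lborel. A' (fst p) * B' (snd p) * light_cone_mean u (fst p) (snd p)))
      = 4 * (LINT z|lborel. u z * radial_wave A' B' z)"
      unfolding V_def
      by (subst integral_radial_wave[OF u step_algebra_continuous[OF A'_alg] step_algebra_continuous[OF B'_alg] A'_supp B'_supp ba]) auto
    also have "\<dots> = (LINT z|lborel. 4 * (u z * radial_wave A' B' z))"
      by simp
    also have "\<dots> = (LINT z|lborel. u z * dalembertian (radial_wave (A n) (B n)) z)"
      unfolding box by (simp only: mult.left_commute)
    also have "\<dots> = (LINT z|lborel. h z * radial_wave (A n) (B n) z)"
      by (rule weak[OF test])
    also have "\<dots> = V * I n"
      unfolding V_def I_def
      by (rule integral_radial_wave[OF h step_algebra_continuous[OF A_alg] step_algebra_continuous[OF B_alg] A_supp B_supp ba])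
    finally have "4 * (LINT p|lborel. A' (fst p) * B' (snd p) * light_cone_mean u (fst p) (snd p)) = I n"
      using V by simp
    moreover have "(LINT p|lborel. A' (fst p) * B' (snd p) * light_cone_mean u (fst p) (snd p))
       = J n \<xi>2 \<eta>2 - J n \<xi>1 \<eta>2 - J n \<xi>2 \<eta>1 + J n \<xi>1 \<eta>1"
    proof -
      let ?j = "\<lambda>p q z. bump N 3 p (fst z) * bump N 1 q (snd z) * light_cone_mean u (fst z) (snd z)"
      have int: "integrable lborel (?j p q)" for p q
        by (rule integrable_bump_product[OF U N])
      have "(LINT z|lborel. A' (fst z) * B' (snd z) * light_cone_mean u (fst z) (snd z))
         = (LINT z|lborel. ?j \<xi>2 \<eta>2 z - ?j \<xi>1 \<eta>2 z - ?j \<xi>2 \<eta>1 z + ?j \<xi>1 \<eta>1 z)"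
        by (rule Bochner_Integration.integral_cong[OF refl]) (simp add: A'_def B'_def algebra_simps)
      also have "\<dots> = J n \<xi>2 \<eta>2 - J n \<xi>1 \<eta>2 - J n \<xi>2 \<eta>1 + J n \<xi>1 \<eta>1"
        unfolding J_def N_def[symmetric]
        by (simp only: Bochner_Integration.integral_add Bochner_Integration.integral_diff int
            Bochner_Integration.integrable_diff Bochner_Integration.integrable_add)
      finally show ?thesis .
    qed
    ultimately show ?thesis by simp
  qed
  have "(\<lambda>n. 4 * (J n \<xi>2 \<eta>2 - J n \<xi>1 \<eta>2 - J n \<xi>2 \<eta>1 + J n \<xi>1 \<eta>1)) \<longlonglongrightarrow>
     4 * (light_cone_mean u \<xi>2 \<eta>2 - light_cone_mean u \<xi>1 \<eta>2 - light_cone_mean u \<xi>2 \<eta>1 + light_cone_mean u \<xi>1 \<eta>1)"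
    unfolding J_def by (intro tendsto_intros bump_concentration U)
  then have lim1: "I \<longlonglongrightarrow>
     4 * (light_cone_mean u \<xi>2 \<eta>2 - light_cone_mean u \<xi>1 \<eta>2 - light_cone_mean u \<xi>2 \<eta>1 + light_cone_mean u \<xi>1 \<eta>1)"
    unfolding identity .
  let ?h = "\<lambda>z. light_cone_mean h (fst z) (snd z)"
  let ?R = "{\<xi>1<..\<xi>2} \<times> {\<eta>1<..\<eta>2}"
  let ?box = "cbox (\<xi>1, \<eta>1) (\<xi>2 + 4, \<eta>2 + 2)"
  have H': "continuous_on S ?h" for S
    using continuous_on_subset[OF H] by (simp add: split_beta)
  have "compact (?h ` ?box)"
    by (rule compact_continuous_image[OF H']) simp
  from compact_imp_bounded[OF this] obtain C where "\<forall>v \<in> ?h ` ?box. norm v \<le> C"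
    unfolding bounded_iff by blast
  then have C: "\<bar>?h z\<bar> \<le> C" if "z \<in> ?box" for z
    using that by auto
  have lim2: "I \<longlonglongrightarrow> (LINT z|lborel. indicator ?R z * ?h z)"
    unfolding I_def
  proof (rule integral_dominated_convergence[where w="\<lambda>z. indicator ?box z *\<^sub>R C"])
    show "integrable lborel (\<lambda>z. indicator ?box z *\<^sub>R C)"
      by (rule borel_integrable_compact) auto
    have "?R \<in> sets borel" by (intro borel_Times) auto
    then show "(\<lambda>z. indicator ?R z * ?h z) \<in> borel_measurable lborel"
      using borel_measurable_continuous_onI[OF H'] by simp
    show "(\<lambda>z. A n (fst z) * B n (snd z) * ?h z) \<in> borel_measurable lborel" for n
    proof -
      have "continuous_on UNIV (\<lambda>z. A n (fst z) * B n (snd z) * ?h z)"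
        by (intro continuous_on_mult H' continuous_on_compose2[OF step_algebra_continuous[OF A_alg, of UNIV]]
            continuous_on_compose2[OF step_algebra_continuous[OF B_alg, of UNIV]] continuous_on_fst continuous_on_snd
            continuous_on_id) auto
      from borel_measurable_continuous_onI[OF this] show ?thesis by simp
    qed
    show "AE z in lborel. (\<lambda>n. A n (fst z) * B n (snd z) * ?h z) \<longlonglongrightarrow> indicator ?R z * ?h z"
    proof (rule AE_I2)
      fix z :: "real \<times> real"
      have "(\<lambda>n. A n (fst z) * B n (snd z) * ?h z) \<longlonglongrightarrow> indicator {\<xi>1<..\<xi>2} (fst z) * indicator {\<eta>1<..\<eta>2} (snd z) * ?h z"
        unfolding A_def B_def using assms by (intro tendsto_mult plateau_tendsto tendsto_const) auto
      moreover have "indicator {\<xi>1<..\<xi>2} (fst z) * indicator {\<eta>1<..\<eta>2} (snd z) = (indicator ?R z :: real)"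
        by (cases z) (simp add: indicator_times)
      ultimately show "(\<lambda>n. A n (fst z) * B n (snd z) * ?h z) \<longlonglongrightarrow> indicator ?R z * ?h z" by simp
    qed
    show "AE z in lborel. norm (A n (fst z) * B n (snd z) * ?h z) \<le> indicator ?box z *\<^sub>R C" for n
    proof (rule AE_I2)
      fix z :: "real \<times> real"
      define N where "N = real (Suc n)"
      have N: "N \<ge> 1" by (simp add: N_def)
      show "norm (A n (fst z) * B n (snd z) * ?h z) \<le> indicator ?box z *\<^sub>R C"
      proof (cases "z \<in> ?box")
        case True
        have "\<bar>A n (fst z)\<bar> * \<bar>B n (snd z)\<bar> * \<bar>?h z\<bar> \<le> 1 * 1 * C"
          using C[OF True] unfolding A_def B_def by (intro mult_mono abs_plateau_le) auto
        then show ?thesis using True by (simp add: abs_mult)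
      next
        case False
        have bounds: "3 / N \<ge> 0" "1 / N \<ge> 0" "(3 + 1) / N \<le> 4" "(1 + 1) / N \<le> 2"
          using N by (simp_all add: divide_le_eq)
        have "A n (fst z) = 0 \<or> B n (snd z) = 0"
        proof (rule ccontr)
          assume "\<not> ?thesis"
          then have nz: "plateau N 3 \<xi>1 \<xi>2 (fst z) \<noteq> 0" "plateau N 1 \<eta>1 \<eta>2 (snd z) \<noteq> 0"
            by (auto simp: A_def B_def N_def)
          have "N > 0" using N by simp
          note supp = plateau_support[OF nz(1) this \<open>\<xi>1 \<le> \<xi>2\<close>] plateau_support[OF nz(2) this \<open>\<eta>1 \<le> \<eta>2\<close>]
          have "\<xi>1 \<le> fst z \<and> fst z \<le> \<xi>2 + 4 \<and> \<eta>1 \<le> snd z \<and> snd z \<le> \<eta>2 + 2"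
            using supp bounds by linarith
          then have "z \<in> ?box" by (cases z) simp
          then show False using False by simp
        qed
        then show ?thesis using False by auto
      qed
    qed
  qed
  have "(LINT z|lborel. indicator ?R z * ?h z) = (LINT z : ?R | lborel. ?h z)"
    by (simp add: set_lebesgue_integral_def)
  also have "\<dots> = integral ?R ?h"
  proof (rule set_borel_integral_eq_integral)
    have "set_integrable lborel (cbox (\<xi>1, \<eta>1) (\<xi>2, \<eta>2)) ?h"
      unfolding set_integrable_def by (rule borel_integrable_compact[OF _ H']) simp
    then show "set_integrable lborel ?R ?h"
      by (rule set_integrable_subset) (auto intro: borel_Times)
  qed
  also have "\<dots> = integral (cbox (\<xi>1, \<eta>1) (\<xi>2, \<eta>2)) ?h"
  proof (rule integral_spike_set)
    show "negligible {x \<in> ?R - cbox (\<xi>1, \<eta>1) (\<xi>2, \<eta>2). ?h x \<noteq> 0}"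
      by (rule negligible_subset[OF negligible_empty]) auto
    show "negligible {x \<in> cbox (\<xi>1, \<eta>1) (\<xi>2, \<eta>2) - ?R. ?h x \<noteq> 0}"
    proof (rule negligible_subset[OF negligible_frontier_interval[of "(\<xi>1, \<eta>1)" "(\<xi>2, \<eta>2)"]])
      have "box (\<xi>1, \<eta>1) (\<xi>2, \<eta>2) \<subseteq> ?R"
      proof
        fix z assume "z \<in> box (\<xi>1, \<eta>1) (\<xi>2, \<eta>2)"
        then have *: "\<forall>b\<in>Basis. (\<xi>1, \<eta>1) \<bullet> b < z \<bullet> b \<and> z \<bullet> b < (\<xi>2, \<eta>2) \<bullet> b"
          unfolding mem_box .
        have "(1, 0) \<in> (Basis :: (real \<times> real) set)" "(0, 1) \<in> (Basis :: (real \<times> real) set)"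
          by (simp_all add: Basis_prod_def)
        from bspec[OF * this(1)] bspec[OF * this(2)] show "z \<in> ?R"
          by (cases z) simp
      qed
      then show "{x \<in> cbox (\<xi>1, \<eta>1) (\<xi>2, \<eta>2) - ?R. ?h x \<noteq> 0}
          \<subseteq> cbox (\<xi>1, \<eta>1) (\<xi>2, \<eta>2) - box (\<xi>1, \<eta>1) (\<xi>2, \<eta>2)" by blast
    qed
  qed
  also have "\<dots> = integral {\<xi>1..\<xi>2} (\<lambda>x. integral {\<eta>1..\<eta>2} (light_cone_mean h x))"
    by (subst integral_prod_continuous[OF H']) simp
  finally show ?thesis using LIMSEQ_unique[OF lim1 lim2] by simp
qed

section \<open>Uniqueness for the one-dimensional characteristic problem\<close>

text \<open>
  The interval of integration becomes independent of the end points, so that continuity in the end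
  points is a matter of continuous dependence on parameters.
\<close>

lemma integral_unit_interval:
  fixes f :: "real \<Rightarrow> real"
  assumes "a \<le> b" "continuous_on {a..b} f"
  shows "integral {a..b} f = (b - a) * integral {0..1} (\<lambda>s. f (a + s * (b - a)))"
proof -
  have "((\<lambda>s. (b - a) *\<^sub>R f (a + s * (b - a))) has_integral
      (integral {a + 0 * (b - a)..a + 1 * (b - a)} f)) {0..1}"
  proof (rule has_integral_substitution[where c=a and d=b])
    show "(\<lambda>s. a + s * (b - a)) ` {0..1} \<subseteq> {a..b}"
    proof clarify
      fix s :: real assume s: "s \<in> {0..1}"
      then have "0 \<le> s * (b - a)" "s * (b - a) \<le> 1 * (b - a)"
        using assms(1) mult_right_mono[of s 1 "b - a"] by auto
      then show "a + s * (b - a) \<in> {a..b}" by auto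
    qed
  qed (use assms in \<open>auto intro!: derivative_eq_intros\<close>)
  from integral_unique[OF this] show ?thesis by simp
qed

context
  fixes F :: "real \<Rightarrow> real \<Rightarrow> real"
  assumes F: "continuous_on UNIV (\<lambda>(x, y). F x y)"
begin

lemma continuous_on_slice: "continuous_on S (F x)"
proof -
  have "continuous_on S (\<lambda>y. (\<lambda>(x, y). F x y) (x, y))"
    by (rule continuous_on_compose2[OF F]) (auto intro!: continuous_intros)
  then show ?thesis by simp
qed

lemma continuous_on_slice_integral: "continuous_on {\<eta>..\<xi>} (\<lambda>x. integral {\<eta>..x} (F x))"
proof -
  have "continuous_on {\<eta>..\<xi>} (\<lambda>x. (x - \<eta>) * integral (cbox 0 1) (\<lambda>s. F x (\<eta> + s * (x - \<eta>))))"
  proof (intro continuous_intros integral_continuous_on_param)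
    have "continuous_on ({\<eta>..\<xi>} \<times> cbox 0 1) (\<lambda>p. (\<lambda>(x, y). F x y) (fst p, \<eta> + snd p * (fst p - \<eta>)))"
      by (rule continuous_on_compose2[OF F]) (auto intro!: continuous_intros)
    then show "continuous_on ({\<eta>..\<xi>} \<times> cbox 0 1) (\<lambda>(x, s). F x (\<eta> + s * (x - \<eta>)))"
      by (simp add: split_beta)
  qed
  then show ?thesis
    by (rule continuous_on_eq) (simp add: integral_unit_interval[OF _ continuous_on_slice])
qed

text \<open>
  The integral of \<open>F\<close> over the triangle \<open>\<eta> \<le> y \<le> x \<le> \<xi>\<close>, whose hypotenuse lies on the axis
  \<open>r = 0\<close>.
\<close>

definition wedge_integral :: "real \<Rightarrow> real \<Rightarrow> real" where
  "wedge_integral \<eta> \<xi> = integral {\<eta>..\<xi>} (\<lambda>x. integral {\<eta>..x} (F x))"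

lemma wedge_integral_rectangle:
  assumes "\<eta>1 \<le> \<eta>2" "\<eta>2 \<le> \<xi>1" "\<xi>1 \<le> \<xi>2"
  shows "wedge_integral \<eta>1 \<xi>2 - wedge_integral \<eta>1 \<xi>1 - wedge_integral \<eta>2 \<xi>2 + wedge_integral \<eta>2 \<xi>1
     = integral {\<xi>1..\<xi>2} (\<lambda>x. integral {\<eta>1..\<eta>2} (F x))"
proof -
  have strip: "wedge_integral \<eta> \<xi>2 - wedge_integral \<eta> \<xi>1 = integral {\<xi>1..\<xi>2} (\<lambda>x. integral {\<eta>..x} (F x))"
    if "\<eta> \<le> \<xi>1" for \<eta>
    using Henstock_Kurzweil_Integration.integral_combine[of \<eta> \<xi>1 \<xi>2 "\<lambda>x. integral {\<eta>..x} (F x)"] that assms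
    by (simp add: wedge_integral_def integrable_continuous_real continuous_on_slice_integral)
  have int: "(\<lambda>x. integral {\<eta>..x} (F x)) integrable_on {\<xi>1..\<xi>2}" if "\<eta> \<le> \<xi>1" for \<eta>
    by (rule integrable_continuous_real, rule continuous_on_subset[OF continuous_on_slice_integral[of \<eta> \<xi>2]])
       (use that in auto)
  have "integral {\<xi>1..\<xi>2} (\<lambda>x. integral {\<eta>1..\<eta>2} (F x))
      = integral {\<xi>1..\<xi>2} (\<lambda>x. integral {\<eta>1..x} (F x) - integral {\<eta>2..x} (F x))"
  proof (rule integral_cong)
    fix x assume "x \<in> {\<xi>1..\<xi>2}"
    then show "integral {\<eta>1..\<eta>2} (F x) = integral {\<eta>1..x} (F x) - integral {\<eta>2..x} (F x)"
      using Henstock_Kurzweil_Integration.integral_combine[of \<eta>1 \<eta>2 x "F x"] assms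
      by (simp add: integrable_continuous_real continuous_on_slice)
  qed
  also have "\<dots> = integral {\<xi>1..\<xi>2} (\<lambda>x. integral {\<eta>1..x} (F x)) - integral {\<xi>1..\<xi>2} (\<lambda>x. integral {\<eta>2..x} (F x))"
    using assms by (intro integral_diff int) auto
  finally show ?thesis using strip[of \<eta>1] strip[of \<eta>2] assms by simp
qed

lemma wedge_integral_bound:
  assumes "\<eta> \<le> \<xi>" and "\<And>x. x \<in> {\<eta>..\<xi>} \<Longrightarrow> \<bar>integral {\<eta>..x} (F x)\<bar> \<le> B"
  shows "\<bar>wedge_integral \<eta> \<xi>\<bar> \<le> B * (\<xi> - \<eta>)"
  using integral_bound[OF assms(1) continuous_on_slice_integral] assms(2)
  by (simp add: wedge_integral_def)

lemma wedge_integral_quadratic_bound: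
  assumes "\<eta> \<le> \<xi>" and B: "\<And>x y. x \<in> {\<eta>..\<xi>} \<Longrightarrow> y \<in> {\<eta>..\<xi>} \<Longrightarrow> \<bar>F x y\<bar> \<le> B"
  shows "\<bar>wedge_integral \<eta> \<xi>\<bar> \<le> B * (\<xi> - \<eta>) * (\<xi> - \<eta>)"
proof (rule wedge_integral_bound)
  fix x assume x: "x \<in> {\<eta>..\<xi>}"
  then have "0 \<le> B" using B[OF x x] by linarith
  have "\<bar>integral {\<eta>..x} (F x)\<bar> \<le> B * (x - \<eta>)"
    using integral_bound[OF _ continuous_on_slice, of \<eta> x x B] B x by auto
  also have "\<dots> \<le> B * (\<xi> - \<eta>)"
    using x \<open>0 \<le> B\<close> by (intro mult_left_mono) auto
  finally show "\<bar>integral {\<eta>..x} (F x)\<bar> \<le> B * (\<xi> - \<eta>)" .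
qed (use assms in simp)

text \<open>
  This is d'Alembert's formula for vanishing Cauchy data on the axis, for a function that satisfies
  the equation in integrated form only. The difference \<open>V\<close> of the two sides has a vanishing alternating sum on
  every rectangle and vanishes on the diagonal, so \<open>V(\<xi>, \<eta>) = a(\<xi>) - a(\<eta>)\<close>. By the
  hypothesis on small differences, which replaces the vanishing of the normal derivative, \<open>a\<close>
  has derivative zero and \<open>V\<close> vanishes.
\<close>

lemma wave_eq_wedge_integral:
  fixes w :: "real \<Rightarrow> real \<Rightarrow> real"
  assumes rect: "\<And>\<eta>1 \<eta>2 \<xi>1 \<xi>2. \<lbrakk>0 \<le> \<eta>1; \<eta>1 \<le> \<eta>2; \<eta>2 \<le> \<xi>1; \<xi>1 \<le> \<xi>2; \<xi>2 \<le> T\<rbrakk> \<Longrightarrow>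
      4 * (w \<xi>2 \<eta>2 - w \<xi>1 \<eta>2 - w \<xi>2 \<eta>1 + w \<xi>1 \<eta>1) = integral {\<xi>1..\<xi>2} (\<lambda>x. integral {\<eta>1..\<eta>2} (F x))"
    and diag: "\<And>\<xi>. \<lbrakk>0 \<le> \<xi>; \<xi> \<le> T\<rbrakk> \<Longrightarrow> w \<xi> \<xi> = 0"
    and small: "\<And>\<epsilon>. \<epsilon> > 0 \<Longrightarrow> \<exists>\<delta>>0. \<forall>\<xi> \<eta>. 0 \<le> \<eta> \<and> \<eta> \<le> \<xi> \<and> \<xi> \<le> T \<and> \<xi> - \<eta> < \<delta> \<longrightarrow>
      \<bar>w \<xi> \<eta>\<bar> \<le> \<epsilon> * (\<xi> - \<eta>)"
    and "0 \<le> \<eta>" "\<eta> \<le> \<xi>" "\<xi> \<le> T"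
  shows "4 * w \<xi> \<eta> = - wedge_integral \<eta> \<xi>"
proof -
  \<comment> \<open>The defect of the claimed formula; the proof shows that it is a difference of boundary values.\<close>
  define V where "V \<xi> \<eta> = 4 * w \<xi> \<eta> + wedge_integral \<eta> \<xi>" for \<xi> \<eta>
  define a where "a \<xi> = V \<xi> 0" for \<xi>
  have V_eq: "V \<xi> \<eta> = a \<xi> - a \<eta>" if "0 \<le> \<eta>" "\<eta> \<le> \<xi>" "\<xi> \<le> T" for \<xi> \<eta>
  proof -
    have "V \<eta> \<eta> = 0"
      using that diag[of \<eta>] by (simp add: V_def wedge_integral_def)
    moreover have "V \<xi> \<eta> - V \<eta> \<eta> - V \<xi> 0 + V \<eta> 0 = 0"
      using rect[of 0 \<eta> \<eta> \<xi>] wedge_integral_rectangle[of 0 \<eta> \<eta> \<xi>] that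
      by (simp add: V_def algebra_simps)
    ultimately show ?thesis by (simp add: a_def)
  qed
  have "compact ((\<lambda>(x, y). F x y) ` ({0..T} \<times> {0..T}))"
    by (intro compact_continuous_image continuous_on_subset[OF F] compact_Times) auto
  then obtain B where B': "\<And>z. z \<in> {0..T} \<times> {0..T} \<Longrightarrow> norm (case z of (x, y) \<Rightarrow> F x y) \<le> B"
    using compact_imp_bounded bounded_iff by (metis imageI)
  have B: "\<bar>F x y\<bar> \<le> \<bar>B\<bar>" if "x \<in> {0..T}" "y \<in> {0..T}" for x y
    using B'[of "(x, y)"] that by auto
  have a_small: "\<exists>\<delta>>0. \<forall>\<xi> \<eta>. 0 \<le> \<eta> \<and> \<eta> \<le> \<xi> \<and> \<xi> \<le> T \<and> \<xi> - \<eta> < \<delta> \<longrightarrow> \<bar>a \<xi> - a \<eta>\<bar> \<le> \<epsilon> * (\<xi> - \<eta>)"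
    if "\<epsilon> > 0" for \<epsilon>
  proof -
    have "\<epsilon> / 8 > 0" using that by simp
    from small[OF this] obtain \<delta> where \<delta>: "\<delta> > 0"
      "\<And>\<xi> \<eta>. 0 \<le> \<eta> \<and> \<eta> \<le> \<xi> \<and> \<xi> \<le> T \<and> \<xi> - \<eta> < \<delta> \<Longrightarrow> \<bar>w \<xi> \<eta>\<bar> \<le> \<epsilon> / 8 * (\<xi> - \<eta>)"
      by blast
    show ?thesis
    proof (intro exI[of _ "min \<delta> (\<epsilon> / (2 * (\<bar>B\<bar> + 1)))"] conjI allI impI)
      show "0 < min \<delta> (\<epsilon> / (2 * (\<bar>B\<bar> + 1)))"
        using \<delta>(1) that by (auto intro!: divide_pos_pos)
      fix \<xi> \<eta> assume *: "0 \<le> \<eta> \<and> \<eta> \<le> \<xi> \<and> \<xi> \<le> T \<and> \<xi> - \<eta> < min \<delta> (\<epsilon> / (2 * (\<bar>B\<bar> + 1)))"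
      then have "(\<bar>B\<bar> + 1) * (\<xi> - \<eta>) \<le> \<epsilon> / 2"
        by (simp add: field_simps)
      then have "\<bar>B\<bar> * (\<xi> - \<eta>) \<le> \<epsilon> / 2"
        using * by (simp add: algebra_simps)
      then have "\<bar>B\<bar> * (\<xi> - \<eta>) * (\<xi> - \<eta>) \<le> \<epsilon> / 2 * (\<xi> - \<eta>)"
        using * by (intro mult_right_mono) auto
      moreover have "\<bar>wedge_integral \<eta> \<xi>\<bar> \<le> \<bar>B\<bar> * (\<xi> - \<eta>) * (\<xi> - \<eta>)"
        using * by (intro wedge_integral_quadratic_bound B) auto
      moreover have "\<bar>w \<xi> \<eta>\<bar> \<le> \<epsilon> / 8 * (\<xi> - \<eta>)"
        using * by (intro \<delta>) auto
      moreover have "\<bar>V \<xi> \<eta>\<bar> \<le> 4 * \<bar>w \<xi> \<eta>\<bar> + \<bar>wedge_integral \<eta> \<xi>\<bar>"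
        unfolding V_def by linarith
      ultimately have "\<bar>V \<xi> \<eta>\<bar> \<le> \<epsilon> * (\<xi> - \<eta>)" by (simp add: algebra_simps)
      then show "\<bar>a \<xi> - a \<eta>\<bar> \<le> \<epsilon> * (\<xi> - \<eta>)"
        using V_eq[of \<eta> \<xi>] * by simp
    qed
  qed
  have "(a has_field_derivative 0) (at x within {0..T})" if x: "x \<in> {0..T}" for x
    unfolding has_field_derivative_iff
  proof (unfold tendsto_iff eventually_at dist_real_def, intro allI impI)
    fix e :: real assume "e > 0"
    then have "e / 2 > 0" by simp
    from a_small[OF this] obtain \<delta> where \<delta>: "\<delta> > 0" "\<And>\<xi> \<eta>. 0 \<le> \<eta> \<and> \<eta> \<le> \<xi> \<and> \<xi> \<le> T \<and> \<xi> - \<eta> < \<delta> \<Longrightarrow> \<bar>a \<xi> - a \<eta>\<bar> \<le> e / 2 * (\<xi> - \<eta>)"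
      by blast
    have "\<bar>(a y - a x) / (y - x) - 0\<bar> < e" if y: "y \<in> {0..T}" "y \<noteq> x" "\<bar>y - x\<bar> < \<delta>" for y
    proof -
      have "\<bar>a y - a x\<bar> \<le> e / 2 * \<bar>y - x\<bar>"
        using \<delta>(2)[of x y] \<delta>(2)[of y x] x y by (cases "x \<le> y") (auto simp: abs_minus_commute)
      also have "\<dots> < e * \<bar>y - x\<bar>" using y \<open>e > 0\<close> by (simp add: mult_less_cancel_right)
      finally show ?thesis using y by (simp add: abs_divide divide_less_eq)
    qed
    then show "\<exists>d>0. \<forall>y\<in>{0..T}. y \<noteq> x \<and> \<bar>y - x\<bar> < d \<longrightarrow> \<bar>(a y - a x) / (y - x) - 0\<bar> < e"
      using \<delta>(1) by blast
  qed
  then obtain c where "\<And>x. x \<in> {0..T} \<Longrightarrow> a x = c"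
    using has_field_derivative_zero_constant[of "{0..T}" a] by auto
  then have "V \<xi> \<eta> = 0" using V_eq[of \<eta> \<xi>] assms by simp
  then show ?thesis by (simp add: V_def)
qed

end

text \<open>
  Integrating an exponential weight gains the factor \<open>1 / \<mu>\<close>; a large \<open>\<mu>\<close> then makes a Volterra
  operator a contraction.
\<close>

lemma integral_exp_decay_bound:
  fixes f :: "real \<Rightarrow> real"
  assumes "a \<le> x" "continuous_on {a..x} f" "0 < \<mu>" "0 \<le> M"
    and "\<And>y. y \<in> {a..x} \<Longrightarrow> \<bar>f y\<bar> \<le> M * exp (\<mu> * (x - y))"
  shows "\<bar>integral {a..x} f\<bar> \<le> M * exp (\<mu> * (x - a)) / \<mu>"
proof -
  have "((\<lambda>y. M * exp (\<mu> * (x - y))) has_integral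
      (- M * exp (\<mu> * (x - x)) / \<mu>) - (- M * exp (\<mu> * (x - a)) / \<mu>)) {a..x}"
    using assms(1,3)
    by (intro fundamental_theorem_of_calculus)
       (auto intro!: derivative_eq_intros simp: has_real_derivative_iff_has_vector_derivative[symmetric])
  then have I: "(\<lambda>y. M * exp (\<mu> * (x - y))) integrable_on {a..x}"
    "integral {a..x} (\<lambda>y. M * exp (\<mu> * (x - y))) = M * exp (\<mu> * (x - a)) / \<mu> - M / \<mu>"
    by (auto simp: has_integral_integrable dest: integral_unique)
  have "norm (integral {a..x} f) \<le> integral {a..x} (\<lambda>y. M * exp (\<mu> * (x - y)))"
    using assms by (intro integral_norm_bound_integral integrable_continuous_real I(1)) auto
  also have "\<dots> \<le> M * exp (\<mu> * (x - a)) / \<mu>"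
    unfolding I(2) using assms by simp
  finally show ?thesis by simp
qed

lemma exp_weight_le:
  fixes x :: real
  assumes "exp (- a) * x \<le> M"
  shows "x \<le> M * exp a"
proof -
  have "x = exp a * (exp (- a) * x)" by (simp add: exp_minus)
  also have "\<dots> \<le> exp a * M" using assms by (intro mult_left_mono) auto
  finally show ?thesis by (simp add: mult.commute)
qed

text \<open>
  Both \<open>w\<close> and \<open>b\<close> are given by integrals of \<open>F\<close>: the former by the triangle formula, the latter by
  comparing that formula with the data on \<open>\<eta> = 0\<close> and differentiating. Measured in the weight
  \<open>exp (- \<mu> (\<xi> - \<eta>))\<close>, each integration gains \<open>1 / \<mu>\<close>. For large \<open>\<mu>\<close> the sum \<open>M\<close> of the
  weighted maxima satisfies \<open>M \<le> M / 2\<close>, hence vanishes.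
\<close>

lemma characteristic_data_unique:
  fixes w F :: "'i::finite \<Rightarrow> real \<Rightarrow> real \<Rightarrow> real" and b :: "real \<Rightarrow> real"
  assumes "T > 0" and "\<kappa> > 0" and "C \<ge> 0"
    and w_cont: "\<And>i. continuous_on UNIV (\<lambda>(x, y). w i x y)"
    and F_cont: "\<And>i. continuous_on UNIV (\<lambda>(x, y). F i x y)"
    and b_cont: "continuous_on UNIV b"
    and repr: "\<And>i \<xi> \<eta>. \<lbrakk>0 \<le> \<eta>; \<eta> \<le> \<xi>; \<xi> \<le> T\<rbrakk> \<Longrightarrow> 4 * w i \<xi> \<eta> = - wedge_integral (F i) \<eta> \<xi>"
    and cone: "\<And>i \<xi>. \<lbrakk>0 \<le> \<xi>; \<xi> \<le> T\<rbrakk> \<Longrightarrow> w i \<xi> 0 = \<kappa> * integral {0..\<xi>} (\<lambda>s. b (s / 2))"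
    and F_bound: "\<And>i \<xi> \<eta>. \<lbrakk>0 \<le> \<eta>; \<eta> \<le> \<xi>; \<xi> \<le> T\<rbrakk> \<Longrightarrow>
      \<bar>F i \<xi> \<eta>\<bar> \<le> C * ((\<Sum>j\<in>UNIV. \<bar>w j \<xi> \<eta>\<bar>) + \<bar>b ((\<xi> - \<eta>) / 2)\<bar>)"
    and "0 \<le> \<rho>" "\<rho> \<le> T / 2"
  shows "b \<rho> = 0"
proof -
  define N where "N = real CARD('i)"
  \<comment> \<open>Multiplied by \<open>M / \<mu>\<close>, the two summands are the bounds for \<open>w\<close> and for \<open>b\<close>; the choice of
    \<open>\<mu>\<close> makes \<open>L / \<mu>\<close> at most \<open>1 / 2\<close>.\<close>
  define L where "L = C * (N * T / 4 + 1 / \<kappa>)"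
  define \<mu> where "\<mu> = 2 * L + 1"
  have N: "N \<ge> 0" by (simp add: N_def)
  have L: "L \<ge> 0" using assms N by (auto simp: L_def)
  then have \<mu>: "\<mu> > 0" by (simp add: \<mu>_def)
  let ?D = "{(\<xi>, \<eta>). 0 \<le> \<eta> \<and> \<eta> \<le> \<xi> \<and> \<xi> \<le> (T::real)}"
  let ?W = "\<lambda>(\<xi>, \<eta>). exp (- \<mu> * (\<xi> - \<eta>)) * (\<Sum>j\<in>UNIV. \<bar>w j \<xi> \<eta>\<bar>)"
  let ?b = "\<lambda>r. exp (- \<mu> * (2 * r)) * \<bar>b r\<bar>"
  have "closed ?D"
    unfolding split_beta by (intro closed_Collect_conj closed_Collect_le continuous_intros)
  moreover have "bounded ?D"
    by (rule bounded_subset[of "{0..T} \<times> {0..T}"]) (auto intro!: bounded_Times)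
  ultimately have D: "compact ?D" by (simp add: compact_eq_bounded_closed)
  have "continuous_on UNIV ?W"
    using w_cont unfolding split_beta by (intro continuous_intros) auto
  then obtain p where p: "p \<in> ?D" "\<And>q. q \<in> ?D \<Longrightarrow> ?W q \<le> ?W p"
    using continuous_attains_sup[OF D, of ?W] \<open>T > 0\<close> continuous_on_subset[OF _ subset_UNIV]
    by (metis (no_types, lifting) case_prodI empty_iff less_eq_real_def mem_Collect_eq)
  have "continuous_on {0..T/2} ?b"
    by (intro continuous_intros continuous_on_subset[OF b_cont]) auto
  then obtain r0 where r0: "r0 \<in> {0..T/2}" "\<And>r. r \<in> {0..T/2} \<Longrightarrow> ?b r \<le> ?b r0"
    using continuous_attains_sup[of "{0..T/2}" ?b] \<open>T > 0\<close> by auto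
  define M where "M = ?W p + ?b r0"
  have M: "0 \<le> M" by (auto simp: M_def split_beta intro!: add_nonneg_nonneg mult_nonneg_nonneg sum_nonneg)
  have F_exp: "\<bar>F i \<xi> \<eta>\<bar> \<le> C * M * exp (\<mu> * (\<xi> - \<eta>))" if "0 \<le> \<eta>" "\<eta> \<le> \<xi>" "\<xi> \<le> T" for i \<xi> \<eta>
  proof -
    have "exp (- \<mu> * (\<xi> - \<eta>)) * ((\<Sum>j\<in>UNIV. \<bar>w j \<xi> \<eta>\<bar>) + \<bar>b ((\<xi> - \<eta>) / 2)\<bar>) \<le> M"
    proof -
      have "?W (\<xi>, \<eta>) \<le> ?W p" using that by (intro p) auto
      moreover have "?b ((\<xi> - \<eta>) / 2) \<le> ?b r0" using that by (intro r0) auto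
      moreover have "2 * ((\<xi> - \<eta>) / 2) = \<xi> - \<eta>" by simp
      ultimately show ?thesis unfolding M_def distrib_left by (simp only: prod.case)
    qed
    then have "(\<Sum>j\<in>UNIV. \<bar>w j \<xi> \<eta>\<bar>) + \<bar>b ((\<xi> - \<eta>) / 2)\<bar> \<le> M * exp (\<mu> * (\<xi> - \<eta>))"
      by (intro exp_weight_le) (simp only: mult_minus_left)
    then have "C * ((\<Sum>j\<in>UNIV. \<bar>w j \<xi> \<eta>\<bar>) + \<bar>b ((\<xi> - \<eta>) / 2)\<bar>) \<le> C * (M * exp (\<mu> * (\<xi> - \<eta>)))"
      using \<open>C \<ge> 0\<close> by (rule mult_left_mono)
    with F_bound[OF that, of i] show ?thesis by (simp add: mult.assoc)
  qed
  have slice: "\<bar>integral {\<eta>..x} (F i x)\<bar> \<le> C * M * exp (\<mu> * (x - \<eta>)) / \<mu>"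
    if "0 \<le> \<eta>" "\<eta> \<le> x" "x \<le> T" for i \<eta> x
    using that \<mu> M \<open>C \<ge> 0\<close>
    by (intro integral_exp_decay_bound continuous_on_slice F_cont F_exp) auto
  have w_exp: "exp (- \<mu> * (\<xi> - \<eta>)) * \<bar>w i \<xi> \<eta>\<bar> \<le> C * T / 4 * M / \<mu>"
    if "0 \<le> \<eta>" "\<eta> \<le> \<xi>" "\<xi> \<le> T" for i \<xi> \<eta>
  proof -
    have "\<bar>wedge_integral (F i) \<eta> \<xi>\<bar> \<le> C * M * exp (\<mu> * (\<xi> - \<eta>)) / \<mu> * (\<xi> - \<eta>)"
    proof (rule wedge_integral_bound[OF F_cont])
      fix x assume x: "x \<in> {\<eta>..\<xi>}"
      have "\<bar>integral {\<eta>..x} (F i x)\<bar> \<le> C * M * exp (\<mu> * (x - \<eta>)) / \<mu>"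
        using x that by (intro slice) auto
      also have "\<dots> \<le> C * M * exp (\<mu> * (\<xi> - \<eta>)) / \<mu>"
        using x \<mu> M \<open>C \<ge> 0\<close> by (intro divide_right_mono mult_left_mono) auto
      finally show "\<bar>integral {\<eta>..x} (F i x)\<bar> \<le> C * M * exp (\<mu> * (\<xi> - \<eta>)) / \<mu>" .
    qed (use that in auto)
    also have "\<dots> \<le> C * M * exp (\<mu> * (\<xi> - \<eta>)) / \<mu> * T"
      using that \<mu> M \<open>C \<ge> 0\<close> by (intro mult_left_mono) auto
    finally have "4 * \<bar>w i \<xi> \<eta>\<bar> \<le> C * M * exp (\<mu> * (\<xi> - \<eta>)) / \<mu> * T"
      using repr[OF that, of i] by linarith
    then have "exp (- \<mu> * (\<xi> - \<eta>)) * (4 * \<bar>w i \<xi> \<eta>\<bar>) \<le> exp (- \<mu> * (\<xi> - \<eta>)) * (C * M * exp (\<mu> * (\<xi> - \<eta>)) / \<mu> * T)"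
      by (intro mult_left_mono) auto
    also have "\<dots> = (exp (- (\<mu> * (\<xi> - \<eta>))) * exp (\<mu> * (\<xi> - \<eta>))) * (C * T * M / \<mu>)"
      by (simp only: mult_minus_left times_divide_eq_right times_divide_eq_left mult_ac)
    also have "\<dots> = C * T * M / \<mu>"
      by (simp only: exp_minus_inverse[of "- (\<mu> * (\<xi> - \<eta>))", unfolded minus_minus] mult_1_left)
    finally have "4 * (exp (- \<mu> * (\<xi> - \<eta>)) * \<bar>w i \<xi> \<eta>\<bar>) \<le> C * T * M / \<mu>"
      by (simp only: mult.left_commute)
    moreover have "C * T / 4 * M / \<mu> = C * T * M / \<mu> / 4" by simp
    moreover have "X \<le> Z" if "4 * X \<le> Y" "Z = Y / 4" for X Y Z :: real
      using that by simp
    ultimately show ?thesis by blast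
  qed
  have W_bound: "?W p \<le> N * (C * T / 4 * M / \<mu>)"
  proof -
    obtain \<xi> \<eta> where pp: "p = (\<xi>, \<eta>)" by (cases p)
    have "?W p = (\<Sum>j\<in>UNIV. exp (- \<mu> * (\<xi> - \<eta>)) * \<bar>w j \<xi> \<eta>\<bar>)"
      by (simp add: pp sum_distrib_left)
    also have "\<dots> \<le> (\<Sum>j\<in>(UNIV::'i set). C * T / 4 * M / \<mu>)"
      using p(1) pp by (intro sum_mono w_exp) auto
    finally show ?thesis by (simp add: N_def)
  qed
  \<comment> \<open>Both sides are derivatives of \<open>\<xi> \<mapsto> 4 w(\<xi>, 0)\<close>.\<close>
  have b_eq: "4 * \<kappa> * b (\<xi> / 2) = - integral {0..\<xi>} (F i \<xi>)" if \<xi>: "0 \<le> \<xi>" "\<xi> \<le> T" for i \<xi>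
  proof -
    have "((\<lambda>x. 4 * (\<kappa> * integral {0..x} (\<lambda>s. b (s / 2)))) has_real_derivative 4 * (\<kappa> * b (\<xi> / 2)))
        (at \<xi> within {0..T})"
      using \<xi> by (intro DERIV_cmult integral_has_real_derivative continuous_on_compose2[OF b_cont] continuous_intros) auto
    then have 1: "((\<lambda>x. 4 * w i x 0) has_real_derivative 4 * (\<kappa> * b (\<xi> / 2))) (at \<xi> within {0..T})"
      by (rule has_field_derivative_transform_within[where d=1]) (use \<xi> cone in auto)
    have "((\<lambda>x. - integral {0..x} (\<lambda>y. integral {0..y} (F i y))) has_real_derivative - integral {0..\<xi>} (F i \<xi>))
        (at \<xi> within {0..T})"
      using \<xi> by (intro DERIV_minus integral_has_real_derivative continuous_on_slice_integral F_cont) auto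
    then have 2: "((\<lambda>x. 4 * w i x 0) has_real_derivative - integral {0..\<xi>} (F i \<xi>)) (at \<xi> within {0..T})"
      by (rule has_field_derivative_transform_within[where d=1])
         (use \<xi> repr[of 0] in \<open>auto simp: wedge_integral_def[OF F_cont]\<close>)
    have "4 * (\<kappa> * b (\<xi> / 2)) = - integral {0..\<xi>} (F i \<xi>)"
      by (rule vector_derivative_unique_within_closed_interval[of 0 T \<xi> "\<lambda>x. 4 * w i x 0"])
         (use 1 2 \<xi> \<open>T > 0\<close> in \<open>auto simp: has_real_derivative_iff_has_vector_derivative[symmetric]\<close>)
    then show ?thesis by simp
  qed
  have b_bound: "?b r0 \<le> C / \<kappa> * M / \<mu>"
  proof -
    define \<xi> where "\<xi> = 2 * r0"
    have \<xi>: "0 \<le> \<xi>" "\<xi> \<le> T" using r0(1) by (auto simp: \<xi>_def)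
    have "4 * \<kappa> * \<bar>b r0\<bar> = \<bar>4 * \<kappa> * b (\<xi> / 2)\<bar>"
      using \<open>\<kappa> > 0\<close> by (simp add: \<xi>_def abs_mult)
    also have "\<dots> \<le> C * M * exp (\<mu> * \<xi>) / \<mu>"
      using slice[of 0 \<xi> undefined] \<xi> unfolding b_eq[OF \<xi>, of undefined] by simp
    finally have "exp (- \<mu> * \<xi>) * (4 * \<kappa> * \<bar>b r0\<bar>) \<le> exp (- \<mu> * \<xi>) * (C * M * exp (\<mu> * \<xi>) / \<mu>)"
      by (intro mult_left_mono) auto
    also have "\<dots> = (exp (- (\<mu> * \<xi>)) * exp (\<mu> * \<xi>)) * (C * M / \<mu>)"
      by simp
    also have "\<dots> = C * M / \<mu>"
      by (simp only: exp_minus_inverse[of "- (\<mu> * \<xi>)", unfolded minus_minus] mult_1_left)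
    finally have "4 * \<kappa> * ?b r0 \<le> C * M / \<mu>" by (simp add: \<xi>_def mult_ac)
    moreover have "\<kappa> * ?b r0 \<le> 4 * \<kappa> * ?b r0" using \<open>\<kappa> > 0\<close> by simp
    ultimately have "\<kappa> * ?b r0 \<le> C * M / \<mu>" by linarith
    then have "?b r0 \<le> C * M / \<mu> / \<kappa>"
      using \<open>\<kappa> > 0\<close> by (simp only: pos_le_divide_eq mult.commute)
    then show ?thesis by (simp add: mult.commute)
  qed
  have "M \<le> N * (C * T / 4 * M / \<mu>) + C / \<kappa> * M / \<mu>"
    using W_bound b_bound by (simp only: M_def add_mono)
  also have "\<dots> = L / \<mu> * M"
    by (simp add: L_def distrib_left distrib_right add_divide_distrib)
  also have "\<dots> \<le> 1 / 2 * M"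
    using M L by (intro mult_right_mono) (auto simp: \<mu>_def field_simps)
  finally have "M \<le> 0" by simp
  moreover have "0 \<le> ?W p" by (auto simp: split_beta intro!: mult_nonneg_nonneg sum_nonneg)
  ultimately have "?b r0 \<le> 0" by (simp add: M_def)
  then have "?b \<rho> \<le> 0" using r0(2)[of \<rho>] assms by auto
  then show ?thesis by (simp add: mult_le_0_iff)
qed

section \<open>The weak equation for the regular part\<close>

lemma continuous_iterated_partial:
  assumes "smooth f" "bs \<in> lists Basis"
  shows "continuous_on S (iterated_partial bs f)"
  using assms unfolding smooth_def
  by (meson continuous_on_subset differentiable_imp_continuous_on subset_UNIV)

lemma smooth_imp_continuous:
  assumes "smooth f"
  shows "continuous_on S f"
  using continuous_iterated_partial[OF assms, of "[]"] by (simp add: iterated_partial_def)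

lemma iterated_partial_outside_tsupport:
  assumes "z \<notin> tsupport f" "bs \<in> lists Basis"
  shows "iterated_partial bs f z = 0"
proof -
  have "open (- tsupport f)" unfolding tsupport_def by (intro open_Compl closed_closure)
  moreover have "f y = 0" if "y \<in> - tsupport f" for y
    using that closure_subset[of "support_on UNIV f"] by (auto simp: tsupport_def support_on_def)
  ultimately show ?thesis
    using iterated_partial_in_differentially_closed[OF _ differentially_closed_zero, of "- tsupport f" "\<lambda>_. 0" f bs] assms
    by blast
qed

lemma continuous_dalembertian:
  assumes "smooth \<phi>"
  shows "continuous_on S (dalembertian \<phi>)"
  unfolding dalembertian_def[abs_def]
  by (intro continuous_intros continuous_iterated_partial[OF assms] spacetime_directions)

lemma dalembertian_outside_tsupport:
  assumes "z \<notin> tsupport \<phi>"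
  shows "dalembertian \<phi> z = 0"
  unfolding dalembertian_def
  by (simp only: iterated_partial_outside_tsupport[OF assms spacetime_directions(1)]
      iterated_partial_outside_tsupport[OF assms spacetime_directions(2)] sum.neutral_const diff_self cong: sum.cong)

text \<open>
  The values of the regular part outside the closed cone are arbitrary. Composition with the
  retraction \<open>(t, x) \<mapsto> (max t |x|, x)\<close> replaces them by a continuous extension, which spares all
  later integrals any case distinction at the boundary of the cone.
\<close>

definition cone_extension :: "(spacetime \<Rightarrow> real^2) \<Rightarrow> spacetime \<Rightarrow> real^2" where
  "cone_extension R z = R (max (fst z) (norm (snd z)), snd z)"

lemma cone_extension_eq: "norm x \<le> t \<Longrightarrow> cone_extension R (t, x) = R (t, x)"
  by (simp add: cone_extension_def max_absorb1)

lemma continuous_cone_extension: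
  assumes "continuous_on closed_cone R"
  shows "continuous_on S (cone_extension R)"
  unfolding cone_extension_def
  by (rule continuous_on_compose2[OF assms]) (auto intro!: continuous_intros simp: closed_cone_def)

lemma continuous_cone_extension_nth:
  assumes "continuous_on closed_cone R"
  shows "continuous_on S (\<lambda>z. cone_extension R z $ i)"
  by (intro continuous_intros continuous_cone_extension assms)

lemma C1_on_imp_continuous: "C1_on S f \<Longrightarrow> continuous_on S f"
  unfolding C1_on_def continuous_on_eq_continuous_within by (meson has_derivative_continuous)

lemma function_distribution_nth:
  assumes R: "continuous_on closed_cone R" and \<psi>: "continuous_on UNIV \<psi>"
    and K: "compact K" "K \<subseteq> open_cone" "\<And>z. z \<notin> K \<Longrightarrow> \<psi> z = 0"
  shows "function_distribution open_cone R \<psi> $ i = (LINT z|lborel. cone_extension R z $ i * \<psi> z)"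
    and "integrable lborel (\<lambda>z. cone_extension R z $ i * \<psi> z)"
proof -
  have cont: "continuous_on K (\<lambda>z. \<psi> z *\<^sub>R cone_extension R z)"
    by (intro continuous_intros continuous_cone_extension R continuous_on_subset[OF \<psi>]) simp
  have "(\<lambda>z. indicator K z *\<^sub>R (\<psi> z *\<^sub>R cone_extension R z)) = (\<lambda>z. \<psi> z *\<^sub>R cone_extension R z)"
    using K(3) by (auto simp: fun_eq_iff indicator_def)
  then have int: "integrable lborel (\<lambda>z. \<psi> z *\<^sub>R cone_extension R z)"
    using borel_integrable_compact[OF K(1) cont] by simp
  have "indicator open_cone z *\<^sub>R (\<psi> z *\<^sub>R R z) = \<psi> z *\<^sub>R cone_extension R z" for z
  proof (cases "z \<in> open_cone")
    case True
    then show ?thesis using cone_extension_eq[of "snd z" "fst z" R] by (auto simp: open_cone_def)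
  next
    case False
    then show ?thesis using K(2) K(3)[of z] by auto
  qed
  then have "function_distribution open_cone R \<psi> = (LINT z|lborel. \<psi> z *\<^sub>R cone_extension R z)"
    by (simp add: function_distribution_def set_lebesgue_integral_def)
  then show "function_distribution open_cone R \<psi> $ i = (LINT z|lborel. cone_extension R z $ i * \<psi> z)"
    using integral_bounded_linear[OF bounded_linear_vec_nth[of i] int] by (simp add: mult.commute)
  show "integrable lborel (\<lambda>z. cone_extension R z $ i * \<psi> z)"
    using integrable_bounded_linear[OF bounded_linear_vec_nth[of i] int] by (simp add: mult.commute)
qed

lemma regular_part_weak_equation:
  assumes R: "regular_part P U R" and P: "\<And>i j. smooth (\<lambda>x. P x $ i $ j)"
    and \<phi>: "\<phi> \<in> test_functions open_cone"
  shows "(LINT z|lborel. cone_extension R z $ i * dalembertian \<phi> z)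
      = (LINT z|lborel. (\<Sum>j\<in>UNIV. P (snd z) $ i $ j * cone_extension R z $ j) * \<phi> z)"
    and "integrable lborel (\<lambda>z. cone_extension R z $ i * dalembertian \<phi> z)"
    and "integrable lborel (\<lambda>z. (\<Sum>j\<in>UNIV. P (snd z) $ i $ j * cone_extension R z $ j) * \<phi> z)"
proof -
  have R_cont: "continuous_on closed_cone R"
    using R by (auto simp: regular_part_def intro: C1_on_imp_continuous)
  have smooth: "smooth \<phi>" and K: "compact (tsupport \<phi>)" "tsupport \<phi> \<subseteq> open_cone"
    using \<phi> by (auto simp: test_functions_def)
  have \<phi>_out: "\<phi> z = 0" if "z \<notin> tsupport \<phi>" for z
    using iterated_partial_outside_tsupport[OF that, of "[]"] by (simp add: iterated_partial_def)
  let ?\<psi> = "\<lambda>j (z::spacetime). P (snd z) $ i $ j * \<phi> z"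
  have \<psi>: "continuous_on UNIV (?\<psi> j)" for j
    by (intro continuous_intros smooth_imp_continuous[OF smooth]
        continuous_on_compose2[OF smooth_imp_continuous[OF P, of UNIV]]) auto
  have \<psi>_out: "?\<psi> j z = 0" if "z \<notin> tsupport \<phi>" for j z
    using \<phi>_out[OF that] by simp
  note box = function_distribution_nth[OF R_cont continuous_dalembertian[OF smooth] K dalembertian_outside_tsupport, where i=i]
  note mult = function_distribution_nth[OF R_cont \<psi> K \<psi>_out]
  have box_nth: "function_distribution open_cone R (dalembertian \<phi>) $ i = (LINT z|lborel. cone_extension R z $ i * dalembertian \<phi> z)"
    by (rule box(1))
  have nth: "function_distribution open_cone R (?\<psi> j) $ j = (LINT z|lborel. cone_extension R z $ j * ?\<psi> j z)" for j
    by (rule function_distribution_nth(1)[OF R_cont \<psi> K \<psi>_out])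
  show "integrable lborel (\<lambda>z. cone_extension R z $ i * dalembertian \<phi> z)"
    by (rule box(2))
  have eq: "(\<Sum>j\<in>UNIV. P (snd z) $ i $ j * cone_extension R z $ j) * \<phi> z
      = (\<Sum>j\<in>UNIV. cone_extension R z $ j * ?\<psi> j z)" for z
    unfolding sum_distrib_right by (intro sum.cong refl) (simp add: ac_simps)
  show "integrable lborel (\<lambda>z. (\<Sum>j\<in>UNIV. P (snd z) $ i $ j * cone_extension R z $ j) * \<phi> z)"
    unfolding eq by (intro Bochner_Integration.integrable_sum mult(2))
  have "wave_operator P (function_distribution open_cone R) \<phi> $ i = 0"
    using R \<phi> by (simp add: regular_part_def)
  then have "function_distribution open_cone R (dalembertian \<phi>) $ i
      = (\<Sum>j\<in>UNIV. function_distribution open_cone R (?\<psi> j) $ j)"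
    by (simp add: wave_operator_def case_prod_beta')
  also have "\<dots> = (LINT z|lborel. (\<Sum>j\<in>UNIV. P (snd z) $ i $ j * cone_extension R z $ j) * \<phi> z)"
    unfolding eq nth by (rule Bochner_Integration.integral_sum[symmetric]) (rule mult(2))
  finally show "(LINT z|lborel. cone_extension R z $ i * dalembertian \<phi> z)
      = (LINT z|lborel. (\<Sum>j\<in>UNIV. P (snd z) $ i $ j * cone_extension R z $ j) * \<phi> z)"
    by (simp only: box_nth)
qed

section \<open>Reduction of the radial problem\<close>

text \<open>
  At \<open>r = 0\<close> the spherical mean is the value on the axis, so by uniform continuity the mean is
  uniformly small for small \<open>r\<close>; the light cone mean has a further factor \<open>r\<close>.
\<close>

lemma light_cone_mean_small_near_axis:
  assumes u: "continuous_on UNIV u" and axis: "\<And>t. 0 \<le> t \<Longrightarrow> t \<le> T \<Longrightarrow> u (t, 0) = 0" and "\<epsilon> > 0"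
  shows "\<exists>\<delta>>0. \<forall>\<xi> \<eta>. 0 \<le> \<eta> \<and> \<eta> \<le> \<xi> \<and> \<xi> \<le> T \<and> \<xi> - \<eta> < \<delta> \<longrightarrow> \<bar>light_cone_mean u \<xi> \<eta>\<bar> \<le> \<epsilon> * (\<xi> - \<eta>)"
proof -
  let ?m = "\<lambda>(t, r). sphere_mean (\<lambda>x. u (t, x)) r"
  have "uniformly_continuous_on ({0..T} \<times> {0..T}) ?m"
    by (intro compact_uniformly_continuous continuous_on_subset[OF continuous_sphere_mean[OF u]] compact_Times) auto
  then obtain \<delta> where \<delta>: "\<delta> > 0"
    "\<And>p q. p \<in> {0..T} \<times> {0..T} \<Longrightarrow> q \<in> {0..T} \<times> {0..T} \<Longrightarrow> dist q p < \<delta> \<Longrightarrow> dist (?m q) (?m p) < \<epsilon>"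
    unfolding uniformly_continuous_on_def using \<open>\<epsilon> > 0\<close> by metis
  show ?thesis
  proof (intro exI[of _ \<delta>] conjI allI impI)
    fix \<xi> \<eta> assume *: "0 \<le> \<eta> \<and> \<eta> \<le> \<xi> \<and> \<xi> \<le> T \<and> \<xi> - \<eta> < \<delta>"
    define t where "t = (\<xi> + \<eta>) / 2"
    define r where "r = (\<xi> - \<eta>) / 2"
    have tr: "0 \<le> t" "t \<le> T" "0 \<le> r" "r \<le> T" "r < \<delta>" using * by (auto simp: t_def r_def)
    have "dist (?m (t, r)) (?m (t, 0)) < \<epsilon>"
      using tr by (intro \<delta>(2)) (auto simp: dist_Pair_Pair)
    moreover have "?m (t, 0) = 0"
      using axis[OF tr(1,2)] by (simp add: sphere_mean_def)
    ultimately have "\<bar>?m (t, r)\<bar> \<le> \<epsilon>" by (simp add: dist_real_def)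
    then have "r * \<bar>?m (t, r)\<bar> \<le> r * \<epsilon>" using tr by (intro mult_left_mono) auto
    also have "\<dots> \<le> \<epsilon> * (\<xi> - \<eta>)"
      using * \<open>\<epsilon> > 0\<close> by (simp add: r_def)
    finally show "\<bar>light_cone_mean u \<xi> \<eta>\<bar> \<le> \<epsilon> * (\<xi> - \<eta>)"
      using tr by (simp add: light_cone_mean_def t_def[symmetric] r_def[symmetric] abs_mult)
  qed (fact \<delta>)
qed

text \<open>
  A radial coefficient is constant on each sphere, so it comes out of the spherical mean.
\<close>

lemma light_cone_mean_linear_radial:
  fixes u v :: "'j::finite \<Rightarrow> real \<times> 'a::euclidean_space \<Rightarrow> real"
  assumes u: "\<And>j. continuous_on UNIV (u j)" and v: "\<And>j. continuous_on UNIV (v j)" and h: "continuous_on UNIV h"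
    and eq: "\<And>t x. h (t, x) = (\<Sum>j\<in>UNIV. \<alpha> j (norm x) * u j (t, x) + \<beta> j (norm x) * v j (t, x))"
    and "\<eta> \<le> \<xi>"
  shows "light_cone_mean h \<xi> \<eta> = (\<Sum>j\<in>UNIV. \<alpha> j ((\<xi> - \<eta>) / 2) * light_cone_mean (u j) \<xi> \<eta>
      + \<beta> j ((\<xi> - \<eta>) / 2) * light_cone_mean (v j) \<xi> \<eta>)"
proof -
  define t where "t = (\<xi> + \<eta>) / 2"
  define r where "r = (\<xi> - \<eta>) / 2"
  have r: "r \<ge> 0" using assms by (simp add: r_def)
  have slice: "continuous_on UNIV (\<lambda>x. f (t, x))" if "continuous_on UNIV f" for f :: "real \<times> 'a \<Rightarrow> real"
    by (rule continuous_on_compose2[OF that]) (auto intro!: continuous_intros)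
  have cont: "continuous_on UNIV (\<lambda>x. c * u j (t, x))" "continuous_on UNIV (\<lambda>x. c * v j (t, x))" for c j
    by (intro continuous_intros slice u v)+
  have "sphere_mean (\<lambda>x. h (t, x)) r
      = sphere_mean (\<lambda>x. \<Sum>j\<in>UNIV. \<alpha> j r * u j (t, x) + \<beta> j r * v j (t, x)) r"
  proof (rule sphere_mean_cong)
    show "(\<lambda>x. h (t, x)) \<in> borel_measurable borel"
      by (intro borel_measurable_continuous_onI slice h)
    show "(\<lambda>x. \<Sum>j\<in>UNIV. \<alpha> j r * u j (t, x) + \<beta> j r * v j (t, x)) \<in> borel_measurable borel"
      by (intro borel_measurable_continuous_onI continuous_on_sum continuous_on_add cont)
  qed (use r eq in simp)
  also have "\<dots> = (\<Sum>j\<in>UNIV. \<alpha> j r * sphere_mean (\<lambda>x. u j (t, x)) r + \<beta> j r * sphere_mean (\<lambda>x. v j (t, x)) r)"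
    by (simp add: sphere_mean_sum continuous_on_add cont sphere_mean_add sphere_mean_mult_right)
  finally show ?thesis
    by (simp add: light_cone_mean_def t_def[symmetric] r_def[symmetric] sum_distrib_left distrib_left mult.left_commute)
qed

text \<open>
  What the three classes have in common: the difference of two members is a scalar function times a
  constant matrix that maps \<open>(1, 1)\<close> to a positive multiple of itself. This multiple is \<open>2\<close> in the
  first class and \<open>1\<close> in the others.
\<close>

lemma admissible_difference:
  fixes P :: "nat \<Rightarrow> real^3 \<Rightarrow> real^2^2"
  assumes "p \<in> {1, 2, 3}" and P1: "P 1 \<in> admissible p f g" and P2: "P 2 \<in> admissible p f g"
  obtains E :: "2 \<Rightarrow> 2 \<Rightarrow> real" and c :: real and i0 j0 :: 2
  where "c > 0" "\<And>i. (\<Sum>j\<in>UNIV. E i j) = c"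
    "\<And>x i j. P 1 x $ i $ j - P 2 x $ i $ j = E i j * (P 1 x $ i0 $ j0 - P 2 x $ i0 $ j0)"
proof -
  consider "p = 1" | "p = 2" | "p = 3" using assms(1) by auto
  then show thesis
  proof cases
    case 1
    have "P 1 x $ i $ j - P 2 x $ i $ j = 1 * (P 1 x $ 1 $ 1 - P 2 x $ 1 $ 1)" for x i j
      proof -
      have Q1: "P 1 \<in> A1" and Q2: "P 2 \<in> A1" using P1 P2 1 by (simp_all add: admissible_def)
      show ?thesis
        using Q1[unfolded A1_def mem_Collect_eq, rule_format, of x] Q2[unfolded A1_def mem_Collect_eq, rule_format, of x]
          exhaust_2[of i] exhaust_2[of j] by (elim disjE) simp_all
    qed
    from that[of 2 "\<lambda>_ _. 1" 1 1, OF _ _ this] show thesis by simp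
  next
    case 2
    have "P 1 x $ i $ j - P 2 x $ i $ j = (if i = j then 1 else 0) * (P 1 x $ 1 $ 1 - P 2 x $ 1 $ 1)" for x i j
      proof -
      have Q1: "P 1 \<in> A2 f g" and Q2: "P 2 \<in> A2 f g" using P1 P2 2 by (simp_all add: admissible_def)
      show ?thesis
        using Q1[unfolded A2_def mem_Collect_eq, rule_format, of x] Q2[unfolded A2_def mem_Collect_eq, rule_format, of x]
          exhaust_2[of i] exhaust_2[of j] by (elim disjE) simp_all
    qed
    from that[of 1 "\<lambda>i j. if i = j then 1 else 0" 1 1, OF _ _ this] show thesis by simp
  next
    case 3
    have "P 1 x $ i $ j - P 2 x $ i $ j = (if i = j then 0 else 1) * (P 1 x $ 1 $ 2 - P 2 x $ 1 $ 2)" for x i j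
      proof -
      have Q1: "P 1 \<in> A3 f g" and Q2: "P 2 \<in> A3 f g" using P1 P2 3 by (simp_all add: admissible_def)
      show ?thesis
        using Q1[unfolded A3_def mem_Collect_eq, rule_format, of x] Q2[unfolded A3_def mem_Collect_eq, rule_format, of x]
          exhaust_2[of i] exhaust_2[of j] by (elim disjE) simp_all
    qed
    moreover have "(\<Sum>j\<in>UNIV. if i = j then 0 else 1) = (1::real)" for i :: 2
      using exhaust_2[of i] by (auto simp: UNIV_2)
    ultimately show thesis
      by (rule that[of 1 "\<lambda>i j. if i = j then 0 else 1" 1 2, OF zero_less_one, rotated])
  qed
qed

lemma regular_part_cone_data:
  assumes R: "regular_part P U R" and P: "\<And>i j. smooth (\<lambda>x. P x $ i $ j)"
  shows "R (norm x, x) $ i = 1 / (8 * pi) * integral {0..1} (\<lambda>s. \<Sum>j\<in>UNIV. P (s *\<^sub>R x) $ i $ j)"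
proof -
  have entry: "continuous_on {0..1} (\<lambda>s. P (s *\<^sub>R x) $ i $ j)" for i j
    by (rule continuous_on_compose2[OF smooth_imp_continuous[OF P, of UNIV]]) (auto intro!: continuous_intros)
  have nth: "(P (s *\<^sub>R x) *v vec 1) $ i = (\<Sum>j\<in>UNIV. P (s *\<^sub>R x) $ i $ j)" for s i
    by (simp add: matrix_vector_mult_def)
  have "P (s *\<^sub>R x) *v vec 1 = (\<chi> i. \<Sum>j\<in>UNIV. P (s *\<^sub>R x) $ i $ j)" for s
    unfolding vec_eq_iff by (intro allI) (simp only: nth vec_lambda_beta)
  then have "continuous_on {0..1} (\<lambda>s. P (s *\<^sub>R x) *v vec 1)"
    by (simp only:) (intro continuous_on_vec_lambda continuous_on_sum entry)
  then have "(\<lambda>s. P (s *\<^sub>R x) *v vec 1) integrable_on {0..1}"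
    by (rule integrable_continuous_real)
  then have "integral {0..1} ((\<lambda>v. v $ i) \<circ> (\<lambda>s. P (s *\<^sub>R x) *v vec 1)) = integral {0..1} (\<lambda>s. P (s *\<^sub>R x) *v vec 1) $ i"
    by (rule integral_linear[OF _ bounded_linear_vec_nth])
  then have "integral {0..1} (\<lambda>s. P (s *\<^sub>R x) *v vec 1) $ i = integral {0..1} (\<lambda>s. \<Sum>j\<in>UNIV. P (s *\<^sub>R x) $ i $ j)"
    by (simp only: comp_def nth)
  moreover have "R (norm x, x) = (1 / (8 * pi)) *\<^sub>R integral {0..1} (\<lambda>s. P (s *\<^sub>R x) *v vec 1)"
    using R unfolding regular_part_def by blast
  ultimately show ?thesis by (simp only: vector_scaleR_component real_scaleR_def)
qed

lemma bounded_finite_family: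
  fixes f :: "'i::finite \<Rightarrow> 'a::topological_space \<Rightarrow> real"
  assumes "compact K" "\<And>i. continuous_on K (f i)"
  obtains C where "\<And>i x. x \<in> K \<Longrightarrow> \<bar>f i x\<bar> \<le> C"
proof -
  have "\<exists>B. \<forall>x\<in>K. \<bar>f i x\<bar> \<le> B" for i
    using compact_imp_bounded[OF compact_continuous_image[OF assms(2,1)], of i]
    by (auto simp: bounded_iff)
  then obtain B where B: "\<And>i x. x \<in> K \<Longrightarrow> \<bar>f i x\<bar> \<le> B i" by metis
  have "\<bar>f i x\<bar> \<le> (\<Sum>i\<in>UNIV. \<bar>B i\<bar>)" if "x \<in> K" for i x
  proof -
    have "\<bar>f i x\<bar> \<le> \<bar>B i\<bar>" using B[OF that, of i] by linarith
    also have "\<dots> \<le> (\<Sum>i\<in>UNIV. \<bar>B i\<bar>)" by (intro member_le_sum) auto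
    finally show ?thesis .
  qed
  then show thesis by (rule that)
qed

theorem theorem1p2:
  fixes T :: real
    and p :: nat
    and f g :: "real^3 \<Rightarrow> real"
    and P :: "nat \<Rightarrow> real^3 \<Rightarrow> real^2^2"
    and U :: "nat \<Rightarrow> (spacetime \<Rightarrow> real) \<Rightarrow> real^2"
    and R :: "nat \<Rightarrow> spacetime \<Rightarrow> real^2"
  assumes "T > 0"
    and "p \<in> {1, 2, 3}"
    and "\<And>k. k \<in> {1, 2} \<Longrightarrow> P k \<in> admissible p f g"
    and "\<And>k i j. k \<in> {1, 2} \<Longrightarrow> smooth (\<lambda>x. P k x $ i $ j)"
    and "\<And>k. k \<in> {1, 2} \<Longrightarrow> solves_ivp (P k) (U k)"
    and "\<And>k. k \<in> {1, 2} \<Longrightarrow> regular_part (P k) (U k) (R k)"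
    and "\<And>k i j. k \<in> {1, 2} \<Longrightarrow>
           \<exists>b :: real \<Rightarrow> real. \<forall>x. P k x $ i $ j = b (norm x)"
    and "\<And>t. t \<in> {0<..T} \<Longrightarrow> R 1 (t, 0) = R 2 (t, 0)"
  shows "\<forall>x. norm x \<le> T / 2 \<longrightarrow> P 1 x = P 2 x"
proof -
  have admissible: "P 1 \<in> admissible p f g" "P 2 \<in> admissible p f g"
    using assms(3) by simp_all
  obtain E :: "2 \<Rightarrow> 2 \<Rightarrow> real" and c :: real and i0 j0 :: 2
    where c: "c > 0" and E_sum: "\<And>i. (\<Sum>j\<in>UNIV. E i j) = c"
      and E: "\<And>x i j. P 1 x $ i $ j - P 2 x $ i $ j = E i j * (P 1 x $ i0 $ j0 - P 2 x $ i0 $ j0)"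
    by (rule admissible_difference[OF assms(2) admissible]) (rule that)
  \<comment> \<open>The radial profiles, read off along a fixed ray; this makes their continuity evident.\<close>
  define \<alpha> where "\<alpha> k i j r = P k (r *\<^sub>R axis 1 1) $ i $ j" for k i j and r :: real
  define b where "b r = \<alpha> 1 i0 j0 r - \<alpha> 2 i0 j0 r" for r
  have radial: "P k x $ i $ j = \<alpha> k i j (norm x)" if k: "k \<in> {1, 2}" for k i j x
  proof -
    obtain \<beta> :: "real \<Rightarrow> real" where "\<And>x. P k x $ i $ j = \<beta> (norm x)"
      using assms(7)[OF k] by blast
    then show ?thesis by (simp add: \<alpha>_def norm_axis_1)
  qed
  have difference: "P 1 x $ i $ j - P 2 x $ i $ j = E i j * b (norm x)" for x i j
    by (subst E) (simp add: radial b_def)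
  have P_cont: "continuous_on S (\<lambda>x. P k x $ i $ j)" if "k \<in> {1, 2}" for k i j S
    by (rule smooth_imp_continuous[OF assms(4)[OF that]])
  have \<alpha>_cont: "continuous_on S (\<alpha> k i j)" if "k \<in> {1, 2}" for k i j S
    unfolding \<alpha>_def[abs_def]
    by (rule continuous_on_compose2[OF P_cont[OF that, of UNIV]]) (auto intro!: continuous_intros)
  have b_cont: "continuous_on S b" for S
    unfolding b_def[abs_def] by (intro continuous_on_diff \<alpha>_cont) auto
  have R_cont: "continuous_on closed_cone (R k)" if "k \<in> {1, 2}" for k
    using assms(6)[OF that] by (auto simp: regular_part_def intro: C1_on_imp_continuous)
  define v where "v k i z = cone_extension (R k) z $ i" for k i z
  have v_cont: "continuous_on S (v k i)" if "k \<in> {1, 2}" for k i S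
    unfolding v_def[abs_def] by (rule continuous_cone_extension_nth[OF R_cont[OF that]])
  define u where "u i z = v 1 i z - v 2 i z" for i z
  define h where "h i z = (\<Sum>j\<in>UNIV. P 1 (snd z) $ i $ j * v 1 j z) - (\<Sum>j\<in>UNIV. P 2 (snd z) $ i $ j * v 2 j z)" for i z
  have u_cont: "continuous_on S (u i)" for i S
    unfolding u_def[abs_def] by (intro continuous_on_diff v_cont) auto
  have h_cont: "continuous_on S (h i)" for i S
    unfolding h_def[abs_def]
    by (intro continuous_on_diff continuous_on_sum continuous_on_mult v_cont
        continuous_on_compose2[OF P_cont[of _ UNIV]] continuous_on_snd continuous_on_id) auto
  have weak: "(LINT z|lborel. u i z * dalembertian \<phi> z) = (LINT z|lborel. h i z * \<phi> z)"
    if \<phi>: "\<phi> \<in> test_functions open_cone" for i \<phi>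
  proof -
    have k: "1 \<in> {1, 2::nat}" "2 \<in> {1, 2::nat}" by auto
    note W = regular_part_weak_equation[OF assms(6) assms(4) \<phi>, folded v_def]
    have "(LINT z|lborel. u i z * dalembertian \<phi> z)
        = (LINT z|lborel. v 1 i z * dalembertian \<phi> z) - (LINT z|lborel. v 2 i z * dalembertian \<phi> z)"
      unfolding u_def left_diff_distrib by (rule Bochner_Integration.integral_diff[OF W(2)[OF k(1) k(1)] W(2)[OF k(2) k(2)]])
    also have "\<dots> = (LINT z|lborel. h i z * \<phi> z)"
      unfolding h_def left_diff_distrib W(1)[OF k(1) k(1)] W(1)[OF k(2) k(2)]
      by (rule Bochner_Integration.integral_diff[OF W(3)[OF k(1) k(1)] W(3)[OF k(2) k(2)], symmetric])
    finally show ?thesis .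
  qed
  \<comment> \<open>At \<open>t = 0\<close> this holds by continuity only.\<close>
  have axis: "u i (t, 0) = 0" if t: "0 \<le> t" "t \<le> T" for i t
  proof -
    have "continuous_on (closure {0<..T}) (\<lambda>t. u i (t, 0))"
      by (rule continuous_on_compose2[OF u_cont[of UNIV]]) (auto intro!: continuous_intros)
    moreover have "u i (t, 0) = 0" if "t \<in> {0<..T}" for t
      using that assms(8)[OF that] by (simp add: u_def v_def cone_extension_eq)
    ultimately have "u i (t, 0) = 0" if "t \<in> closure {0<..T}" for t
      using continuous_constant_on_closure[of "{0<..T}" "\<lambda>t. u i (t, 0)" 0 t] that by simp
    then show ?thesis using t \<open>T > 0\<close> by simp
  qed
  have cone: "light_cone_mean (u i) \<xi> 0 = c / (16 * pi) * integral {0..\<xi>} (\<lambda>s. b (s / 2))" if "0 \<le> \<xi>" for i \<xi>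
  proof -
    define r where "r = \<xi> / 2"
    have r: "0 \<le> r" using that by (simp add: r_def)
    have "u i (r, x) = c / (8 * pi) * integral {0..1} (\<lambda>s. b (s * r))" if x: "norm x = r" for x
    proof -
      have int: "(\<lambda>s. \<Sum>j\<in>UNIV. P k (s *\<^sub>R x) $ i $ j) integrable_on {0..1}" if "k \<in> {1, 2}" for k
        by (intro integrable_continuous_real continuous_on_sum continuous_on_compose2[OF P_cont[OF that, of UNIV]]
            continuous_on_scaleR continuous_on_id continuous_on_const) auto
      have "u i (r, x) = R 1 (norm x, x) $ i - R 2 (norm x, x) $ i"
        using x by (simp add: u_def v_def cone_extension_eq)
      also have "\<dots> = 1 / (8 * pi) * (integral {0..1} (\<lambda>s. \<Sum>j\<in>UNIV. P 1 (s *\<^sub>R x) $ i $ j)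
          - integral {0..1} (\<lambda>s. \<Sum>j\<in>UNIV. P 2 (s *\<^sub>R x) $ i $ j))"
        by (simp add: regular_part_cone_data[OF assms(6) assms(4)] right_diff_distrib)
      also have "\<dots> = 1 / (8 * pi) * integral {0..1} (\<lambda>s. (\<Sum>j\<in>UNIV. P 1 (s *\<^sub>R x) $ i $ j)
          - (\<Sum>j\<in>UNIV. P 2 (s *\<^sub>R x) $ i $ j))"
        by (subst integral_diff[OF int int]) auto
      also have "integral {0..1} (\<lambda>s. (\<Sum>j\<in>UNIV. P 1 (s *\<^sub>R x) $ i $ j) - (\<Sum>j\<in>UNIV. P 2 (s *\<^sub>R x) $ i $ j))
          = integral {0..1} (\<lambda>s. c * b (s * r))"
        by (rule integral_cong)
           (simp add: sum_subtractf[symmetric] difference sum_distrib_right[symmetric] E_sum x del: One_nat_def)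
      finally show ?thesis by simp
    qed
    note on_sphere = this
    have meas: "(\<lambda>x. u i (r, x)) \<in> borel_measurable borel"
      by (intro borel_measurable_continuous_onI continuous_on_compose2[OF u_cont[of UNIV]]
          continuous_on_Pair continuous_on_const continuous_on_id) auto
    have "sphere_mean (\<lambda>x. u i (r, x)) r = sphere_mean (\<lambda>x::real^3. c / (8 * pi) * integral {0..1} (\<lambda>s. b (s * r))) r"
      by (rule sphere_mean_cong[OF meas]) (use on_sphere r in auto)
    then have "light_cone_mean (u i) \<xi> 0 = r * (c / (8 * pi) * integral {0..1} (\<lambda>s. b (s * r)))"
      by (simp add: light_cone_mean_def r_def)
    moreover have "integral {0..\<xi>} (\<lambda>s. b (s / 2)) = \<xi> * integral {0..1} (\<lambda>s. b (s * r))"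
      using integral_unit_interval[of 0 \<xi> "\<lambda>s. b (s / 2)"] that
      by (simp add: r_def continuous_on_compose2[OF b_cont[of UNIV]] continuous_intros)
    ultimately show ?thesis by (simp add: r_def)
  qed
  have source: "light_cone_mean (h i) \<xi> \<eta> = (\<Sum>j\<in>UNIV. \<alpha> 1 i j ((\<xi> - \<eta>) / 2) * light_cone_mean (u j) \<xi> \<eta>
      + E i j * b ((\<xi> - \<eta>) / 2) * light_cone_mean (v 2 j) \<xi> \<eta>)" if "\<eta> \<le> \<xi>" for i \<xi> \<eta>
  proof (rule light_cone_mean_linear_radial[where \<beta>="\<lambda>j r. E i j * b r"])
    fix t and x :: "real^3"
    have "h i (t, x) = (\<Sum>j\<in>UNIV. P 1 x $ i $ j * u j (t, x) + (P 1 x $ i $ j - P 2 x $ i $ j) * v 2 j (t, x))"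
      by (simp add: h_def u_def sum_subtractf[symmetric] algebra_simps)
    then show "h i (t, x) = (\<Sum>j\<in>UNIV. \<alpha> 1 i j (norm x) * u j (t, x) + E i j * b (norm x) * v 2 j (t, x))"
      unfolding difference by (simp add: radial)
  qed (use that u_cont v_cont h_cont in auto)
  obtain C1 where "\<And>(q :: 2 \<times> 2) r. r \<in> {0..T} \<Longrightarrow> \<bar>\<alpha> 1 (fst q) (snd q) r\<bar> \<le> C1"
    using bounded_finite_family[of "{0..T}" "\<lambda>q :: 2 \<times> 2. \<alpha> 1 (fst q) (snd q)"] \<alpha>_cont by auto
  then have C1: "\<bar>\<alpha> 1 i j r\<bar> \<le> C1" if "r \<in> {0..T}" for i j r
    using that by (metis fst_conv snd_conv)
  let ?g = "\<lambda>(q :: 2 \<times> 2) z. E (fst q) (snd q) * (\<lambda>(\<xi>, \<eta>). light_cone_mean (v 2 (snd q)) \<xi> \<eta>) z"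
  have "continuous_on ({0..T} \<times> {0..T}) (?g q)" for q
    by (intro continuous_on_mult continuous_on_const continuous_on_subset[OF continuous_light_cone_mean[OF v_cont]]) auto
  then obtain C2 where C2': "\<And>q z. z \<in> {0..T} \<times> {0..T} \<Longrightarrow> \<bar>?g q z\<bar> \<le> C2"
    using bounded_finite_family[of "{0..T} \<times> {0..T}" ?g] compact_Times[OF compact_Icc compact_Icc] by blast
  have C2: "\<bar>E i j * light_cone_mean (v 2 j) \<xi> \<eta>\<bar> \<le> C2" if "\<xi> \<in> {0..T}" "\<eta> \<in> {0..T}" for i j \<xi> \<eta>
    using C2'[of "(\<xi>, \<eta>)" "(i, j)"] that by simp
  have C: "0 \<le> C1" "0 \<le> C2"
    using C1[of 0 1 1] C2[of 0 0 1 1] \<open>T > 0\<close> by auto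
  have bound: "\<bar>light_cone_mean (h i) \<xi> \<eta>\<bar> \<le> (C1 + 2 * C2) * ((\<Sum>j\<in>UNIV. \<bar>light_cone_mean (u j) \<xi> \<eta>\<bar>) + \<bar>b ((\<xi> - \<eta>) / 2)\<bar>)"
    if *: "0 \<le> \<eta>" "\<eta> \<le> \<xi>" "\<xi> \<le> T" for i \<xi> \<eta>
  proof -
    let ?b = "\<bar>b ((\<xi> - \<eta>) / 2)\<bar>" and ?S = "\<Sum>j\<in>UNIV. \<bar>light_cone_mean (u j) \<xi> \<eta>\<bar>"
    have "\<bar>light_cone_mean (h i) \<xi> \<eta>\<bar> \<le> (\<Sum>j\<in>UNIV. \<bar>\<alpha> 1 i j ((\<xi> - \<eta>) / 2) * light_cone_mean (u j) \<xi> \<eta>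
      + E i j * b ((\<xi> - \<eta>) / 2) * light_cone_mean (v 2 j) \<xi> \<eta>\<bar>)"
      unfolding source[OF *(2)] by (rule sum_abs)
    also have "\<dots> \<le> (\<Sum>j\<in>(UNIV :: 2 set). C1 * \<bar>light_cone_mean (u j) \<xi> \<eta>\<bar> + C2 * ?b)"
    proof (rule sum_mono)
      fix j :: 2
      have "\<bar>\<alpha> 1 i j ((\<xi> - \<eta>) / 2)\<bar> * \<bar>light_cone_mean (u j) \<xi> \<eta>\<bar> \<le> C1 * \<bar>light_cone_mean (u j) \<xi> \<eta>\<bar>"
        using * by (intro mult_right_mono C1) auto
      moreover have "\<bar>E i j * light_cone_mean (v 2 j) \<xi> \<eta>\<bar> * ?b \<le> C2 * ?b"
        using * by (intro mult_right_mono C2) auto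
      ultimately show "\<bar>\<alpha> 1 i j ((\<xi> - \<eta>) / 2) * light_cone_mean (u j) \<xi> \<eta>
          + E i j * b ((\<xi> - \<eta>) / 2) * light_cone_mean (v 2 j) \<xi> \<eta>\<bar>
        \<le> C1 * \<bar>light_cone_mean (u j) \<xi> \<eta>\<bar> + C2 * ?b"
        by (intro order_trans[OF abs_triangle_ineq] add_mono) (simp_all add: abs_mult ac_simps)
    qed
    also have "\<dots> = C1 * ?S + 2 * C2 * ?b"
      by (simp add: sum.distrib sum_distrib_left[symmetric])
    also have "\<dots> \<le> (C1 + 2 * C2) * ?S + (C1 + 2 * C2) * ?b"
      using C by (intro add_mono mult_right_mono sum_nonneg) auto
    finally show ?thesis by (simp add: distrib_left)
  qed
  have zero: "b \<rho> = 0" if "0 \<le> \<rho>" "\<rho> \<le> T / 2" for \<rho>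
  proof (rule characteristic_data_unique[where w="\<lambda>i. light_cone_mean (u i)" and F="\<lambda>i. light_cone_mean (h i)"
        and T=T and b=b and \<rho>=\<rho> and \<kappa>="c / (16 * pi)" and C="C1 + 2 * C2"])
    fix i and \<xi> \<eta> :: real assume *: "0 \<le> \<eta>" "\<eta> \<le> \<xi>" "\<xi> \<le> T"
    show "4 * light_cone_mean (u i) \<xi> \<eta> = - wedge_integral (light_cone_mean (h i)) \<eta> \<xi>"
    proof (rule wave_eq_wedge_integral[OF continuous_light_cone_mean[OF h_cont]])
      show "4 * (light_cone_mean (u i) \<xi>2 \<eta>2 - light_cone_mean (u i) \<xi>1 \<eta>2 - light_cone_mean (u i) \<xi>2 \<eta>1
            + light_cone_mean (u i) \<xi>1 \<eta>1) = integral {\<xi>1..\<xi>2} (\<lambda>x. integral {\<eta>1..\<eta>2} (light_cone_mean (h i) x))"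
        if "0 \<le> \<eta>1" "\<eta>1 \<le> \<eta>2" "\<eta>2 \<le> \<xi>1" "\<xi>1 \<le> \<xi>2" for \<eta>1 \<eta>2 \<xi>1 \<xi>2
        by (rule light_cone_rectangle_identity[OF u_cont h_cont weak that])
      show "\<exists>\<delta>>0. \<forall>\<xi> \<eta>. 0 \<le> \<eta> \<and> \<eta> \<le> \<xi> \<and> \<xi> \<le> T \<and> \<xi> - \<eta> < \<delta> \<longrightarrow> \<bar>light_cone_mean (u i) \<xi> \<eta>\<bar> \<le> \<epsilon> * (\<xi> - \<eta>)"
        if "\<epsilon> > 0" for \<epsilon>
        by (rule light_cone_mean_small_near_axis[OF u_cont axis that])
    qed (use * in \<open>simp_all add: light_cone_mean_def\<close>)
  qed (use that \<open>T > 0\<close> c C b_cont cone bound in \<open>auto intro: continuous_light_cone_mean u_cont h_cont\<close>)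
  show ?thesis
  proof (intro allI impI)
    fix x :: "real^3"
    assume "norm x \<le> T / 2"
    then have "P 1 x $ i $ j - P 2 x $ i $ j = 0" for i j
      unfolding difference using zero[of "norm x"] by simp
    then show "P 1 x = P 2 x" by (simp add: vec_eq_iff)
  qed
qed

end
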